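(* Let $k$ be a field and let $A=k[x]/(x^2)$ with basis $\bar 1=1+(x^2)$, $\bar x=x+(x^2)$. Then every unital Hopf algebra coaction on $A$ is equivalent via $\mathrm{id}_A$ to one of the following five unital coactions: (1) $\rho_1\colon A\to A\otimes k$, $\rho_1(a)=a\otimes1$ for all $a\in A$. The cosupport $\mathrm{cosupp}\,\rho_1$ is one-dimensional and consists of all scalar operators on $A$. (2) (if $\mathrm{char}\,k=2$) $\rho_2=\Delta_A$, where the structure of a Hopf algebra on $A$ is defined by $\Delta\bar x=\bar x\otimes\bar1+\bar1\otimes\bar x$, $\varepsilon(\bar x)=0$, $S\bar x=\bar x$. The cosupport $\mathrm{cosupp}\,\rho_2$ is two-dimensional and consists of all linear operators on $A$ that have matrices of the form $\left(\begin{smallmatrix}\alpha&\beta\\0&\alpha\end{smallmatrix}\right)$, $\alpha,\beta\in k$, in the basis $\bar1,\bar x$. (3) (if $\mathrm{char}\,k=2$) $\rho_{3,\theta}=\Delta_{kC_2}$, the comultiplication of the group Hopf algebra $kC_2$, where $C_2=\langle c\rangle$ is the cyclic group of order $2$, $A$ is identified with $kC_2$ via $\bar1\mapsto1$, $\bar x\mapsto\theta(1+c)$, and $\theta\in k\setminus\{0\}$ is a fixed element (so $\rho_{3,\theta}\colon A\to A\otimes kC_2$ corresponds to the standard $C_2$-grading on $kC_2$). The cosupport $\mathrm{cosupp}\,\rho_{3,\theta}$ is two-dimensional and consists of all linear operators on $A$ that have matrices of the form $\left(\begin{smallmatrix}\alpha&\theta(\alpha+\beta)\\0&\beta\end{smallmatrix}\right)$,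 $\alpha,\beta\in k$, in the basis $\bar1,\bar x$. (4) $\rho_4\colon A\to A\otimes kC_\infty$, $\rho_4(\bar x)=\bar x\otimes c$, where $C_\infty=\langle c\rangle$ is the infinite cyclic group. The cosupport $\mathrm{cosupp}\,\rho_4$ is two-dimensional and consists of all linear operators on $A$ that have diagonal matrices in the basis $\bar1,\bar x$. This class of equivalent coactions contains a representative with a finite dimensional coacting Hopf algebra, namely the $kC_2$-coaction $\rho_{4a}\colon A\to A\otimes kC_2$, $\rho_{4a}(\bar x)=\bar x\otimes c$, where $C_2=\langle c\rangle$. (5) $\rho_5\colon A\to A\otimes k\langle c,d,h\rangle/I_0$, $\rho_5(\bar x)=\bar1\otimes\bar h+\bar x\otimes\bar c$, where $k\langle c,d,h\rangle/I_0$ is the Hopf algebra defined in the context. The cosupport $\mathrm{cosupp}\,\rho_5$ is three-dimensional and consists of all linear operators on $A$ that have upper triangular matrices in the basis $\bar1,\bar x$. This class of equivalent coactions contains a representative with a finite dimensional coacting Hopf algebra, namely the coaction $\rho_{5a}\colon A\to A\otimes H_4$ of the Sweedler algebra $H_4$, $\rho_{5a}(\bar x)=\bar x\otimes c+\bar1\otimes cv$. Finally, the coactions $\rho_1,\rho_2,\rho_{3,\theta},\rho_4,\rho_5$ and the corresponding Hopf algebras are $V$-universal for their cosupports $V$.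
   Context: Coactions. For a Hopf algebra $H$ over $k$ and a unital $k$-algebra $A$, an $H$-coaction on $A$ is an algebra homomorphism $\rho\colon A\to A\otimes H$ that makes $A$ a right $H$-comodule; it is unital if $\rho(1_A)=1_A\otimes 1_H$. A (unital) Hopf algebra coaction on $A$ is a (unital) $H$-coaction for some Hopf algebra $H$. Cosupport and equivalence. For $\rho\colon A\to A\otimes H$ put $\rho^\vee(\lambda\otimes a)=\lambda(a_{(1)})a_{(0)}$ for $\lambda\in H^*$, $a\in A$, where $\rho(a)=a_{(0)}\otimes a_{(1)}$. The cosupport is the unital subalgebra $\mathrm{cosupp}\,\rho=\{\rho^\vee(\lambda\otimes(-))\mid\lambda\in H^*\}\subseteq\mathrm{End}_k(A)$. Coactions $\rho_1$ on $A_1$ and $\rho_2$ on $A_2$ are equivalent via an algebra isomorphism $\varphi\colon A_1\to A_2$ if $\varphi(\mathrm{cosupp}\,\rho_1)\varphi^{-1}=\mathrm{cosupp}\,\rho_2$; in particular, coactions on the same $A$ are equivalent via $\mathrm{id}_A$ iff their cosupports coincide. Matrices of operators: the $j$-th column contains the coordinates of the image of the $j$-th basis vector. Universality. For a unital subalgebra $V\subseteq\mathrm{End}_k(A)$, a Hopf algebra $H_0$ with an $H_0$-coaction $\rho_0$ on $A$, $\mathrm{cosupp}\,\rho_0\subseteq V$, is $V$-universal if for every Hopf algebra $H$ and every $H$-coaction $\rho$ on $A$ with $\mathrm{cosupp}\,\rho\subseteq V$ there is a unique Hopf algebra homomorphism $\varphi\colon H_0\to H$ with $\rho=(\mathrm{id}_A\otimes\varphi)\rho_0$.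 Convention: (co)actions on unital associative algebras are assumed unital (so $\bar1\mapsto\bar1\otimes1$ in all cases). The Hopf algebra $k\langle c,d,h\rangle/I_0$: $k\langle c,d,h\rangle$ is the free unital associative algebra, $I_0$ is the two-sided ideal generated by $cd-1$, $dc-1$, $h^2$, $hc+ch$; $\Delta,\varepsilon$ are induced by the unital algebra homomorphisms with $\Delta c=c\otimes c$, $\Delta d=d\otimes d$, $\Delta h=h\otimes c+1\otimes h$, $\varepsilon(c)=\varepsilon(d)=1$, $\varepsilon(h)=0$, and $S$ by the unital anti-homomorphism with $Sc=d$, $Sd=c$, $Sh=-hd$. In $\bar c,\bar h$ the bars denote images in this quotient. Sweedler algebra $H_4$ (any characteristic): generated as a unital algebra by $c,v$ with $c^2=1$, $v^2=0$, $vc=-cv$, basis $1,c,v,cv$; $\Delta c=c\otimes c$, $\Delta v=c\otimes v+v\otimes 1$, $\varepsilon(c)=1$, $\varepsilon(v)=0$, $Sc=c$, $Sv=-cv$. *)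

theory Defs
  imports
    "HOL-Library.Poly_Mapping"
    "HOL-Library.Function_Algebras"
    "HOL-Library.Z2"
    "HOL-Computational_Algebra.Polynomial"
begin

section \<open>Algebras over a field\<close>

text \<open>
  An algebra over the field \<open>'k\<close> is a (nonzero, unital, associative) ring type together with an
  explicit scalar multiplication. Nothing is lost for Hopf algebras, which are nonzero because
  the counit maps 1 to 1.
\<close>

locale k_algebra = vector_space scale
  for scale :: "'k::field \<Rightarrow> 'a::ring_1 \<Rightarrow> 'a" +
  assumes scale_mult_left: "scale c x * y = scale c (x * y)"
    and scale_mult_right: "x * scale c y = scale c (x * y)"

definition algebra_hom ::
  "('k::field \<Rightarrow> 'a::ring_1 \<Rightarrow> 'a) \<Rightarrow> ('k \<Rightarrow> 'b::ring_1 \<Rightarrow> 'b) \<Rightarrow> ('a \<Rightarrow> 'b) \<Rightarrow> bool" where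
  "algebra_hom sA sB f \<longleftrightarrow>
     Vector_Spaces.linear sA sB f \<and> f 1 = 1 \<and> (\<forall>x y. f (x * y) = f x * f y)"

definition algebra_iso ::
  "('k::field \<Rightarrow> 'a::ring_1 \<Rightarrow> 'a) \<Rightarrow> ('k \<Rightarrow> 'b::ring_1 \<Rightarrow> 'b) \<Rightarrow> ('a \<Rightarrow> 'b) \<Rightarrow> bool" where
  "algebra_iso sA sB f \<longleftrightarrow> algebra_hom sA sB f \<and> bij f"


section \<open>Tensor products\<close>

text \<open>
  \<open>'x \<Rightarrow>\<^sub>0 'k\<close> is used as the vector space with basis \<open>'x\<close>; \<open>fext\<close> is the linear
  extension of a map between bases.
\<close>

definition fscale :: "'k::field \<Rightarrow> ('x \<Rightarrow>\<^sub>0 'k) \<Rightarrow> ('x \<Rightarrow>\<^sub>0 'k)" where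
  "fscale c f = Poly_Mapping.map ((*) c) f"

definition fext :: "('x \<Rightarrow> ('y \<Rightarrow>\<^sub>0 'k::field)) \<Rightarrow> ('x \<Rightarrow>\<^sub>0 'k) \<Rightarrow> ('y \<Rightarrow>\<^sub>0 'k)" where
  "fext g f = (\<Sum>x \<in> Poly_Mapping.keys f. fscale (Poly_Mapping.lookup f x) (g x))"

abbreviation fbasis :: "'x \<Rightarrow> ('x \<Rightarrow>\<^sub>0 'k::field)" where
  "fbasis x \<equiv> Poly_Mapping.single x 1"

text \<open>
  \<open>A \<otimes> B\<close> is the quotient of the vector space with basis \<open>A \<times> B\<close> by the subspace
  \<open>bilin_rels\<close>; its elements are cosets. \<open>tcls\<close> is the quotient map, so that
  \<open>tcls sA sB (fbasis (a, b))\<close> is the pure tensor of \<open>a\<close> and \<open>b\<close>. All operations on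
  tensors below are computed on a representative \<open>trep X\<close> of the coset \<open>X\<close>; for the (bi)linear
  data they are applied to, the result does not depend on the representative.
\<close>

definition bilin_rels ::
  "('k::field \<Rightarrow> 'a::ab_group_add \<Rightarrow> 'a) \<Rightarrow> ('k \<Rightarrow> 'b::ab_group_add \<Rightarrow> 'b) \<Rightarrow> ('a \<times> 'b \<Rightarrow>\<^sub>0 'k) set" where
  "bilin_rels sA sB = module.span fscale
     ({fbasis (a + a', b) - fbasis (a, b) - fbasis (a', b) | a a' b. True} \<union>
      {fbasis (a, b + b') - fbasis (a, b) - fbasis (a, b') | a b b'. True} \<union>
      {fbasis (sA c a, b) - fscale c (fbasis (a, b)) | c a b. True} \<union>
      {fbasis (a, sB c b) - fscale c (fbasis (a, b)) | c a b. True})"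

definition tcls ::
  "('k::field \<Rightarrow> 'a::ab_group_add \<Rightarrow> 'a) \<Rightarrow> ('k \<Rightarrow> 'b::ab_group_add \<Rightarrow> 'b) \<Rightarrow>
     ('a \<times> 'b \<Rightarrow>\<^sub>0 'k) \<Rightarrow> ('a \<times> 'b \<Rightarrow>\<^sub>0 'k) set" where
  "tcls sA sB f = {g. g - f \<in> bilin_rels sA sB}"

definition tensor_space ::
  "('k::field \<Rightarrow> 'a::ab_group_add \<Rightarrow> 'a) \<Rightarrow> ('k \<Rightarrow> 'b::ab_group_add \<Rightarrow> 'b) \<Rightarrow>
     ('a \<times> 'b \<Rightarrow>\<^sub>0 'k) set set" where
  "tensor_space sA sB = range (tcls sA sB)"

definition trep :: "'t set \<Rightarrow> 't" where
  "trep X = (SOME f. f \<in> X)"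

text \<open>
  The product on formal sums of pairs with \<open>(a, b) (a', b') = (a a', b b')\<close>. The instance
  \<open>(*)\<close> of \<open>\<Rightarrow>\<^sub>0\<close> is convolution with respect to addition of the keys and is not the
  product of the algebra \<open>A \<otimes> B\<close>.
\<close>

definition ftimes ::
  "('a::ring_1 \<times> 'b::ring_1 \<Rightarrow>\<^sub>0 'k::field) \<Rightarrow> ('a \<times> 'b \<Rightarrow>\<^sub>0 'k) \<Rightarrow> ('a \<times> 'b \<Rightarrow>\<^sub>0 'k)" where
  "ftimes f g = fext (\<lambda>(a, b). fext (\<lambda>(a', b'). fbasis (a * a', b * b')) g) f"

text \<open>\<open>f \<otimes> g\<close> for linear maps \<open>f\<close> and \<open>g\<close>, where \<open>sA\<close>, \<open>sB\<close> belong to the codomains.\<close>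

definition tmap ::
  "('k::field \<Rightarrow> 'a::ab_group_add \<Rightarrow> 'a) \<Rightarrow> ('k \<Rightarrow> 'b::ab_group_add \<Rightarrow> 'b) \<Rightarrow>
     ('c \<Rightarrow> 'a) \<Rightarrow> ('d \<Rightarrow> 'b) \<Rightarrow> ('c \<times> 'd \<Rightarrow>\<^sub>0 'k) set \<Rightarrow> ('a \<times> 'b \<Rightarrow>\<^sub>0 'k) set" where
  "tmap sA sB f g X = tcls sA sB (fext (\<lambda>(c, d). fbasis (f c, g d)) (trep X))"

text \<open>The linear map on a tensor product induced by a bilinear map \<open>\<beta>\<close>.\<close>

definition tlift ::
  "('k::field \<Rightarrow> 'v::ab_group_add \<Rightarrow> 'v) \<Rightarrow> ('a \<Rightarrow> 'b \<Rightarrow> 'v) \<Rightarrow> ('a \<times> 'b \<Rightarrow>\<^sub>0 'k) set \<Rightarrow> 'v" where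
  "tlift sV \<beta> X =
     (\<Sum>(a, b) \<in> Poly_Mapping.keys (trep X). sV (Poly_Mapping.lookup (trep X) (a, b)) (\<beta> a b))"

text \<open>\<open>A \<otimes> B \<otimes> C\<close>, without choosing a bracketing.\<close>

definition trilin_rels ::
  "('k::field \<Rightarrow> 'a::ab_group_add \<Rightarrow> 'a) \<Rightarrow> ('k \<Rightarrow> 'b::ab_group_add \<Rightarrow> 'b) \<Rightarrow>
     ('k \<Rightarrow> 'c::ab_group_add \<Rightarrow> 'c) \<Rightarrow> ('a \<times> 'b \<times> 'c \<Rightarrow>\<^sub>0 'k) set" where
  "trilin_rels sA sB sC = module.span fscale
     ({fbasis (a + a', b, c) - fbasis (a, b, c) - fbasis (a', b, c) | a a' b c. True} \<union>
      {fbasis (a, b + b', c) - fbasis (a, b, c) - fbasis (a, b', c) | a b b' c. True} \<union>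
      {fbasis (a, b, c + c') - fbasis (a, b, c) - fbasis (a, b, c') | a b c c'. True} \<union>
      {fbasis (sA r a, b, c) - fscale r (fbasis (a, b, c)) | r a b c. True} \<union>
      {fbasis (a, sB r b, c) - fscale r (fbasis (a, b, c)) | r a b c. True} \<union>
      {fbasis (a, b, sC r c) - fscale r (fbasis (a, b, c)) | r a b c. True})"

definition tcls3 ::
  "('k::field \<Rightarrow> 'a::ab_group_add \<Rightarrow> 'a) \<Rightarrow> ('k \<Rightarrow> 'b::ab_group_add \<Rightarrow> 'b) \<Rightarrow>
     ('k \<Rightarrow> 'c::ab_group_add \<Rightarrow> 'c) \<Rightarrow> ('a \<times> 'b \<times> 'c \<Rightarrow>\<^sub>0 'k) \<Rightarrow> ('a \<times> 'b \<times> 'c \<Rightarrow>\<^sub>0 'k) set" where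
  "tcls3 sA sB sC f = {g. g - f \<in> trilin_rels sA sB sC}"

text \<open>\<open>\<rho> \<otimes> id\<close> and \<open>id \<otimes> \<Delta>\<close> as maps \<open>A \<otimes> H \<rightarrow> A \<otimes> H \<otimes> H\<close>.\<close>

definition tmap_coact_id ::
  "('k::field \<Rightarrow> 'a::ab_group_add \<Rightarrow> 'a) \<Rightarrow> ('k \<Rightarrow> 'h::ab_group_add \<Rightarrow> 'h) \<Rightarrow>
     ('a \<Rightarrow> ('a \<times> 'h \<Rightarrow>\<^sub>0 'k) set) \<Rightarrow> ('a \<times> 'h \<Rightarrow>\<^sub>0 'k) set \<Rightarrow> ('a \<times> 'h \<times> 'h \<Rightarrow>\<^sub>0 'k) set" where
  "tmap_coact_id sA sH \<rho> X = tcls3 sA sH sH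
     (fext (\<lambda>(a, h). fext (\<lambda>(a', h'). fbasis (a', h', h)) (trep (\<rho> a))) (trep X))"

definition tmap_id_comult ::
  "('k::field \<Rightarrow> 'a::ab_group_add \<Rightarrow> 'a) \<Rightarrow> ('k \<Rightarrow> 'h::ab_group_add \<Rightarrow> 'h) \<Rightarrow>
     ('h \<Rightarrow> ('h \<times> 'h \<Rightarrow>\<^sub>0 'k) set) \<Rightarrow> ('a \<times> 'h \<Rightarrow>\<^sub>0 'k) set \<Rightarrow> ('a \<times> 'h \<times> 'h \<Rightarrow>\<^sub>0 'k) set" where
  "tmap_id_comult sA sH \<Delta> X = tcls3 sA sH sH
     (fext (\<lambda>(a, h). fext (\<lambda>(h', h''). fbasis (a, h', h'')) (trep (\<Delta> h))) (trep X))"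

text \<open>(Not necessarily unital) algebra homomorphisms \<open>C \<rightarrow> A \<otimes> B\<close>.\<close>

definition tensor_algebra_hom ::
  "('k::field \<Rightarrow> 'c::ring_1 \<Rightarrow> 'c) \<Rightarrow> ('k \<Rightarrow> 'a::ring_1 \<Rightarrow> 'a) \<Rightarrow> ('k \<Rightarrow> 'b::ring_1 \<Rightarrow> 'b) \<Rightarrow>
     ('c \<Rightarrow> ('a \<times> 'b \<Rightarrow>\<^sub>0 'k) set) \<Rightarrow> bool" where
  "tensor_algebra_hom sC sA sB \<rho> \<longleftrightarrow>
     (\<forall>x. \<rho> x \<in> tensor_space sA sB) \<and>
     (\<forall>x y. \<rho> (x + y) = tcls sA sB (trep (\<rho> x) + trep (\<rho> y))) \<and>
     (\<forall>r x. \<rho> (sC r x) = tcls sA sB (fscale r (trep (\<rho> x)))) \<and>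
     (\<forall>x y. \<rho> (x * y) = tcls sA sB (ftimes (trep (\<rho> x)) (trep (\<rho> y))))"


section \<open>Hopf algebras and coactions\<close>

record (overloaded) ('k::zero, 'h) hopf =
  scl :: "'k \<Rightarrow> 'h \<Rightarrow> 'h"
  comult :: "'h \<Rightarrow> ('h \<times> 'h \<Rightarrow>\<^sub>0 'k) set"
  counit :: "'h \<Rightarrow> 'k"
  antipode :: "'h \<Rightarrow> 'h"

locale hopf_algebra =
  fixes H :: "('k::field, 'h::ring_1) hopf"
  assumes k_alg: "k_algebra (scl H)"
    and comult_hom: "tensor_algebra_hom (scl H) (scl H) (scl H) (comult H)"
    and comult_one: "comult H 1 = tcls (scl H) (scl H) (fbasis (1, 1))"
    and counit_hom: "algebra_hom (scl H) (*) (counit H)"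
    and coassoc: "tmap_coact_id (scl H) (scl H) (comult H) (comult H h) =
                  tmap_id_comult (scl H) (scl H) (comult H) (comult H h)"
    and counit_left: "tlift (scl H) (\<lambda>x y. scl H (counit H x) y) (comult H h) = h"
    and counit_right: "tlift (scl H) (\<lambda>x y. scl H (counit H y) x) (comult H h) = h"
    and antipode_linear: "Vector_Spaces.linear (scl H) (scl H) (antipode H)"
    and antipode_left: "tlift (scl H) (\<lambda>x y. antipode H x * y) (comult H h) = scl H (counit H h) 1"
    and antipode_right: "tlift (scl H) (\<lambda>x y. x * antipode H y) (comult H h) = scl H (counit H h) 1"

definition hopf_hom ::
  "('k::field, 'h::ring_1) hopf \<Rightarrow> ('k, 'g::ring_1) hopf \<Rightarrow> ('h \<Rightarrow> 'g) \<Rightarrow> bool" where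
  "hopf_hom H G \<phi> \<longleftrightarrow>
     algebra_hom (scl H) (scl G) \<phi> \<and>
     (\<forall>h. comult G (\<phi> h) = tmap (scl G) (scl G) \<phi> \<phi> (comult H h)) \<and>
     (\<forall>h. counit G (\<phi> h) = counit H h) \<and>
     (\<forall>h. antipode G (\<phi> h) = \<phi> (antipode H h))"

definition coaction ::
  "('k::field \<Rightarrow> 'a::ring_1 \<Rightarrow> 'a) \<Rightarrow> ('k, 'h::ring_1) hopf \<Rightarrow> ('a \<Rightarrow> ('a \<times> 'h \<Rightarrow>\<^sub>0 'k) set) \<Rightarrow> bool" where
  "coaction sA H \<rho> \<longleftrightarrow>
     k_algebra sA \<and> hopf_algebra H \<and>
     tensor_algebra_hom sA sA (scl H) \<rho> \<and>
     (\<forall>a. tmap_coact_id sA (scl H) \<rho> (\<rho> a) = tmap_id_comult sA (scl H) (comult H) (\<rho> a)) \<and>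
     (\<forall>a. tlift sA (\<lambda>a' h. sA (counit H h) a') (\<rho> a) = a)"

definition unital_coaction ::
  "('k::field \<Rightarrow> 'a::ring_1 \<Rightarrow> 'a) \<Rightarrow> ('k, 'h::ring_1) hopf \<Rightarrow> ('a \<Rightarrow> ('a \<times> 'h \<Rightarrow>\<^sub>0 'k) set) \<Rightarrow> bool" where
  "unital_coaction sA H \<rho> \<longleftrightarrow> coaction sA H \<rho> \<and> \<rho> 1 = tcls sA (scl H) (fbasis (1, 1))"

definition coact_dual ::
  "('k::field \<Rightarrow> 'a::ring_1 \<Rightarrow> 'a) \<Rightarrow> ('a \<Rightarrow> ('a \<times> 'h \<Rightarrow>\<^sub>0 'k) set) \<Rightarrow> ('h \<Rightarrow> 'k) \<Rightarrow> 'a \<Rightarrow> 'a" where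
  "coact_dual sA \<rho> l a = tlift sA (\<lambda>a' h. sA (l h) a') (\<rho> a)"

definition cosupp ::
  "('k::field \<Rightarrow> 'a::ring_1 \<Rightarrow> 'a) \<Rightarrow> ('k, 'h::ring_1) hopf \<Rightarrow> ('a \<Rightarrow> ('a \<times> 'h \<Rightarrow>\<^sub>0 'k) set) \<Rightarrow>
     ('a \<Rightarrow> 'a) set" where
  "cosupp sA H \<rho> = {coact_dual sA \<rho> l | l. Vector_Spaces.linear (scl H) (*) l}"

definition equivalent_via ::
  "('a::ring_1 \<Rightarrow> 'b::ring_1) \<Rightarrow>
   ('k::field \<Rightarrow> 'a \<Rightarrow> 'a) \<Rightarrow> ('k, 'h::ring_1) hopf \<Rightarrow> ('a \<Rightarrow> ('a \<times> 'h \<Rightarrow>\<^sub>0 'k) set) \<Rightarrow>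
   ('k \<Rightarrow> 'b \<Rightarrow> 'b) \<Rightarrow> ('k, 'g::ring_1) hopf \<Rightarrow> ('b \<Rightarrow> ('b \<times> 'g \<Rightarrow>\<^sub>0 'k) set) \<Rightarrow> bool" where
  "equivalent_via \<phi> sA H \<rho> sB G \<sigma> \<longleftrightarrow>
     algebra_iso sA sB \<phi> \<and> (\<lambda>T. \<phi> \<circ> T \<circ> inv \<phi>) ` cosupp sA H \<rho> = cosupp sB G \<sigma>"

definition op_scale :: "('k::field \<Rightarrow> 'a \<Rightarrow> 'a) \<Rightarrow> 'k \<Rightarrow> ('a \<Rightarrow> 'a) \<Rightarrow> ('a \<Rightarrow> 'a)" where
  "op_scale sA c T = (\<lambda>a. sA c (T a))"

definition unital_subalgebra_End ::
  "('k::field \<Rightarrow> 'a::ring_1 \<Rightarrow> 'a) \<Rightarrow> ('a \<Rightarrow> 'a) set \<Rightarrow> bool" where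
  "unital_subalgebra_End sA V \<longleftrightarrow>
     (\<forall>T\<in>V. Vector_Spaces.linear sA sA T) \<and> module.subspace (op_scale sA) V \<and>
     id \<in> V \<and> (\<forall>T\<in>V. \<forall>U\<in>V. T \<circ> U \<in> V)"

text \<open>
  HOL cannot quantify over types inside a formula, so the universal property is tested on Hopf
  algebras whose underlying type is the type \<open>'h\<close> passed as a parameter; it is meant to be used
  with an arbitrary (free) type \<open>'h\<close>.
\<close>

definition V_universal ::
  "'h::ring_1 itself \<Rightarrow> ('k::field \<Rightarrow> 'a::ring_1 \<Rightarrow> 'a) \<Rightarrow> ('a \<Rightarrow> 'a) set \<Rightarrow>
     ('k, 'g::ring_1) hopf \<Rightarrow> ('a \<Rightarrow> ('a \<times> 'g \<Rightarrow>\<^sub>0 'k) set) \<Rightarrow> bool" where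
  "V_universal TH sA V H0 \<rho>0 \<longleftrightarrow>
     unital_subalgebra_End sA V \<and> hopf_algebra H0 \<and> unital_coaction sA H0 \<rho>0 \<and>
     cosupp sA H0 \<rho>0 \<subseteq> V \<and>
     (\<forall>(H :: ('k, 'h) hopf) \<rho>.
        hopf_algebra H \<and> unital_coaction sA H \<rho> \<and> cosupp sA H \<rho> \<subseteq> V \<longrightarrow>
        (\<exists>!\<phi>. hopf_hom H0 H \<phi> \<and> (\<forall>a. \<rho> a = tmap sA (scl H) id \<phi> (\<rho>0 a))))"


section \<open>The algebra $k[x]/(x^2)$\<close>

quotient_type (overloaded) 'k dual_num = "'k::field poly" / "\<lambda>p q. [:0, 1:] ^ 2 dvd p - q"
proof (rule equivpI)
  show "reflp (\<lambda>p q::'k poly. [:0, 1:] ^ 2 dvd p - q)"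
    by (auto intro: reflpI)
  show "symp (\<lambda>p q::'k poly. [:0, 1:] ^ 2 dvd p - q)"
    by (auto intro!: sympI simp: dvd_diff_commute)
  show "transp (\<lambda>p q::'k poly. [:0, 1:] ^ 2 dvd p - q)"
  proof (rule transpI)
    fix p q r :: "'k poly"
    assume "[:0, 1:] ^ 2 dvd p - q" "[:0, 1:] ^ 2 dvd q - r"
    then have "[:0, 1:] ^ 2 dvd (p - q) + (q - r)" by (rule dvd_add)
    then show "[:0, 1:] ^ 2 dvd p - r" by simp
  qed
qed

lemma dual_num_dvd_iff:
  "[:0, 1:] ^ 2 dvd p \<longleftrightarrow> coeff p 0 = 0 \<and> coeff p 1 = (0::'k::field)"
proof -
  have sq: "[:0, 1:] ^ 2 = (monom 1 2 :: 'k poly)"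
    by (simp add: monom_altdef)
  show ?thesis
    unfolding sq monom_1_dvd_iff' by (auto simp: less_2_cases_iff)
qed

instantiation dual_num :: (field) comm_ring_1
begin

lift_definition zero_dual_num :: "'a dual_num" is 0 .
lift_definition one_dual_num :: "'a dual_num" is 1 .
lift_definition plus_dual_num :: "'a dual_num \<Rightarrow> 'a dual_num \<Rightarrow> 'a dual_num" is "(+)"
  by (auto simp: dual_num_dvd_iff)
lift_definition minus_dual_num :: "'a dual_num \<Rightarrow> 'a dual_num \<Rightarrow> 'a dual_num" is "(-)"
  by (auto simp: dual_num_dvd_iff)
lift_definition uminus_dual_num :: "'a dual_num \<Rightarrow> 'a dual_num" is uminus
  by (auto simp: dual_num_dvd_iff)
lift_definition times_dual_num :: "'a dual_num \<Rightarrow> 'a dual_num \<Rightarrow> 'a dual_num" is "(*)"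
  by (auto simp: dual_num_dvd_iff coeff_mult)

instance
  by standard
    (transfer; simp add: algebra_simps dual_num_dvd_iff)+

end

lift_definition dn_scale :: "'k::field \<Rightarrow> 'k dual_num \<Rightarrow> 'k dual_num" is smult
  by (auto simp: dual_num_dvd_iff)

lift_definition dn_x :: "'k::field dual_num" is "[:0, 1:]" .

lift_definition dn_coord1 :: "'k::field dual_num \<Rightarrow> 'k" is "\<lambda>p. coeff p 0"
  by (auto simp: dual_num_dvd_iff)
lift_definition dn_coordx :: "'k::field dual_num \<Rightarrow> 'k" is "\<lambda>p. coeff p 1"
  by (auto simp: dual_num_dvd_iff)

lemma dn_coords_unique:
  "a = dn_scale \<alpha> 1 + dn_scale \<beta> dn_x \<longleftrightarrow> \<alpha> = dn_coord1 a \<and> \<beta> = dn_coordx a"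
  by transfer (auto simp: dual_num_dvd_iff)

text \<open>
  \<open>has_matrix T a b c d\<close>: in the basis \<open>1, x\<close> the matrix of \<open>T\<close> has rows \<open>(a b)\<close> and
  \<open>(c d)\<close>; its columns are the coordinates of \<open>T 1\<close> and \<open>T x\<close>.
\<close>

definition has_matrix :: "('k::field dual_num \<Rightarrow> 'k dual_num) \<Rightarrow> 'k \<Rightarrow> 'k \<Rightarrow> 'k \<Rightarrow> 'k \<Rightarrow> bool" where
  "has_matrix T a b c d \<longleftrightarrow>
     Vector_Spaces.linear dn_scale dn_scale T \<and>
     T 1 = dn_scale a 1 + dn_scale c dn_x \<and>
     T dn_x = dn_scale b 1 + dn_scale d dn_x"

text \<open>The linear map on \<open>k[x]/(x\<^sup>2)\<close> with \<open>1 \<mapsto> 1 \<otimes> 1\<close> and \<open>x \<mapsto> t\<close>.\<close>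

definition dn_tensor_map ::
  "('k::field \<Rightarrow> 'h::ring_1 \<Rightarrow> 'h) \<Rightarrow> ('k dual_num \<times> 'h \<Rightarrow>\<^sub>0 'k) \<Rightarrow>
     'k dual_num \<Rightarrow> ('k dual_num \<times> 'h \<Rightarrow>\<^sub>0 'k) set" where
  "dn_tensor_map sH t a =
     tcls dn_scale sH (fscale (dn_coord1 a) (fbasis (1, 1)) + fscale (dn_coordx a) t)"


section \<open>The coacting Hopf algebras\<close>

definition base_hopf :: "('k::field, 'k) hopf" where
  "base_hopf = \<lparr>scl = (*), comult = (\<lambda>r. tcls (*) (*) (fbasis (r, 1))),
                counit = (\<lambda>r. r), antipode = (\<lambda>r. r)\<rparr>"

text \<open>The Hopf algebra structure with primitive \<open>x\<close>; it exists in characteristic 2 only.\<close>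

definition dual_num_hopf :: "('k::field, 'k dual_num) hopf" where
  "dual_num_hopf = \<lparr>scl = dn_scale,
     comult = dn_tensor_map dn_scale (fbasis (dn_x, 1) + fbasis (1, dn_x)),
     counit = dn_coord1,
     antipode = (\<lambda>a. dn_scale (dn_coord1 a) 1 + dn_scale (dn_coordx a) dn_x)\<rparr>"

text \<open>
  The group algebra of a group \<open>'g\<close> written additively is \<open>'g \<Rightarrow>\<^sub>0 'k\<close> with its library
  (convolution) product; \<open>fbasis g\<close> is the group element \<open>g\<close>. We use \<open>'g = bit\<close> for \<open>C\<^sub>2\<close> and
  \<open>'g = int\<close> for the infinite cyclic group, both generated by \<open>1\<close>.
\<close>

definition group_hopf :: "('k::field, 'g::group_add \<Rightarrow>\<^sub>0 'k) hopf" where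
  "group_hopf = \<lparr>scl = fscale,
     comult = (\<lambda>f. tcls fscale fscale (fext (\<lambda>g. fbasis (fbasis g, fbasis g)) f)),
     counit = (\<lambda>f. \<Sum>g \<in> Poly_Mapping.keys f. Poly_Mapping.lookup f g),
     antipode = fext (\<lambda>g. fbasis (- g))\<rparr>"

abbreviation kC2 :: "('k::field, bit \<Rightarrow>\<^sub>0 'k) hopf" where "kC2 \<equiv> group_hopf"
abbreviation kCinf :: "('k::field, int \<Rightarrow>\<^sub>0 'k) hopf" where "kCinf \<equiv> group_hopf"


subsection \<open>The Hopf algebra $k\langle c,d,h\rangle/I_0$\<close>

text \<open>
  The free unital algebra on \<open>'g\<close> is the monoid algebra \<open>'g word \<Rightarrow>\<^sub>0 'k\<close> of the free monoid,
  whose operation (concatenation) is written additively.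
\<close>

datatype 'g word = Word (letters: "'g list")

instantiation word :: (type) monoid_add
begin
definition "0 = Word []"
definition "u + v = Word (letters u @ letters v)"
instance by standard (auto simp: zero_word_def plus_word_def)
end

type_synonym ('g, 'k) free_alg = "'g word \<Rightarrow>\<^sub>0 'k"

text \<open>The unital homomorphism from the free algebra that extends a map on the generators.\<close>

definition free_eval ::
  "('k::field \<Rightarrow> 'a::ring_1 \<Rightarrow> 'a) \<Rightarrow> ('g \<Rightarrow> 'a) \<Rightarrow> ('g, 'k) free_alg \<Rightarrow> 'a" where
  "free_eval sA \<phi> p = (\<Sum>w \<in> Poly_Mapping.keys p.
     sA (Poly_Mapping.lookup p w) (prod_list (map \<phi> (letters w))))"

text \<open>The unital anti-homomorphism from the free algebra that extends a map on the generators.\<close>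

definition free_anti_eval ::
  "('k::field \<Rightarrow> 'a::ring_1 \<Rightarrow> 'a) \<Rightarrow> ('g \<Rightarrow> 'a) \<Rightarrow> ('g, 'k) free_alg \<Rightarrow> 'a" where
  "free_anti_eval sA \<phi> p = (\<Sum>w \<in> Poly_Mapping.keys p.
     sA (Poly_Mapping.lookup p w) (prod_list (map \<phi> (rev (letters w)))))"

text \<open>
  The unital homomorphism from the free algebra to \<open>A \<otimes> B\<close> that extends a map on the
  generators, computed on formal sums of pairs.
\<close>

definition free_tensor_eval ::
  "('g \<Rightarrow> ('a::ring_1 \<times> 'b::ring_1 \<Rightarrow>\<^sub>0 'k::field)) \<Rightarrow> ('g, 'k) free_alg \<Rightarrow> ('a \<times> 'b \<Rightarrow>\<^sub>0 'k)" where
  "free_tensor_eval \<phi> = fext (\<lambda>w. foldr (\<lambda>g t. ftimes (\<phi> g) t) (letters w) (fbasis (1, 1)))"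

definition two_sided_ideal :: "'r::ring_1 set \<Rightarrow> bool" where
  "two_sided_ideal I \<longleftrightarrow> 0 \<in> I \<and> (\<forall>a\<in>I. \<forall>b\<in>I. a - b \<in> I) \<and> (\<forall>a\<in>I. \<forall>r. r * a \<in> I \<and> a * r \<in> I)"

definition generated_ideal :: "'r::ring_1 set \<Rightarrow> 'r set" where
  "generated_ideal X = \<Inter> {I. two_sided_ideal I \<and> X \<subseteq> I}"

lemma two_sided_ideal_generated: "two_sided_ideal (generated_ideal X)"
  unfolding two_sided_ideal_def generated_ideal_def by blast

datatype cdh_gen = gC | gD | gH

abbreviation fgen :: "'g \<Rightarrow> ('g, 'k::field) free_alg" where
  "fgen g \<equiv> fbasis (Word [g])"

definition I0 :: "(cdh_gen, 'k::field) free_alg set" where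
  "I0 = generated_ideal
     {fgen gC * fgen gD - 1, fgen gD * fgen gC - 1, fgen gH ^ 2,
      fgen gH * fgen gC + fgen gC * fgen gH}"

lemma I0_ideal: "two_sided_ideal (I0 :: (cdh_gen, 'k::field) free_alg set)"
  unfolding I0_def by (rule two_sided_ideal_generated)

lemma I0_zero: "0 \<in> I0"
  and I0_diff: "p \<in> I0 \<Longrightarrow> q \<in> I0 \<Longrightarrow> p - q \<in> I0"
  and I0_mult_left: "p \<in> I0 \<Longrightarrow> r * p \<in> I0"
  and I0_mult_right: "p \<in> I0 \<Longrightarrow> p * r \<in> I0"
  using I0_ideal unfolding two_sided_ideal_def by blast+

lemma I0_uminus: "p \<in> I0 \<Longrightarrow> - p \<in> I0"
  using I0_diff[OF I0_zero, of p] by simp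

lemma I0_add: "p \<in> I0 \<Longrightarrow> q \<in> I0 \<Longrightarrow> p + q \<in> I0"
  using I0_diff[of p "- q"] I0_uminus[of q] by simp

definition cdh_counit_gen :: "cdh_gen \<Rightarrow> 'k::field" where
  "cdh_counit_gen g = (case g of gC \<Rightarrow> 1 | gD \<Rightarrow> 1 | gH \<Rightarrow> 0)"

lemma free_eval_sum_superset:
  assumes "finite S" "Poly_Mapping.keys p \<subseteq> S"
  shows "free_eval (*) \<phi> p =
    (\<Sum>w\<in>S. Poly_Mapping.lookup p w * prod_list (map \<phi> (letters w)))"
  unfolding free_eval_def using assms
  by (intro sum.mono_neutral_left) (auto simp: in_keys_iff)

lemma free_eval_add: "free_eval (*) \<phi> (p + q) = free_eval (*) \<phi> p + free_eval (*) \<phi> q"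
proof -
  let ?S = "Poly_Mapping.keys p \<union> Poly_Mapping.keys q"
  have "Poly_Mapping.keys (p + q) \<subseteq> ?S" by (rule Poly_Mapping.keys_add)
  then show ?thesis
    by (simp add: free_eval_sum_superset[of ?S] lookup_add distrib_right sum.distrib)
qed

lemma free_eval_zero: "free_eval (*) \<phi> 0 = 0"
  by (simp add: free_eval_def)

lemma free_eval_single:
  "free_eval (*) \<phi> (Poly_Mapping.single w r) = r * prod_list (map \<phi> (letters w))"
  by (simp add: free_eval_def)

lemma free_eval_diff: "free_eval (*) \<phi> (p - q) = free_eval (*) \<phi> p - free_eval (*) \<phi> q"
  using free_eval_add[of \<phi> "p - q" q] by simp

lemma poly_mapping_sum_induct [case_names zero single]:
  fixes p :: "'x \<Rightarrow>\<^sub>0 'k::comm_monoid_add"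
  assumes "P 0" and step: "\<And>w r q. P q \<Longrightarrow> P (q + Poly_Mapping.single w r)"
  shows "P p"
proof (induction p rule: update_induct)
  case const
  then show ?case by fact
next
  case (update f a b)
  have "Poly_Mapping.update a b f = f + Poly_Mapping.single a b"
    using update(1) by (intro poly_mapping_eqI)
      (auto simp: lookup_add lookup_single lookup_update when_def in_keys_iff)
  then show ?case using step[OF update(3)] by simp
qed

lemma free_eval_mult: "free_eval (*) \<phi> (p * q) = free_eval (*) \<phi> p * free_eval (*) \<phi> q"
proof (induction p rule: poly_mapping_sum_induct)
  case zero
  then show ?case by (simp add: free_eval_zero)
next
  case (single w r p)
  have "free_eval (*) \<phi> (Poly_Mapping.single w r * q) =
      free_eval (*) \<phi> (Poly_Mapping.single w r) * free_eval (*) \<phi> q"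
  proof (induction q rule: poly_mapping_sum_induct)
    case zero
    then show ?case by (simp add: free_eval_zero)
  next
    case (single v s q)
    then show ?case
      by (simp add: distrib_left free_eval_add mult_single free_eval_single plus_word_def algebra_simps)
  qed
  with single show ?case by (simp add: distrib_right free_eval_add)
qed

lemma one_notin_I0: "(1 :: (cdh_gen, 'k::field) free_alg) \<notin> I0"
proof -
  let ?e = "free_eval (*) (cdh_counit_gen :: cdh_gen \<Rightarrow> 'k)"
  let ?K = "{p. ?e p = 0}"
  have one: "?e 1 = 1"
    unfolding single_one[symmetric] by (simp only: free_eval_single zero_word_def) simp
  have "two_sided_ideal ?K"
    by (auto simp: two_sided_ideal_def free_eval_zero free_eval_diff free_eval_mult)
  moreover have "{fgen gC * fgen gD - 1, fgen gD * fgen gC - 1, fgen gH ^ 2,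
      fgen gH * fgen gC + fgen gC * fgen gH} \<subseteq> ?K"
    by (auto simp: free_eval_diff free_eval_add free_eval_mult power2_eq_square
        free_eval_single one cdh_counit_gen_def)
  ultimately have "I0 \<subseteq> ?K"
    unfolding I0_def generated_ideal_def by blast
  then show ?thesis using one by auto
qed

quotient_type (overloaded) 'k cdh = "(cdh_gen, 'k::field) free_alg" / "\<lambda>p q. p - q \<in> I0"
proof (rule equivpI)
  show "reflp (\<lambda>p q::(cdh_gen, 'k) free_alg. p - q \<in> I0)"
    by (auto intro: reflpI simp: I0_zero)
  show "symp (\<lambda>p q::(cdh_gen, 'k) free_alg. p - q \<in> I0)"
  proof (rule sympI)
    fix p q :: "(cdh_gen, 'k) free_alg"
    assume "p - q \<in> I0"
    from I0_uminus[OF this] show "q - p \<in> I0" by simp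
  qed
  show "transp (\<lambda>p q::(cdh_gen, 'k) free_alg. p - q \<in> I0)"
  proof (rule transpI)
    fix p q r :: "(cdh_gen, 'k) free_alg"
    assume "p - q \<in> I0" "q - r \<in> I0"
    from I0_add[OF this] show "p - r \<in> I0" by simp
  qed
qed

instantiation cdh :: (field) ring_1
begin

lift_definition zero_cdh :: "'a cdh" is 0 .
lift_definition one_cdh :: "'a cdh" is 1 .
lift_definition plus_cdh :: "'a cdh \<Rightarrow> 'a cdh \<Rightarrow> 'a cdh" is "(+)"
proof -
  fix p p' q q' :: "(cdh_gen, 'a) free_alg"
  assume "p - p' \<in> I0" "q - q' \<in> I0"
  from I0_add[OF this] show "p + q - (p' + q') \<in> I0" by (simp add: algebra_simps)
qed
lift_definition minus_cdh :: "'a cdh \<Rightarrow> 'a cdh \<Rightarrow> 'a cdh" is "(-)"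
proof -
  fix p p' q q' :: "(cdh_gen, 'a) free_alg"
  assume "p - p' \<in> I0" "q - q' \<in> I0"
  from I0_diff[OF this] show "p - q - (p' - q') \<in> I0" by (simp add: algebra_simps)
qed
lift_definition uminus_cdh :: "'a cdh \<Rightarrow> 'a cdh" is uminus
proof -
  fix p p' :: "(cdh_gen, 'a) free_alg"
  assume "p - p' \<in> I0"
  from I0_uminus[OF this] show "- p - - p' \<in> I0" by (simp add: algebra_simps)
qed
lift_definition times_cdh :: "'a cdh \<Rightarrow> 'a cdh \<Rightarrow> 'a cdh" is "(*)"
proof -
  fix p p' q q' :: "(cdh_gen, 'a) free_alg"
  assume "p - p' \<in> I0" "q - q' \<in> I0"
  then have "(p - p') * q + p' * (q - q') \<in> I0"
    by (intro I0_add I0_mult_left I0_mult_right)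
  then show "p * q - p' * q' \<in> I0" by (simp add: algebra_simps)
qed

instance
proof
  show "(0 :: 'a cdh) \<noteq> 1"
    by transfer (use one_notin_I0 I0_uminus in fastforce)
qed (transfer; simp add: algebra_simps I0_zero)+

end

lemma fscale_conv_mult: "fscale c p = Poly_Mapping.single 0 c * p" for p :: "'x::monoid_add \<Rightarrow>\<^sub>0 'k::field"
  unfolding fscale_def by (rule mult_map_scale_conv_mult)

lift_definition cdh_scale :: "'k::field \<Rightarrow> 'k cdh \<Rightarrow> 'k cdh" is fscale
  by (simp add: fscale_conv_mult I0_mult_left flip: right_diff_distrib)

lift_definition cdh_c :: "'k::field cdh" is "fgen gC" .
lift_definition cdh_d :: "'k::field cdh" is "fgen gD" .
lift_definition cdh_h :: "'k::field cdh" is "fgen gH" .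

definition cdh_comult_gen :: "cdh_gen \<Rightarrow> ('k::field cdh \<times> 'k cdh \<Rightarrow>\<^sub>0 'k)" where
  "cdh_comult_gen g = (case g of
      gC \<Rightarrow> fbasis (cdh_c, cdh_c)
    | gD \<Rightarrow> fbasis (cdh_d, cdh_d)
    | gH \<Rightarrow> fbasis (cdh_h, cdh_c) + fbasis (1, cdh_h))"

definition cdh_antipode_gen :: "cdh_gen \<Rightarrow> 'k::field cdh" where
  "cdh_antipode_gen g = (case g of gC \<Rightarrow> cdh_d | gD \<Rightarrow> cdh_c | gH \<Rightarrow> - (cdh_h * cdh_d))"

text \<open>
  The structure maps on the quotient are the ones induced by the (anti-)homomorphisms on the
  free algebra, evaluated at a representative \<open>rep_cdh q\<close> of the class \<open>q\<close>.
\<close>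

definition cdh_hopf :: "('k::field, 'k cdh) hopf" where
  "cdh_hopf = \<lparr>scl = cdh_scale,
     comult = (\<lambda>q. tcls cdh_scale cdh_scale (free_tensor_eval cdh_comult_gen (rep_cdh q))),
     counit = (\<lambda>q. free_eval (*) cdh_counit_gen (rep_cdh q)),
     antipode = (\<lambda>q. free_anti_eval cdh_scale cdh_antipode_gen (rep_cdh q))\<rparr>"


subsection \<open>The Sweedler algebra\<close>

text \<open>
  \<open>Sw p q r s\<close> is \<open>p 1 + q c + r v + s cv\<close>; the product is the one determined by
  \<open>c\<^sup>2 = 1\<close>, \<open>v\<^sup>2 = 0\<close>, \<open>vc = - cv\<close>.
\<close>

datatype 'k sweedler = Sw (sw_1: 'k) (sw_c: 'k) (sw_v: 'k) (sw_cv: 'k)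

instantiation sweedler :: (field) ring_1
begin

definition "0 = Sw 0 0 0 0"
definition "1 = Sw 1 0 0 0"
definition "a + b = Sw (sw_1 a + sw_1 b) (sw_c a + sw_c b) (sw_v a + sw_v b) (sw_cv a + sw_cv b)"
definition "a - b = Sw (sw_1 a - sw_1 b) (sw_c a - sw_c b) (sw_v a - sw_v b) (sw_cv a - sw_cv b)"
definition "- a = Sw (- sw_1 a) (- sw_c a) (- sw_v a) (- sw_cv a)"
definition "a * b = Sw
  (sw_1 a * sw_1 b + sw_c a * sw_c b)
  (sw_1 a * sw_c b + sw_c a * sw_1 b)
  (sw_1 a * sw_v b + sw_v a * sw_1 b + sw_c a * sw_cv b - sw_cv a * sw_c b)
  (sw_1 a * sw_cv b + sw_cv a * sw_1 b + sw_c a * sw_v b - sw_v a * sw_c b)"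

instance
  by standard
    (simp_all add: zero_sweedler_def one_sweedler_def plus_sweedler_def minus_sweedler_def
      uminus_sweedler_def times_sweedler_def sweedler.expand algebra_simps)

end

definition sweedler_scale :: "'k::field \<Rightarrow> 'k sweedler \<Rightarrow> 'k sweedler" where
  "sweedler_scale k a = Sw (k * sw_1 a) (k * sw_c a) (k * sw_v a) (k * sw_cv a)"

definition sweedler_c :: "'k::field sweedler" where "sweedler_c = Sw 0 1 0 0"
definition sweedler_v :: "'k::field sweedler" where "sweedler_v = Sw 0 0 1 0"

lemma sweedler_relations:
  "sweedler_c ^ 2 = (1 :: 'k::field sweedler)"
  "sweedler_v ^ 2 = (0 :: 'k::field sweedler)"
  "sweedler_v * sweedler_c = - (sweedler_c * sweedler_v :: 'k::field sweedler)"
  by (simp_all add: power2_eq_square sweedler_c_def sweedler_v_def zero_sweedler_def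
      one_sweedler_def uminus_sweedler_def times_sweedler_def)

lemma sweedler_basis:
  "Sw p q r s = sweedler_scale p 1 + sweedler_scale q sweedler_c + sweedler_scale r sweedler_v
     + sweedler_scale s (sweedler_c * sweedler_v)"
  by (simp add: sweedler_scale_def sweedler_c_def sweedler_v_def one_sweedler_def
      plus_sweedler_def times_sweedler_def)

text \<open>
  The structure maps are given on the basis \<open>1, c, v, cv\<close>, with the values
  \<open>\<Delta>(c) \<Delta>(v)\<close>, \<open>\<epsilon>(c) \<epsilon>(v) = 0\<close> and \<open>S(v) S(c)\<close> at \<open>cv\<close>.
\<close>

definition sweedler_hopf :: "('k::field, 'k sweedler) hopf" where
  "sweedler_hopf =
    (let c = sweedler_c; v = sweedler_v;
         \<Delta>c = fbasis (c, c);
         \<Delta>v = fbasis (c, v) + fbasis (v, 1);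
         Sv = - (c * v)
     in \<lparr>scl = sweedler_scale,
         comult = (\<lambda>a. tcls sweedler_scale sweedler_scale
           (fscale (sw_1 a) (fbasis (1, 1)) + fscale (sw_c a) \<Delta>c
            + fscale (sw_v a) \<Delta>v + fscale (sw_cv a) (ftimes \<Delta>c \<Delta>v))),
         counit = (\<lambda>a. sw_1 a + sw_c a),
         antipode = (\<lambda>a. sweedler_scale (sw_1 a) 1 + sweedler_scale (sw_c a) c
            + sweedler_scale (sw_v a) Sv + sweedler_scale (sw_cv a) (Sv * c))\<rparr>)"


section \<open>The coactions\<close>

definition rho1 :: "'k::field dual_num \<Rightarrow> ('k dual_num \<times> 'k \<Rightarrow>\<^sub>0 'k) set" where
  "rho1 a = tcls dn_scale (*) (fbasis (a, 1))"

definition rho2 :: "'k::field dual_num \<Rightarrow> ('k dual_num \<times> 'k dual_num \<Rightarrow>\<^sub>0 'k) set" where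
  "rho2 = comult dual_num_hopf"

text \<open>The identification of \<open>k[x]/(x\<^sup>2)\<close> with \<open>kC\<^sub>2\<close> given by \<open>1 \<mapsto> 1\<close>, \<open>x \<mapsto> \<theta> (1 + c)\<close>.\<close>

definition dn_kC2 :: "'k::field \<Rightarrow> 'k dual_num \<Rightarrow> (bit \<Rightarrow>\<^sub>0 'k)" where
  "dn_kC2 \<theta> a = fscale (dn_coord1 a) 1 + fscale (dn_coordx a) (fscale \<theta> (1 + fbasis 1))"

definition rho3 :: "'k::field \<Rightarrow> 'k dual_num \<Rightarrow> ('k dual_num \<times> (bit \<Rightarrow>\<^sub>0 'k) \<Rightarrow>\<^sub>0 'k) set" where
  "rho3 \<theta> a = tmap dn_scale fscale (inv (dn_kC2 \<theta>)) id (comult kC2 (dn_kC2 \<theta> a))"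

definition rho4 :: "'k::field dual_num \<Rightarrow> ('k dual_num \<times> (int \<Rightarrow>\<^sub>0 'k) \<Rightarrow>\<^sub>0 'k) set" where
  "rho4 = dn_tensor_map fscale (fbasis (dn_x, fbasis 1))"

definition rho4a :: "'k::field dual_num \<Rightarrow> ('k dual_num \<times> (bit \<Rightarrow>\<^sub>0 'k) \<Rightarrow>\<^sub>0 'k) set" where
  "rho4a = dn_tensor_map fscale (fbasis (dn_x, fbasis 1))"

definition rho5 :: "'k::field dual_num \<Rightarrow> ('k dual_num \<times> 'k cdh \<Rightarrow>\<^sub>0 'k) set" where
  "rho5 = dn_tensor_map cdh_scale (fbasis (1, cdh_h) + fbasis (dn_x, cdh_c))"

definition rho5a :: "'k::field dual_num \<Rightarrow> ('k dual_num \<times> 'k sweedler \<Rightarrow>\<^sub>0 'k) set" where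
  "rho5a = dn_tensor_map sweedler_scale
     (fbasis (dn_x, sweedler_c) + fbasis (1, sweedler_c * sweedler_v))"

end

theory Submission
  imports Defs
begin

text \<open>
  Write a unital coaction \<open>\<rho>\<close> of \<open>H\<close> on \<open>k[x]/(x\<^sup>2)\<close> as \<open>\<rho> x = 1 \<otimes> h + x \<otimes> c\<close>. Comparing coefficients,
  the coaction axioms say exactly that \<open>c\<close> is group-like, \<open>\<Delta> h = h \<otimes> c + 1 \<otimes> h\<close>, \<open>h\<^sup>2 = 0\<close> and
  \<open>hc + ch = 0\<close> (\<open>unital_coaction_skew_pair\<close>, \<open>unital_coaction_dn_coact\<close>). The operator that belongs to
  a functional \<open>l\<close> on \<open>H\<close> has the matrix with rows \<open>(l 1, l h)\<close> and \<open>(0, l c)\<close>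
  (\<open>cosupp_dn_coact\<close>), so the cosupport depends only on the linear relations between \<open>1\<close>, \<open>h\<close> and
  \<open>c\<close>. As the counit maps \<open>h\<close> to \<open>0\<close> and \<open>c\<close> to \<open>1\<close>, the only possible relations are \<open>h = 0\<close>, \<open>c = 1\<close>
  and \<open>h = \<theta> (1 - c)\<close>. If \<open>c = 1\<close> and \<open>h \<noteq> 0\<close>, or if \<open>h = \<theta> (1 - c) \<noteq> 0\<close>, the relations
  \<open>h\<^sup>2 = 0 = hc + ch\<close> force characteristic 2. This leaves the five cases
  (\<open>cosupp_dn_coact_shape\<close>, \<open>unital_coaction_classification\<close>).

  For universality, an inclusion of cosupports says that the linear relations between \<open>1\<close>, \<open>h0\<close> and
  \<open>c0\<close> in the given Hopf algebra \<open>H0\<close> also hold between \<open>1\<close>, \<open>h\<close> and \<open>c\<close> in \<open>H\<close>. Together with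
  \<open>h\<^sup>2 = 0\<close>, \<open>hc + ch = 0\<close> and the invertibility of \<open>c\<close> these are the defining relations of \<open>H0\<close>, so there
  is an algebra homomorphism \<open>H0 \<rightarrow> H\<close> with \<open>h0 \<mapsto> h\<close> and \<open>c0 \<mapsto> c\<close>. It respects the comultiplication
  because it does so on generators, hence also the antipode, and it is the only one because \<open>h0\<close>, \<open>c0\<close>
  and the antipode of \<open>c0\<close> generate \<open>H0\<close> (\<open>V_universal_dn_coact\<close>).

  Two devices make the axioms tractable. Tensors are cosets, and two of them agree if and only if all
  bilinear forms agree on them (\<open>tensor_eqI\<close>); every axiom thus becomes an equation between iterated
  sums \<open>tlift\<close>. Moreover the axioms only need to be checked on algebra generators, which are here
  group-like or skew-primitive (\<open>hopf_algebra_pointedI\<close>, \<open>hopf_homI\<close>). That \<open>1\<close>, \<open>h\<close> and \<open>c\<close> are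
  independent in \<open>k\<langle>c,d,h\<rangle>/I\<^sub>0\<close> is seen by mapping this algebra to the Sweedler algebra
  (\<open>cdh_independent\<close>).
\<close>

section \<open>Linear extension and linear functionals\<close>

text \<open>
  The linear extension to formal sums of a map on the basis. The maps \<open>fext\<close>, \<open>tlift\<close>,
  \<open>free_eval\<close> and \<open>free_anti_eval\<close> are instances of it, so its linearity serves them all.
\<close>

definition lext :: "('k::field \<Rightarrow> 'v::ab_group_add \<Rightarrow> 'v) \<Rightarrow> ('x \<Rightarrow> 'v) \<Rightarrow> ('x \<Rightarrow>\<^sub>0 'k) \<Rightarrow> 'v" where
  "lext s g f = (\<Sum>x\<in>Poly_Mapping.keys f. s (Poly_Mapping.lookup f x) (g x))"

lemma vector_space_mult: "vector_space ((*) :: 'k::field \<Rightarrow> 'k \<Rightarrow> 'k)"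
  by unfold_locales (simp_all add: algebra_simps)

lemma lookup_fscale: "Poly_Mapping.lookup (fscale c f) x = c * Poly_Mapping.lookup f x"
  unfolding fscale_def by (simp add: Poly_Mapping.map.rep_eq when_def)

lemma vector_space_fscale: "vector_space (fscale :: 'k::field \<Rightarrow> ('x \<Rightarrow>\<^sub>0 'k) \<Rightarrow> _)"
  by unfold_locales
    (rule poly_mapping_eqI; simp add: lookup_fscale lookup_add algebra_simps)+

lemma fscale_single: "fscale c (Poly_Mapping.single x r) = Poly_Mapping.single x (c * r)"
  by (rule poly_mapping_eqI) (simp add: lookup_fscale lookup_single when_def)

context vector_space
begin

lemma lext_superset:
  assumes "finite S" "Poly_Mapping.keys f \<subseteq> S"
  shows "lext scale g f = (\<Sum>x\<in>S. scale (Poly_Mapping.lookup f x) (g x))"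
  unfolding lext_def using assms
  by (intro sum.mono_neutral_left) (auto simp: in_keys_iff)

lemma lext_zero [simp]: "lext scale g 0 = 0"
  by (simp add: lext_def)

lemma lext_add: "lext scale g (p + q) = lext scale g p + lext scale g q"
proof -
  let ?S = "Poly_Mapping.keys p \<union> Poly_Mapping.keys q"
  have "Poly_Mapping.keys (p + q) \<subseteq> ?S" by (rule Poly_Mapping.keys_add)
  then show ?thesis
    by (simp add: lext_superset[of ?S] lookup_add scale_left_distrib sum.distrib)
qed

lemma lext_single: "lext scale g (Poly_Mapping.single x r) = scale r (g x)"
  by (simp add: lext_def)

lemma lext_fbasis [simp]: "lext scale g (fbasis x) = g x"
  by (simp add: lext_single)

lemma lext_diff: "lext scale g (p - q) = lext scale g p - lext scale g q"
  using lext_add[of g "p - q" q] by simp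

lemma lext_fscale: "lext scale g (fscale c p) = scale c (lext scale g p)"
proof -
  have "Poly_Mapping.keys (fscale c p) \<subseteq> Poly_Mapping.keys p"
    by (auto simp: in_keys_iff lookup_fscale)
  then show ?thesis
    by (simp add: lext_superset[of "Poly_Mapping.keys p"] lookup_fscale scale_sum_right)
qed

lemma lext_sum: "lext scale g (\<Sum>i\<in>I. p i) = (\<Sum>i\<in>I. lext scale g (p i))"
  by (induction I rule: infinite_finite_induct) (simp_all add: lext_add)

lemma lext_fext: "lext scale g (fext \<phi> f) = lext scale (\<lambda>x. lext scale g (\<phi> x)) f"
  by (simp add: fext_def lext_sum lext_fscale lext_def[of scale _ f])

lemma lext_fun_add: "lext scale (\<lambda>x. g x + g' x) f = lext scale g f + lext scale g' f"
  by (simp add: lext_def scale_right_distrib sum.distrib)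

lemma lext_fun_scale: "lext scale (\<lambda>x. scale c (g x)) f = scale c (lext scale g f)"
  by (simp add: lext_def scale_sum_right mult.commute)

lemma lext_swap:
  "lext scale (\<lambda>x. lext scale (\<lambda>y. B x y) g) f = lext scale (\<lambda>y. lext scale (\<lambda>x. B x y) f) g"
  unfolding lext_def scale_sum_right
  by (subst sum.swap) (simp add: mult.commute)

lemma lext_fun_zero [simp]: "lext scale (\<lambda>x. 0) f = 0"
  by (simp add: lext_def)

end

lemmas lext_field =
  vector_space.lext_zero[OF vector_space_mult]
  vector_space.lext_add[OF vector_space_mult]
  vector_space.lext_diff[OF vector_space_mult]
  vector_space.lext_fbasis[OF vector_space_mult]
  vector_space.lext_fscale[OF vector_space_mult]

lemma fext_conv_lext: "fext = lext fscale"
  by (intro ext) (simp add: fext_def lext_def)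

lemma linear_lext:
  assumes "Vector_Spaces.linear sV sW L"
  shows "L (lext sV g f) = lext sW (\<lambda>x. L (g x)) f"
proof -
  interpret Vector_Spaces.linear sV sW L by fact
  show ?thesis by (simp add: lext_def sum scale)
qed

lemma linearI_field:
  assumes "vector_space s" "\<And>x y. l (x + y) = l x + l y" "\<And>c x. l (s c x) = c * l x"
  shows "Vector_Spaces.linear s (*) l"
  using assms by (simp add: Vector_Spaces.linear_iff vector_space_mult)

text \<open>
  A basis of \<open>S\<close> stays independent when \<open>v\<close> is added to it, so a functional may be prescribed
  to vanish on that basis and to be \<open>1\<close> at \<open>v\<close>.
\<close>

lemma separating_functional:
  assumes "vector_space s" "module.subspace s S" "v \<notin> S"
  obtains l where "Vector_Spaces.linear s (*) l" "\<And>x. x \<in> S \<Longrightarrow> l x = 0" "l v = 1"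
proof -
  interpret V: vector_space s by fact
  interpret K: vector_space "(*) :: 'a \<Rightarrow> 'a \<Rightarrow> 'a" by (rule vector_space_mult)
  interpret VK: vector_space_pair s "(*)" ..
  obtain B where B: "B \<subseteq> S" "V.independent B" "S \<subseteq> V.span B"
    using V.maximal_independent_subset by blast
  have "V.span B = S"
    using B(1,3) V.span_minimal[OF B(1) assms(2)] by blast
  then have "V.independent (insert v B)"
    using assms(3) B(2) by (intro V.independent_insertI) auto
  then obtain l where l: "Vector_Spaces.linear s (*) l"
      "\<forall>x\<in>insert v B. l x = (if x = v then 1 else 0)"
    using VK.linear_independent_extend[of "insert v B" "\<lambda>x. if x = v then 1 else 0"] by blast
  have "l x = 0" if "x \<in> S" for x
  proof -
    have z: "l b = (\<lambda>_. 0) b" if "b \<in> B" for b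
      using l(2) that B(1) assms(3) by auto
    have "Vector_Spaces.linear s (*) (\<lambda>_. 0)"
      using VK.linear_zero by simp
    from VK.linear_eq_on[OF l(1) this _ z] that show ?thesis
      using \<open>V.span B = S\<close> by blast
  qed
  with l that show ?thesis by auto
qed

lemma functionals_separate_points:
  assumes "vector_space s" "\<And>l. Vector_Spaces.linear s (*) l \<Longrightarrow> l v = l w"
  shows "v = w"
proof (rule ccontr)
  assume "v \<noteq> w"
  interpret V: vector_space s by fact
  have "v - w \<notin> {0}" using \<open>v \<noteq> w\<close> by simp
  then obtain l where l: "Vector_Spaces.linear s (*) l" "l (v - w) = 1"
    using separating_functional[OF assms(1) V.subspace_single_0] by metis
  interpret l: Vector_Spaces.linear s "(*)" l by fact
  show False using l(2) assms(2)[OF l(1)] by (simp add: l.diff)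
qed

section \<open>Tensors and multilinear forms\<close>

text \<open>
  Only the four equations: the vector space axioms are left out, so that bilinearity of nested
  expressions can be proved by rewriting.
\<close>

definition bilin ::
  "('k::field \<Rightarrow> 'a::ab_group_add \<Rightarrow> 'a) \<Rightarrow> ('k \<Rightarrow> 'b::ab_group_add \<Rightarrow> 'b) \<Rightarrow>
     ('k \<Rightarrow> 'v::ab_group_add \<Rightarrow> 'v) \<Rightarrow> ('a \<Rightarrow> 'b \<Rightarrow> 'v) \<Rightarrow> bool" where
  "bilin sA sB sV \<beta> \<longleftrightarrow>
     (\<forall>a a' b. \<beta> (a + a') b = \<beta> a b + \<beta> a' b) \<and>
     (\<forall>a b b'. \<beta> a (b + b') = \<beta> a b + \<beta> a b') \<and>
     (\<forall>r a b. \<beta> (sA r a) b = sV r (\<beta> a b)) \<and>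
     (\<forall>r a b. \<beta> a (sB r b) = sV r (\<beta> a b))"

definition trilin ::
  "('k::field \<Rightarrow> 'a::ab_group_add \<Rightarrow> 'a) \<Rightarrow> ('k \<Rightarrow> 'b::ab_group_add \<Rightarrow> 'b) \<Rightarrow>
     ('k \<Rightarrow> 'c::ab_group_add \<Rightarrow> 'c) \<Rightarrow> ('k \<Rightarrow> 'v::ab_group_add \<Rightarrow> 'v) \<Rightarrow>
     ('a \<Rightarrow> 'b \<Rightarrow> 'c \<Rightarrow> 'v) \<Rightarrow> bool" where
  "trilin sA sB sC sV \<gamma> \<longleftrightarrow>
     (\<forall>a. bilin sB sC sV (\<lambda>b c. \<gamma> a b c)) \<and>
     (\<forall>b. bilin sA sC sV (\<lambda>a c. \<gamma> a b c)) \<and>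
     (\<forall>c. bilin sA sB sV (\<lambda>a b. \<gamma> a b c))"

lemma bilinI:
  assumes "\<And>a a' b. \<beta> (a + a') b = \<beta> a b + \<beta> a' b" "\<And>a b b'. \<beta> a (b + b') = \<beta> a b + \<beta> a b'"
    "\<And>r a b. \<beta> (sA r a) b = sV r (\<beta> a b)" "\<And>r a b. \<beta> a (sB r b) = sV r (\<beta> a b)"
  shows "bilin sA sB sV \<beta>"
  using assms by (simp add: bilin_def)

lemma bilin_simps:
  assumes "bilin sA sB sV \<beta>"
  shows "\<beta> (a + a') b = \<beta> a b + \<beta> a' b" "\<beta> a (b + b') = \<beta> a b + \<beta> a b'"
    "\<beta> (sA r a) b = sV r (\<beta> a b)" "\<beta> a (sB r b) = sV r (\<beta> a b)"
    "\<beta> 0 b = 0" "\<beta> a 0 = 0" "\<beta> (- a) b = - \<beta> a b" "\<beta> a (- b) = - \<beta> a b"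
    "\<beta> (a - a') b = \<beta> a b - \<beta> a' b" "\<beta> a (b - b') = \<beta> a b - \<beta> a b'"
proof -
  have add: "\<And>a a' b. \<beta> (a + a') b = \<beta> a b + \<beta> a' b" "\<And>a b b'. \<beta> a (b + b') = \<beta> a b + \<beta> a b'"
    using assms by (simp_all add: bilin_def)
  show "\<beta> (a + a') b = \<beta> a b + \<beta> a' b" "\<beta> a (b + b') = \<beta> a b + \<beta> a b'"
    "\<beta> (sA r a) b = sV r (\<beta> a b)" "\<beta> a (sB r b) = sV r (\<beta> a b)"
    using assms by (simp_all add: bilin_def)
  show z: "\<beta> 0 b = 0" "\<beta> a 0 = 0" for a b
    using add(1)[of 0 0 b] add(2)[of a 0 0] by simp_all
  show m: "\<beta> (- a) b = - \<beta> a b" "\<beta> a (- b) = - \<beta> a b" for a b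
    using add(1)[of a "- a" b] add(2)[of a b "- b"] by (simp_all add: z eq_neg_iff_add_eq_0 add.commute)
  show "\<beta> (a - a') b = \<beta> a b - \<beta> a' b" "\<beta> a (b - b') = \<beta> a b - \<beta> a b'"
    using add(1)[of a "- a'" b] add(2)[of a b "- b'"] by (simp_all add: m)
qed

lemma trilin_bilin:
  assumes "trilin sA sB sC sV \<gamma>"
  shows "bilin sB sC sV (\<lambda>b c. \<gamma> a b c)" "bilin sA sC sV (\<lambda>a c. \<gamma> a b c)"
    "bilin sA sB sV (\<lambda>a b. \<gamma> a b c)"
  using assms by (simp_all add: trilin_def)

lemma trilin_simps:
  assumes "trilin sA sB sC sV \<gamma>"
  shows "\<gamma> (a + a') b c = \<gamma> a b c + \<gamma> a' b c" "\<gamma> a (b + b') c = \<gamma> a b c + \<gamma> a b' c"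
    "\<gamma> a b (c + c') = \<gamma> a b c + \<gamma> a b c'"
    "\<gamma> (sA r a) b c = sV r (\<gamma> a b c)" "\<gamma> a (sB r b) c = sV r (\<gamma> a b c)"
    "\<gamma> a b (sC r c) = sV r (\<gamma> a b c)"
  using assms by (simp_all add: trilin_def bilin_def)

lemma tlift_conv_lext: "tlift sV \<beta> X = lext sV (\<lambda>(a, b). \<beta> a b) (trep X)"
  by (simp add: tlift_def lext_def case_prod_unfold)

lemma bilin_rels_subspace: "module.subspace fscale (bilin_rels sA sB)"
  for sA :: "'k::field \<Rightarrow> 'a::ab_group_add \<Rightarrow> 'a" and sB :: "'k \<Rightarrow> 'b::ab_group_add \<Rightarrow> 'b"
proof -
  interpret vector_space "fscale :: 'k \<Rightarrow> ('a \<times> 'b \<Rightarrow>\<^sub>0 'k) \<Rightarrow> _" by (rule vector_space_fscale)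
  show ?thesis unfolding bilin_rels_def by (rule subspace_span)
qed

lemma trilin_rels_subspace: "module.subspace fscale (trilin_rels sA sB sC)"
  for sA :: "'k::field \<Rightarrow> 'a::ab_group_add \<Rightarrow> 'a" and sB :: "'k \<Rightarrow> 'b::ab_group_add \<Rightarrow> 'b"
    and sC :: "'k \<Rightarrow> 'c::ab_group_add \<Rightarrow> 'c"
proof -
  interpret vector_space "fscale :: 'k \<Rightarrow> ('a \<times> 'b \<times> 'c \<Rightarrow>\<^sub>0 'k) \<Rightarrow> _" by (rule vector_space_fscale)
  show ?thesis unfolding trilin_rels_def by (rule subspace_span)
qed

lemma lext_bilin_rels:
  fixes sA :: "'k::field \<Rightarrow> 'a::ab_group_add \<Rightarrow> 'a" and sB :: "'k \<Rightarrow> 'b::ab_group_add \<Rightarrow> 'b"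
  assumes "vector_space sV" "bilin sA sB sV \<beta>" "f \<in> bilin_rels sA sB"
  shows "lext sV (\<lambda>(a, b). \<beta> a b) f = 0"
proof -
  interpret V: vector_space sV by fact
  interpret F: vector_space "fscale :: 'k \<Rightarrow> ('a \<times> 'b \<Rightarrow>\<^sub>0 'k) \<Rightarrow> _" by (rule vector_space_fscale)
  show ?thesis
    using assms(3) unfolding bilin_rels_def
  proof (induction rule: F.span_induct_alt)
    case base
    then show ?case by simp
  next
    case (step c x y)
    then show ?case
      by (auto simp: V.lext_add V.lext_fscale V.lext_diff bilin_simps[OF assms(2)])
  qed
qed

lemma lext_trilin_rels:
  fixes sA :: "'k::field \<Rightarrow> 'a::ab_group_add \<Rightarrow> 'a" and sB :: "'k \<Rightarrow> 'b::ab_group_add \<Rightarrow> 'b"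
    and sC :: "'k \<Rightarrow> 'c::ab_group_add \<Rightarrow> 'c"
  assumes "vector_space sV" "trilin sA sB sC sV \<gamma>" "f \<in> trilin_rels sA sB sC"
  shows "lext sV (\<lambda>(a, b, c). \<gamma> a b c) f = 0"
proof -
  interpret V: vector_space sV by fact
  interpret F: vector_space "fscale :: 'k \<Rightarrow> ('a \<times> 'b \<times> 'c \<Rightarrow>\<^sub>0 'k) \<Rightarrow> _" by (rule vector_space_fscale)
  show ?thesis
    using assms(3) unfolding trilin_rels_def
  proof (induction rule: F.span_induct_alt)
    case base
    then show ?case by simp
  next
    case (step c x y)
    then show ?case
      by (auto simp: V.lext_add V.lext_fscale V.lext_diff trilin_simps[OF assms(2)])
  qed
qed

lemma functional_eq_lext:
  fixes f :: "'x \<Rightarrow>\<^sub>0 'k::field"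
  assumes "Vector_Spaces.linear fscale (*) L"
  shows "L f = lext (*) (\<lambda>x. L (fbasis x)) f"
proof -
  interpret F: vector_space "fscale :: 'k \<Rightarrow> ('x \<Rightarrow>\<^sub>0 'k) \<Rightarrow> _" by (rule vector_space_fscale)
  interpret L: Vector_Spaces.linear fscale "(*)" L by fact
  have "lext fscale fbasis f = f"
    by (induction f rule: poly_mapping_sum_induct) (simp_all add: F.lext_add F.lext_single fscale_single)
  then show ?thesis using linear_lext[OF assms, of fbasis f] by simp
qed

text \<open>
  A formal sum outside the subspace of relations is separated from it by a functional \<open>L\<close>. Then
  \<open>(a, b) \<mapsto> L (fbasis (a, b))\<close> is a bilinear form that does not vanish on the formal sum.
\<close>

lemma bilin_relsI:
  fixes sA :: "'k::field \<Rightarrow> 'a::ab_group_add \<Rightarrow> 'a" and sB :: "'k \<Rightarrow> 'b::ab_group_add \<Rightarrow> 'b"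
  assumes "\<And>\<beta>. bilin sA sB (*) \<beta> \<Longrightarrow> lext (*) (\<lambda>(a, b). \<beta> a b) f = 0"
  shows "f \<in> bilin_rels sA sB"
proof (rule ccontr)
  assume "f \<notin> bilin_rels sA sB"
  then obtain L where L: "Vector_Spaces.linear fscale (*) L" "\<And>x. x \<in> bilin_rels sA sB \<Longrightarrow> L x = 0" "L f = 1"
    using separating_functional[OF vector_space_fscale bilin_rels_subspace] by metis
  interpret F: vector_space "fscale :: 'k \<Rightarrow> ('a \<times> 'b \<Rightarrow>\<^sub>0 'k) \<Rightarrow> _" by (rule vector_space_fscale)
  interpret L: Vector_Spaces.linear fscale "(*)" L by fact
  note * = L(2)[unfolded bilin_rels_def, OF F.span_base]
  have "L (fbasis (a + a', b) - fbasis (a, b) - fbasis (a', b)) = 0"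
    "L (fbasis (a, b + b') - fbasis (a, b) - fbasis (a, b')) = 0"
    "L (fbasis (sA r a, b) - fscale r (fbasis (a, b))) = 0"
    "L (fbasis (a, sB r b) - fscale r (fbasis (a, b))) = 0" for a a' b b' r
    by (rule *, fast)+
  then have "bilin sA sB (*) (\<lambda>a b. L (fbasis (a, b)))"
    by (intro bilinI) (simp_all add: L.add L.diff L.scale diff_diff_eq)
  from assms[OF this] have "L f = 0"
    by (subst functional_eq_lext[OF L(1)]) (simp add: case_prod_unfold)
  with L(3) show False by simp
qed

lemma trilin_relsI:
  fixes sA :: "'k::field \<Rightarrow> 'a::ab_group_add \<Rightarrow> 'a" and sB :: "'k \<Rightarrow> 'b::ab_group_add \<Rightarrow> 'b"
    and sC :: "'k \<Rightarrow> 'c::ab_group_add \<Rightarrow> 'c"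
  assumes "\<And>\<gamma>. trilin sA sB sC (*) \<gamma> \<Longrightarrow> lext (*) (\<lambda>(a, b, c). \<gamma> a b c) f = 0"
  shows "f \<in> trilin_rels sA sB sC"
proof (rule ccontr)
  assume "f \<notin> trilin_rels sA sB sC"
  then obtain L where L: "Vector_Spaces.linear fscale (*) L" "\<And>x. x \<in> trilin_rels sA sB sC \<Longrightarrow> L x = 0" "L f = 1"
    using separating_functional[OF vector_space_fscale trilin_rels_subspace] by metis
  interpret F: vector_space "fscale :: 'k \<Rightarrow> ('a \<times> 'b \<times> 'c \<Rightarrow>\<^sub>0 'k) \<Rightarrow> _" by (rule vector_space_fscale)
  interpret L: Vector_Spaces.linear fscale "(*)" L by fact
  note * = L(2)[unfolded trilin_rels_def, OF F.span_base]
  have "L (fbasis (a + a', b, c) - fbasis (a, b, c) - fbasis (a', b, c)) = 0"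
    "L (fbasis (a, b + b', c) - fbasis (a, b, c) - fbasis (a, b', c)) = 0"
    "L (fbasis (a, b, c + c') - fbasis (a, b, c) - fbasis (a, b, c')) = 0"
    "L (fbasis (sA r a, b, c) - fscale r (fbasis (a, b, c))) = 0"
    "L (fbasis (a, sB r b, c) - fscale r (fbasis (a, b, c))) = 0"
    "L (fbasis (a, b, sC r c) - fscale r (fbasis (a, b, c))) = 0" for a a' b b' c c' r
    by (rule *, fast)+
  then have "trilin sA sB sC (*) (\<lambda>a b c. L (fbasis (a, b, c)))"
    by (simp add: trilin_def bilin_def L.add L.diff L.scale diff_diff_eq)
  from assms[OF this] have "L f = 0"
    by (subst functional_eq_lext[OF L(1)]) (simp add: case_prod_unfold)
  with L(3) show False by simp
qed

lemma tcls_eq_iff: "tcls sA sB f = tcls sA sB g \<longleftrightarrow> f - g \<in> bilin_rels sA sB"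
  for sA :: "'k::field \<Rightarrow> 'a::ab_group_add \<Rightarrow> 'a" and sB :: "'k \<Rightarrow> 'b::ab_group_add \<Rightarrow> 'b"
proof -
  interpret F: vector_space "fscale :: 'k \<Rightarrow> ('a \<times> 'b \<Rightarrow>\<^sub>0 'k) \<Rightarrow> _" by (rule vector_space_fscale)
  note sub = bilin_rels_subspace[of sA sB]
  show ?thesis
  proof
    assume "tcls sA sB f = tcls sA sB g"
    moreover have "f \<in> tcls sA sB f" using F.subspace_0[OF sub] by (simp add: tcls_def)
    ultimately show "f - g \<in> bilin_rels sA sB" by (simp add: tcls_def)
  next
    assume fg: "f - g \<in> bilin_rels sA sB"
    have "x - g = (x - f) + (f - g)" "x - f = (x - g) - (f - g)" for x by simp_all
    then have "x - f \<in> bilin_rels sA sB \<longleftrightarrow> x - g \<in> bilin_rels sA sB" for x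
      using F.subspace_add[OF sub _ fg] F.subspace_diff[OF sub _ fg] by metis
    then show "tcls sA sB f = tcls sA sB g" by (simp add: tcls_def)
  qed
qed

lemma tcls3_eq_iff: "tcls3 sA sB sC f = tcls3 sA sB sC g \<longleftrightarrow> f - g \<in> trilin_rels sA sB sC"
  for sA :: "'k::field \<Rightarrow> 'a::ab_group_add \<Rightarrow> 'a" and sB :: "'k \<Rightarrow> 'b::ab_group_add \<Rightarrow> 'b"
    and sC :: "'k \<Rightarrow> 'c::ab_group_add \<Rightarrow> 'c"
proof -
  interpret F: vector_space "fscale :: 'k \<Rightarrow> ('a \<times> 'b \<times> 'c \<Rightarrow>\<^sub>0 'k) \<Rightarrow> _" by (rule vector_space_fscale)
  note sub = trilin_rels_subspace[of sA sB sC]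
  show ?thesis
  proof
    assume "tcls3 sA sB sC f = tcls3 sA sB sC g"
    moreover have "f \<in> tcls3 sA sB sC f" using F.subspace_0[OF sub] by (simp add: tcls3_def)
    ultimately show "f - g \<in> trilin_rels sA sB sC" by (simp add: tcls3_def)
  next
    assume fg: "f - g \<in> trilin_rels sA sB sC"
    have "x - g = (x - f) + (f - g)" "x - f = (x - g) - (f - g)" for x by simp_all
    then have "x - f \<in> trilin_rels sA sB sC \<longleftrightarrow> x - g \<in> trilin_rels sA sB sC" for x
      using F.subspace_add[OF sub _ fg] F.subspace_diff[OF sub _ fg] by metis
    then show "tcls3 sA sB sC f = tcls3 sA sB sC g" by (simp add: tcls3_def)
  qed
qed

lemma tcls_in_tensor_space [simp]: "tcls sA sB f \<in> tensor_space sA sB"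
  by (simp add: tensor_space_def)

lemma trep_tcls: "trep (tcls sA sB f) - f \<in> bilin_rels sA sB"
proof -
  have "f \<in> tcls sA sB f"
    using tcls_eq_iff[of sA sB f f] by (simp add: tcls_def)
  then have "trep (tcls sA sB f) \<in> tcls sA sB f"
    unfolding trep_def by (rule someI)
  then show ?thesis by (simp add: tcls_def)
qed

lemma tcls_trep: "X \<in> tensor_space sA sB \<Longrightarrow> tcls sA sB (trep X) = X"
  unfolding tensor_space_def using trep_tcls tcls_eq_iff by blast

lemma tlift_tcls:
  assumes "vector_space sV" "bilin sA sB sV \<beta>"
  shows "tlift sV \<beta> (tcls sA sB f) = lext sV (\<lambda>(a, b). \<beta> a b) f"
proof -
  interpret V: vector_space sV by fact
  show ?thesis
    using lext_bilin_rels[OF assms trep_tcls] by (simp add: tlift_conv_lext V.lext_diff)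
qed

lemmas tlift_tcls_field = tlift_tcls[OF vector_space_mult]

text \<open>
  Bilinear forms separate tensors. Equations between tensors are therefore proved by evaluating
  both sides at a form: the values are iterated sums, which read like Sweedler notation, and no
  representative of a coset has to be chosen.
\<close>

lemma tensor_eqI:
  fixes sA :: "'k::field \<Rightarrow> 'a::ab_group_add \<Rightarrow> 'a" and sB :: "'k \<Rightarrow> 'b::ab_group_add \<Rightarrow> 'b"
  assumes "X \<in> tensor_space sA sB" "Y \<in> tensor_space sA sB"
    "\<And>\<beta>. bilin sA sB (*) \<beta> \<Longrightarrow> tlift (*) \<beta> X = tlift (*) \<beta> Y"
  shows "X = Y"
proof -
  interpret K: vector_space "(*) :: 'k \<Rightarrow> 'k \<Rightarrow> 'k" by (rule vector_space_mult)
  have "trep X - trep Y \<in> bilin_rels sA sB"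
    using assms(3) by (intro bilin_relsI) (simp add: tlift_conv_lext K.lext_diff)
  then show ?thesis
    using tcls_eq_iff tcls_trep assms(1,2) by metis
qed

text \<open>
  The two sides of coassociativity are cosets of triple tensors; trilinear forms separate them.
\<close>

lemma coassoc_iff:
  fixes sA :: "'k::field \<Rightarrow> 'a::ab_group_add \<Rightarrow> 'a" and sH :: "'k \<Rightarrow> 'h::ab_group_add \<Rightarrow> 'h"
  shows "tmap_coact_id sA sH \<rho> X = tmap_id_comult sA sH \<Delta> X \<longleftrightarrow>
    (\<forall>\<gamma>. trilin sA sH sH (*) \<gamma> \<longrightarrow>
      tlift (*) (\<lambda>a h. tlift (*) (\<lambda>a' h'. \<gamma> a' h' h) (\<rho> a)) X =
      tlift (*) (\<lambda>a h. tlift (*) (\<lambda>h' h''. \<gamma> a h' h'') (\<Delta> h)) X)" (is "?L \<longleftrightarrow> ?R")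
proof -
  interpret K: vector_space "(*) :: 'k \<Rightarrow> 'k \<Rightarrow> 'k" by (rule vector_space_mult)
  let ?f = "fext (\<lambda>(a, h). fext (\<lambda>(a', h'). fbasis (a', h', h)) (trep (\<rho> a))) (trep X)"
  let ?g = "fext (\<lambda>(a, h). fext (\<lambda>(h', h''). fbasis (a, h', h'')) (trep (\<Delta> h))) (trep X)"
  have "?L \<longleftrightarrow> (\<forall>\<gamma>. trilin sA sH sH (*) \<gamma> \<longrightarrow> lext (*) (\<lambda>(a, b, c). \<gamma> a b c) (?f - ?g) = 0)"
    unfolding tmap_coact_id_def tmap_id_comult_def tcls3_eq_iff
    using trilin_relsI lext_trilin_rels[OF K.vector_space_axioms] by blast
  then show ?thesis
    by (simp add: K.lext_diff K.lext_fext tlift_conv_lext case_prod_unfold)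
qed

context vector_space
begin

lemma tlift_fun_add:
  "tlift scale (\<lambda>a b. \<beta> a b + \<beta>' a b) X = tlift scale \<beta> X + tlift scale \<beta>' X"
  unfolding tlift_conv_lext by (simp add: lext_fun_add case_prod_unfold)

lemma tlift_fun_scale: "tlift scale (\<lambda>a b. scale c (\<beta> a b)) X = scale c (tlift scale \<beta> X)"
  unfolding tlift_conv_lext by (simp add: lext_fun_scale case_prod_unfold)

lemma tlift_swap:
  "tlift scale (\<lambda>a b. tlift scale (\<lambda>c d. B a b c d) Y) X =
    tlift scale (\<lambda>c d. tlift scale (\<lambda>a b. B a b c d) X) Y"
  unfolding tlift_conv_lext case_prod_unfold by (rule lext_swap)

lemma tlift_fun_zero: "tlift scale (\<lambda>a b. 0) X = 0"
  by (simp add: tlift_conv_lext case_prod_unfold)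

end

lemmas tlift_field =
  vector_space.tlift_fun_add[OF vector_space_mult]
  vector_space.tlift_fun_scale[OF vector_space_mult]
  vector_space.tlift_fun_zero[OF vector_space_mult]

lemma linear_tlift:
  assumes "Vector_Spaces.linear sV sW L"
  shows "L (tlift sV \<beta> X) = tlift sW (\<lambda>a b. L (\<beta> a b)) X"
  using linear_lext[OF assms] by (simp add: tlift_conv_lext case_prod_unfold)

lemma tlift_tmap:
  assumes "vector_space sV" "bilin sA sB sV \<beta>"
  shows "tlift sV \<beta> (tmap sA sB f g X) = tlift sV (\<lambda>c d. \<beta> (f c) (g d)) X"
proof -
  interpret V: vector_space sV by fact
  show ?thesis
    unfolding tmap_def tlift_tcls[OF assms] V.lext_fext
    by (simp add: tlift_conv_lext case_prod_unfold)
qed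

lemma lext_ftimes:
  assumes "vector_space sV"
  shows "lext sV (\<lambda>(a, b). \<beta> a b) (ftimes f g) =
    lext sV (\<lambda>(a, b). lext sV (\<lambda>(a', b'). \<beta> (a * a') (b * b')) g) f"
proof -
  interpret V: vector_space sV by fact
  show ?thesis by (simp add: ftimes_def V.lext_fext case_prod_unfold)
qed

text \<open>
  The definition of a homomorphism into a tensor product speaks of chosen representatives.
  Evaluation at bilinear maps eliminates the choice, and conversely the values at bilinear forms
  suffice to recognize a homomorphism.
\<close>

lemma tensor_algebra_homD:
  assumes "tensor_algebra_hom sC sA sB \<rho>"
  shows "\<rho> x \<in> tensor_space sA sB"
    and "vector_space sV \<Longrightarrow> bilin sA sB sV \<beta> \<Longrightarrow>
      tlift sV \<beta> (\<rho> (x + y)) = tlift sV \<beta> (\<rho> x) + tlift sV \<beta> (\<rho> y)"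
    and "vector_space sV \<Longrightarrow> bilin sA sB sV \<beta> \<Longrightarrow> tlift sV \<beta> (\<rho> (sC r x)) = sV r (tlift sV \<beta> (\<rho> x))"
    and "vector_space sV \<Longrightarrow> bilin sA sB sV \<beta> \<Longrightarrow> tlift sV \<beta> (\<rho> (x * y)) =
      tlift sV (\<lambda>a b. tlift sV (\<lambda>a' b'. \<beta> (a * a') (b * b')) (\<rho> y)) (\<rho> x)"
proof -
  note D = assms[unfolded tensor_algebra_hom_def]
  show "\<rho> x \<in> tensor_space sA sB" using D by blast
  have D1: "\<rho> (x + y) = tcls sA sB (trep (\<rho> x) + trep (\<rho> y))"
    and D2: "\<rho> (sC r x) = tcls sA sB (fscale r (trep (\<rho> x)))"
    and D3: "\<rho> (x * y) = tcls sA sB (ftimes (trep (\<rho> x)) (trep (\<rho> y)))"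
    using D by blast+
  show "tlift sV \<beta> (\<rho> (x + y)) = tlift sV \<beta> (\<rho> x) + tlift sV \<beta> (\<rho> y)"
    if "vector_space sV" "bilin sA sB sV \<beta>"
  proof -
    interpret V: vector_space sV by fact
    show ?thesis unfolding D1 tlift_tcls[OF that] V.lext_add by (simp only: tlift_conv_lext)
  qed
  show "tlift sV \<beta> (\<rho> (sC r x)) = sV r (tlift sV \<beta> (\<rho> x))"
    if "vector_space sV" "bilin sA sB sV \<beta>"
  proof -
    interpret V: vector_space sV by fact
    show ?thesis unfolding D2 tlift_tcls[OF that] V.lext_fscale by (simp only: tlift_conv_lext)
  qed
  show "tlift sV \<beta> (\<rho> (x * y)) =
      tlift sV (\<lambda>a b. tlift sV (\<lambda>a' b'. \<beta> (a * a') (b * b')) (\<rho> y)) (\<rho> x)"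
    if "vector_space sV" "bilin sA sB sV \<beta>"
    unfolding D3 tlift_tcls[OF that] lext_ftimes[OF that(1)] by (simp only: tlift_conv_lext)
qed

lemma tensor_algebra_homI:
  fixes sC :: "'k::field \<Rightarrow> 'c::ring_1 \<Rightarrow> 'c"
    and sA :: "'k \<Rightarrow> 'a::ring_1 \<Rightarrow> 'a" and sB :: "'k \<Rightarrow> 'b::ring_1 \<Rightarrow> 'b"
  assumes "\<And>x. \<rho> x \<in> tensor_space sA sB"
    and "\<And>\<beta> x y. bilin sA sB (*) \<beta> \<Longrightarrow>
      tlift (*) \<beta> (\<rho> (x + y)) = tlift (*) \<beta> (\<rho> x) + tlift (*) \<beta> (\<rho> y)"
    and "\<And>\<beta> r x. bilin sA sB (*) \<beta> \<Longrightarrow> tlift (*) \<beta> (\<rho> (sC r x)) = r * tlift (*) \<beta> (\<rho> x)"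
    and "\<And>\<beta> x y. bilin sA sB (*) \<beta> \<Longrightarrow> tlift (*) \<beta> (\<rho> (x * y)) =
      tlift (*) (\<lambda>a b. tlift (*) (\<lambda>a' b'. \<beta> (a * a') (b * b')) (\<rho> y)) (\<rho> x)"
  shows "tensor_algebra_hom sC sA sB \<rho>"
proof -
  interpret K: vector_space "(*) :: 'k \<Rightarrow> 'k \<Rightarrow> 'k" by (rule vector_space_mult)
  note t = tlift_tcls_field
  show ?thesis
    unfolding tensor_algebra_hom_def
  proof (intro conjI allI)
    show "\<rho> x \<in> tensor_space sA sB" for x by (rule assms(1))
    show "\<rho> (x + y) = tcls sA sB (trep (\<rho> x) + trep (\<rho> y))" for x y
      by (rule tensor_eqI[of _ sA sB]) (simp_all add: assms(1,2) t K.lext_add, simp add: tlift_conv_lext)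
    show "\<rho> (sC r x) = tcls sA sB (fscale r (trep (\<rho> x)))" for r x
      by (rule tensor_eqI[of _ sA sB]) (simp_all add: assms(1,3) t K.lext_fscale, simp add: tlift_conv_lext)
    show "\<rho> (x * y) = tcls sA sB (ftimes (trep (\<rho> x)) (trep (\<rho> y)))" for x y
      by (rule tensor_eqI[of _ sA sB]) 
        (simp_all add: assms(1,4) t lext_ftimes[OF vector_space_mult], simp add: tlift_conv_lext)
  qed
qed

section \<open>Algebra maps are determined on generators\<close>

text \<open>
  The unital subalgebra generated by \<open>X\<close>, as an inductive set: statements that are stable under
  the algebra operations are proved on generators by its induction rule.
\<close>

inductive_set alg_span :: "('k \<Rightarrow> 'a::ring_1 \<Rightarrow> 'a) \<Rightarrow> 'a set \<Rightarrow> 'a set" for s X where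
  gen: "x \<in> X \<Longrightarrow> x \<in> alg_span s X"
| one: "1 \<in> alg_span s X"
| add: "x \<in> alg_span s X \<Longrightarrow> y \<in> alg_span s X \<Longrightarrow> x + y \<in> alg_span s X"
| scale: "x \<in> alg_span s X \<Longrightarrow> s c x \<in> alg_span s X"
| mult: "x \<in> alg_span s X \<Longrightarrow> y \<in> alg_span s X \<Longrightarrow> x * y \<in> alg_span s X"

lemma k_algebra_mult: "k_algebra ((*) :: 'k::field \<Rightarrow> 'k \<Rightarrow> 'k)"
  by (intro k_algebra.intro vector_space_mult) (unfold_locales, simp_all)

lemma k_algebra_vector_space: "k_algebra s \<Longrightarrow> vector_space s"
  by (simp add: k_algebra_def)

lemma algebra_homI:
  assumes "k_algebra sA" "k_algebra sB" "f 1 = 1" "\<And>x y. f (x + y) = f x + f y"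
    "\<And>c x. f (sA c x) = sB c (f x)" "\<And>x y. f (x * y) = f x * f y"
  shows "algebra_hom sA sB f"
  using assms by (simp add: algebra_hom_def Vector_Spaces.linear_iff k_algebra_vector_space)

lemma algebra_homD:
  assumes "algebra_hom sA sB f"
  shows "f 1 = 1" "f (x + y) = f x + f y" "f (sA c x) = sB c (f x)" "f (x * y) = f x * f y"
    "f 0 = 0" "f (x - y) = f x - f y" "f (- x) = - f x"
proof -
  interpret Vector_Spaces.linear sA sB f using assms by (simp add: algebra_hom_def)
  show "f 1 = 1" "f (x + y) = f x + f y" "f (sA c x) = sB c (f x)" "f (x * y) = f x * f y"
    "f 0 = 0" "f (x - y) = f x - f y" "f (- x) = - f x"
    using assms by (simp_all add: algebra_hom_def add scale diff neg)
qed

lemma algebra_hom_eq_on_alg_span: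
  assumes "algebra_hom sA sB f" "algebra_hom sA sB g" "\<And>x. x \<in> X \<Longrightarrow> f x = g x"
    and "x \<in> alg_span sA X"
  shows "f x = g x"
  using assms(4)
  by induction (simp_all add: assms(3) algebra_homD[OF assms(1)] algebra_homD[OF assms(2)])

lemma tensor_algebra_hom_eq_on_alg_span:
  assumes f: "tensor_algebra_hom sC sA sB f" and g: "tensor_algebra_hom sC sA sB g"
    and "f 1 = g 1" "\<And>x. x \<in> X \<Longrightarrow> f x = g x" "x \<in> alg_span sC X"
  shows "f x = g x"
  using assms(5)
proof induction
  case (add x y)
  then show ?case using f g by (simp add: tensor_algebra_hom_def)
next
  case (scale x c)
  then show ?case using f g by (simp add: tensor_algebra_hom_def)
next
  case (mult x y)
  then show ?case using f g by (simp add: tensor_algebra_hom_def)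
qed (use assms in simp_all)

lemma tlift_mult:
  assumes "k_algebra s"
  shows "tlift s (\<lambda>a b. u * \<beta> a b) X = u * tlift s \<beta> X"
    and "tlift s (\<lambda>a b. \<beta> a b * u) X = tlift s \<beta> X * u"
proof -
  interpret k_algebra s by fact
  have l: "Vector_Spaces.linear s s (\<lambda>z. u * z)" and r: "Vector_Spaces.linear s s (\<lambda>z. z * u)"
    by (simp_all add: Vector_Spaces.linear_iff vector_space_axioms distrib_left distrib_right
        scale_mult_left scale_mult_right)
  show "tlift s (\<lambda>a b. u * \<beta> a b) X = u * tlift s \<beta> X"
    by (rule linear_tlift[OF l, symmetric])
  show "tlift s (\<lambda>a b. \<beta> a b * u) X = tlift s \<beta> X * u"
    by (rule linear_tlift[OF r, symmetric])
qed

text \<open>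
  Since the images of \<open>f\<close> and \<open>g\<close> commute, \<open>f (a a') g (b b') = (f a g b) (f a' g b')\<close>. With the
  counit for one of the two maps, the counit axioms become equations between algebra homomorphisms,
  which hold as soon as they hold on generators.
\<close>

lemma tensor_fold_hom:
  assumes \<rho>: "tensor_algebra_hom sC sA sB \<rho>" "\<rho> 1 = tcls sA sB (fbasis (1, 1))"
    and alg: "k_algebra sC" "k_algebra sD"
    and f: "algebra_hom sA sD f" and g: "algebra_hom sB sD g"
    and comm: "\<And>a b. f a * g b = g b * f a"
  shows "algebra_hom sC sD (\<lambda>x. tlift sD (\<lambda>a b. f a * g b) (\<rho> x))"
proof -
  interpret D: k_algebra sD by fact
  note vs = D.vector_space_axioms
  have bil: "bilin sA sB sD (\<lambda>a b. f a * g b)"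
    by (rule bilinI) (simp_all add: algebra_homD[OF f] algebra_homD[OF g] distrib_left distrib_right
        D.scale_mult_left D.scale_mult_right)
  show ?thesis
  proof (rule algebra_homI)
    show "tlift sD (\<lambda>a b. f a * g b) (\<rho> 1) = 1"
      by (simp add: \<rho>(2) tlift_tcls[OF vs bil] D.lext_fbasis algebra_homD[OF f] algebra_homD[OF g])
    fix x y
    have "f (a * a') * g (b * b') = (f a * g b) * (f a' * g b')" for a a' b b'
      by (simp add: algebra_homD[OF f] algebra_homD[OF g]) (metis comm mult.assoc)
    then show "tlift sD (\<lambda>a b. f a * g b) (\<rho> (x * y)) =
        tlift sD (\<lambda>a b. f a * g b) (\<rho> x) * tlift sD (\<lambda>a b. f a * g b) (\<rho> y)"
      by (simp add: tensor_algebra_homD(4)[OF \<rho>(1) vs bil] tlift_mult[OF alg(2)])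
  qed (simp_all add: alg tensor_algebra_homD(2,3)[OF \<rho>(1) vs bil])
qed

lemma bilin_mult:
  assumes "k_algebra sA" "k_algebra sB" "bilin sA sB sV \<beta>"
  shows "bilin sA sB sV (\<lambda>a' b'. \<beta> (a * a') (b * b'))"
    and "bilin sA sB sV (\<lambda>a b. \<beta> (a * a') (b * b'))"
proof -
  interpret A: k_algebra sA by fact
  interpret B: k_algebra sB by fact
  show "bilin sA sB sV (\<lambda>a' b'. \<beta> (a * a') (b * b'))" "bilin sA sB sV (\<lambda>a b. \<beta> (a * a') (b * b'))"
    by (rule bilinI; simp add: distrib_left distrib_right A.scale_mult_left A.scale_mult_right
        B.scale_mult_left B.scale_mult_right bilin_simps[OF assms(3)])+
qed

lemma bilin_lext:
  assumes "vector_space sV" "\<And>z. bilin sA sB sV (\<lambda>a b. B a b z)"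
  shows "bilin sA sB sV (\<lambda>a b. lext sV (\<lambda>z. B a b z) f)"
proof -
  interpret V: vector_space sV by fact
  show ?thesis
    by (rule bilinI) (simp_all add: bilin_simps[OF assms(2)] V.lext_fun_add V.lext_fun_scale)
qed

lemma bilin_tlift:
  assumes "vector_space sV" "\<And>c d. bilin sA sB sV (\<lambda>a b. B a b c d)"
  shows "bilin sA sB sV (\<lambda>a b. tlift sV (\<lambda>c d. B a b c d) X)"
  unfolding tlift_conv_lext
  by (rule bilin_lext[OF assms(1)]) (use assms(2) in \<open>auto split: prod.split\<close>)

lemma tensor_algebra_hom_tmap:
  assumes \<rho>: "tensor_algebra_hom sC sA sB \<rho>" and alg: "k_algebra sA'" "k_algebra sB'"
    and f: "algebra_hom sA sA' f" and g: "algebra_hom sB sB' g"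
  shows "tensor_algebra_hom sC sA' sB' (\<lambda>x. tmap sA' sB' f g (\<rho> x))"
proof (rule tensor_algebra_homI)
  show "tmap sA' sB' f g (\<rho> x) \<in> tensor_space sA' sB'" for x
    by (simp add: tmap_def)
  fix \<beta> assume \<beta>: "bilin sA' sB' (*) \<beta>"
  note t = tlift_tmap[OF vector_space_mult \<beta>]
  have bil: "bilin sA sB (*) (\<lambda>a b. \<beta> (f a) (g b))"
    by (rule bilinI) (simp_all add: algebra_homD[OF f] algebra_homD[OF g] bilin_simps[OF \<beta>])
  note h = tensor_algebra_homD(2-)[OF \<rho> vector_space_mult bil]
  show "tlift (*) \<beta> (tmap sA' sB' f g (\<rho> (x + y))) =
      tlift (*) \<beta> (tmap sA' sB' f g (\<rho> x)) + tlift (*) \<beta> (tmap sA' sB' f g (\<rho> y))" for x y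
    by (simp add: t h)
  show "tlift (*) \<beta> (tmap sA' sB' f g (\<rho> (sC r x))) = r * tlift (*) \<beta> (tmap sA' sB' f g (\<rho> x))" for r x
    by (simp add: t h)
  note b = bilin_mult[OF alg \<beta>]
  show "tlift (*) \<beta> (tmap sA' sB' f g (\<rho> (x * y))) =
       tlift (*) (\<lambda>a b. tlift (*) (\<lambda>a' b'. \<beta> (a * a') (b * b')) (tmap sA' sB' f g (\<rho> y)))
        (tmap sA' sB' f g (\<rho> x))" for x y
    by (simp add: t h tlift_tmap[OF vector_space_mult bilin_tlift[OF vector_space_mult b(2)]]
        tlift_tmap[OF vector_space_mult b(1)] algebra_homD[OF f] algebra_homD[OF g])
qed

lemma tensor_algebra_hom_comp:
  assumes \<rho>: "tensor_algebra_hom sC sA sB \<rho>" and f: "algebra_hom sD sC f"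
  shows "tensor_algebra_hom sD sA sB (\<lambda>x. \<rho> (f x))"
  using assms(1) by (simp add: tensor_algebra_hom_def algebra_homD[OF f])

section \<open>Coassociativity on generators\<close>

text \<open>
  Coassociativity at a single element. The coaction \<open>\<rho>\<close> and the comultiplication \<open>\<Delta>\<close> are kept
  apart, so that the notion covers comodules as well as the coalgebra itself (\<open>\<rho> = \<Delta>\<close>).
\<close>

definition coassoc_at ::
  "('k::field \<Rightarrow> 'a::ab_group_add \<Rightarrow> 'a) \<Rightarrow> ('k \<Rightarrow> 'h::ab_group_add \<Rightarrow> 'h) \<Rightarrow>
     ('a \<Rightarrow> ('a \<times> 'h \<Rightarrow>\<^sub>0 'k) set) \<Rightarrow> ('h \<Rightarrow> ('h \<times> 'h \<Rightarrow>\<^sub>0 'k) set) \<Rightarrow> 'a \<Rightarrow> bool" where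
  "coassoc_at sA sH \<rho> \<Delta> x \<longleftrightarrow> (\<forall>\<gamma>. trilin sA sH sH (*) \<gamma> \<longrightarrow>
      tlift (*) (\<lambda>a h. tlift (*) (\<lambda>a' h'. \<gamma> a' h' h) (\<rho> a)) (\<rho> x) =
      tlift (*) (\<lambda>a h. tlift (*) (\<lambda>h' h''. \<gamma> a h' h'') (\<Delta> h)) (\<rho> x))"

lemma bilin_coact_left:
  assumes \<rho>: "tensor_algebra_hom sA sA sH \<rho>" and \<gamma>: "trilin sA sH sH (*) \<gamma>"
  shows "bilin sA sH (*) (\<lambda>a h. tlift (*) (\<lambda>a' h'. \<gamma> a' h' h) (\<rho> a))"
  by (rule bilinI) (simp_all add: tensor_algebra_homD(2,3)[OF \<rho> vector_space_mult trilin_bilin(3)[OF \<gamma>]]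
      trilin_simps[OF \<gamma>] tlift_field)

lemma bilin_coact_right:
  assumes \<Delta>: "tensor_algebra_hom sH sH sH \<Delta>" and \<gamma>: "trilin sA sH sH (*) \<gamma>"
  shows "bilin sA sH (*) (\<lambda>a h. tlift (*) (\<lambda>h' h''. \<gamma> a h' h'') (\<Delta> h))"
  by (rule bilinI) (simp_all add: tensor_algebra_homD(2,3)[OF \<Delta> vector_space_mult trilin_bilin(1)[OF \<gamma>]]
      trilin_simps[OF \<gamma>] tlift_field)

lemma trilin_mult:
  assumes "k_algebra sA" "k_algebra sH" "trilin sA sH sH sV \<gamma>"
  shows "trilin sA sH sH sV (\<lambda>b p q. \<gamma> (a * b) (h * p) (h' * q))"
    and "trilin sA sH sH sV (\<lambda>a h h'. \<gamma> (a * b) (h * p) (h' * q))"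
proof -
  interpret A: k_algebra sA by fact
  interpret H: k_algebra sH by fact
  show "trilin sA sH sH sV (\<lambda>b p q. \<gamma> (a * b) (h * p) (h' * q))"
    "trilin sA sH sH sV (\<lambda>a h h'. \<gamma> (a * b) (h * p) (h' * q))"
    by (simp_all add: trilin_def bilin_def distrib_left distrib_right A.scale_mult_left A.scale_mult_right
        H.scale_mult_left H.scale_mult_right trilin_simps[OF assms(3)])
qed

lemma trilin_tlift:
  assumes "vector_space sV" "\<And>p q. trilin sA sB sC sV (\<lambda>a b c. B a b c p q)"
  shows "trilin sA sB sC sV (\<lambda>a b c. tlift sV (\<lambda>p q. B a b c p q) X)"
  unfolding trilin_def by (intro conjI allI bilin_tlift assms(1) trilin_bilin[OF assms(2)])

text \<open>
  After both coproducts of \<open>x * y\<close> have been expanded, \<open>G\<close> collects the sums that belong to \<open>y\<close>.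
  Coassociativity at \<open>y\<close> rewrites \<open>G\<close>, and coassociativity at \<open>x\<close> is applied to the trilinear form
  \<open>G\<close>; exchanging finite sums does the rest.
\<close>

lemma coassoc_at_mult:
  assumes alg: "k_algebra sA" "k_algebra sH"
    and \<rho>: "tensor_algebra_hom sA sA sH \<rho>" and \<Delta>: "tensor_algebra_hom sH sH sH \<Delta>"
    and x: "coassoc_at sA sH \<rho> \<Delta> x" and y: "coassoc_at sA sH \<rho> \<Delta> y"
  shows "coassoc_at sA sH \<rho> \<Delta> (x * y)"
  unfolding coassoc_at_def
proof (intro allI impI)
  fix \<gamma> assume \<gamma>: "trilin sA sH sH (*) \<gamma>"
  note vs = vector_space_mult
  note \<rho>m = tensor_algebra_homD(4)[OF \<rho> vs] and \<Delta>m = tensor_algebra_homD(4)[OF \<Delta> vs]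
  note swap = vector_space.tlift_swap[OF vs]
  define G where "G = (\<lambda>a1 h1 h. tlift (*) (\<lambda>b g. tlift (*) (\<lambda>b1 g1. \<gamma> (a1 * b1) (h1 * g1) (h * g)) (\<rho> b)) (\<rho> y))"
  have G: "G a1 h1 h =
      tlift (*) (\<lambda>b g. tlift (*) (\<lambda>g1 g2. \<gamma> (a1 * b) (h1 * g1) (h * g2)) (\<Delta> g)) (\<rho> y)" for a1 h1 h
    using y trilin_mult(1)[OF alg \<gamma>] unfolding G_def coassoc_at_def by blast
  have tG: "trilin sA sH sH (*) G"
    unfolding G_def by (intro trilin_tlift vs trilin_mult(2)[OF alg \<gamma>])
  have "tlift (*) (\<lambda>a h. tlift (*) (\<lambda>a' h'. \<gamma> a' h' h) (\<rho> a)) (\<rho> (x * y)) =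
    tlift (*) (\<lambda>a h. tlift (*) (\<lambda>b g. tlift (*) (\<lambda>a1 h1. tlift (*) (\<lambda>b1 g1.
      \<gamma> (a1 * b1) (h1 * g1) (h * g)) (\<rho> b)) (\<rho> a)) (\<rho> y)) (\<rho> x)"
    by (simp add: \<rho>m[OF bilin_coact_left[OF \<rho> \<gamma>]] \<rho>m[OF trilin_bilin(3)[OF \<gamma>]])
  also have "\<dots> = tlift (*) (\<lambda>a h. tlift (*) (\<lambda>a1 h1. G a1 h1 h) (\<rho> a)) (\<rho> x)"
    unfolding G_def by (subst swap) (rule refl)
  also have "\<dots> = tlift (*) (\<lambda>a h. tlift (*) (\<lambda>h1 h2. G a h1 h2) (\<Delta> h)) (\<rho> x)"
    using x tG unfolding coassoc_at_def by blast
  also have "\<dots> = tlift (*) (\<lambda>a h. tlift (*) (\<lambda>b g. tlift (*) (\<lambda>h1 h2. tlift (*) (\<lambda>g1 g2.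
      \<gamma> (a * b) (h1 * g1) (h2 * g2)) (\<Delta> g)) (\<Delta> h)) (\<rho> y)) (\<rho> x)"
    unfolding G by (subst swap) (rule refl)
  also have "\<dots> = tlift (*) (\<lambda>a h. tlift (*) (\<lambda>h' h''. \<gamma> a h' h'') (\<Delta> h)) (\<rho> (x * y))"
    by (simp add: \<rho>m[OF bilin_coact_right[OF \<Delta> \<gamma>]] \<Delta>m[OF trilin_bilin(1)[OF \<gamma>]])
  finally show "tlift (*) (\<lambda>a h. tlift (*) (\<lambda>a' h'. \<gamma> a' h' h) (\<rho> a)) (\<rho> (x * y)) =
    tlift (*) (\<lambda>a h. tlift (*) (\<lambda>h' h''. \<gamma> a h' h'') (\<Delta> h)) (\<rho> (x * y))" .
qed

lemma coassoc_at_alg_span: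
  assumes alg: "k_algebra sA" "k_algebra sH"
    and \<rho>: "tensor_algebra_hom sA sA sH \<rho>" and \<Delta>: "tensor_algebra_hom sH sH sH \<Delta>"
    and one: "\<rho> 1 = tcls sA sH (fbasis (1, 1))" "\<Delta> 1 = tcls sH sH (fbasis (1, 1))"
    and X: "\<And>x. x \<in> X \<Longrightarrow> coassoc_at sA sH \<rho> \<Delta> x" and x: "x \<in> alg_span sA X"
  shows "coassoc_at sA sH \<rho> \<Delta> x"
  using x
proof induction
  case (gen x)
  then show ?case by (rule X)
next
  case one
  show ?case unfolding coassoc_at_def
  proof (intro allI impI)
    fix \<gamma> assume \<gamma>: "trilin sA sH sH (*) \<gamma>"
    show "tlift (*) (\<lambda>a h. tlift (*) (\<lambda>a' h'. \<gamma> a' h' h) (\<rho> a)) (\<rho> 1) =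
       tlift (*) (\<lambda>a h. tlift (*) (\<gamma> a) (\<Delta> h)) (\<rho> 1)"
      by (simp add: assms(5,6) lext_field tlift_tcls_field[OF bilin_coact_left[OF \<rho> \<gamma>]]
        tlift_tcls_field[OF bilin_coact_right[OF \<Delta> \<gamma>]]
        tlift_tcls_field[OF trilin_bilin(1)[OF \<gamma>]]
        tlift_tcls_field[OF trilin_bilin(3)[OF \<gamma>]])
  qed
next
  case (add x y)
  then show ?case unfolding coassoc_at_def
    by (simp add: tensor_algebra_homD(2)[OF \<rho> vector_space_mult bilin_coact_left[OF \<rho>]]
        tensor_algebra_homD(2)[OF \<rho> vector_space_mult bilin_coact_right[OF \<Delta>]])
next
  case (scale x c)
  then show ?case unfolding coassoc_at_def
    by (simp add: tensor_algebra_homD(3)[OF \<rho> vector_space_mult bilin_coact_left[OF \<rho>]]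
        tensor_algebra_homD(3)[OF \<rho> vector_space_mult bilin_coact_right[OF \<Delta>]])
next
  case (mult x y)
  then show ?case by (intro coassoc_at_mult[OF alg \<rho> \<Delta>])
qed

section \<open>Hopf algebras and their homomorphisms on generators\<close>

text \<open>
  Coassociativity and the counit axioms compare multiplicative maps. The antipode axioms are
  stable under products because \<open>S\<close> reverses them: in \<open>S (a c) b d = S c (S a b) d\<close> the sum over
  the coproduct of the first factor collapses to a scalar.
\<close>

lemma hopf_algebraI:
  assumes alg: "k_algebra (scl H)"
    and \<Delta>: "tensor_algebra_hom (scl H) (scl H) (scl H) (comult H)"
      "comult H 1 = tcls (scl H) (scl H) (fbasis (1, 1))"
    and \<epsilon>: "algebra_hom (scl H) (*) (counit H)"
    and S: "Vector_Spaces.linear (scl H) (scl H) (antipode H)" "antipode H 1 = 1"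
      "\<And>x y. antipode H (x * y) = antipode H y * antipode H x"
    and X: "alg_span (scl H) X = UNIV"
    and coassoc: "\<And>x. x \<in> X \<Longrightarrow> coassoc_at (scl H) (scl H) (comult H) (comult H) x"
    and counit: "\<And>x. x \<in> X \<Longrightarrow> tlift (scl H) (\<lambda>x y. scl H (counit H x) y) (comult H x) = x"
      "\<And>x. x \<in> X \<Longrightarrow> tlift (scl H) (\<lambda>x y. scl H (counit H y) x) (comult H x) = x"
    and antipode: "\<And>x. x \<in> X \<Longrightarrow> tlift (scl H) (\<lambda>x y. antipode H x * y) (comult H x) = scl H (counit H x) 1"
      "\<And>x. x \<in> X \<Longrightarrow> tlift (scl H) (\<lambda>x y. x * antipode H y) (comult H x) = scl H (counit H x) 1"
  shows "hopf_algebra H"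
proof -
  interpret H: k_algebra "scl H" by fact
  interpret S: Vector_Spaces.linear "scl H" "scl H" "antipode H" by fact
  note vs = H.vector_space_axioms
  have span: "x \<in> alg_span (scl H) X" for x using X by simp
  have id: "algebra_hom (scl H) (scl H) (\<lambda>x. x)"
    by (intro algebra_homI alg) simp_all
  have e: "algebra_hom (scl H) (scl H) (\<lambda>x. scl H (counit H x) 1)"
    by (intro algebra_homI alg)
      (simp_all add: algebra_homD[OF \<epsilon>] H.scale_left_distrib H.scale_mult_left)
  have bil: "bilin (scl H) (scl H) (scl H) (\<lambda>x y. antipode H x * y)"
      "bilin (scl H) (scl H) (scl H) (\<lambda>x y. x * antipode H y)"
    by (rule bilinI; simp add: S.add S.scale distrib_left distrib_right H.scale_mult_left
        H.scale_mult_right)+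
  show ?thesis
  proof
    show "tmap_coact_id (scl H) (scl H) (comult H) (comult H h) =
         tmap_id_comult (scl H) (scl H) (comult H) (comult H h)" for h
      using coassoc_at_alg_span[OF alg alg \<Delta>(1) \<Delta>(1) \<Delta>(2) \<Delta>(2) coassoc span]
      unfolding coassoc_iff coassoc_at_def by blast
    have "algebra_hom (scl H) (scl H) (\<lambda>x. tlift (scl H) (\<lambda>a b. scl H (counit H a) 1 * b) (comult H x))"
      by (rule tensor_fold_hom[OF \<Delta> alg alg e id]) (simp add: H.scale_mult_left H.scale_mult_right)
    then have "algebra_hom (scl H) (scl H) (\<lambda>x. tlift (scl H) (\<lambda>a b. scl H (counit H a) b) (comult H x))"
      by (simp add: H.scale_mult_left)
    from algebra_hom_eq_on_alg_span[OF this id counit(1) span]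
    show "tlift (scl H) (\<lambda>x y. scl H (counit H x) y) (comult H h) = h" for h .
    have "algebra_hom (scl H) (scl H) (\<lambda>x. tlift (scl H) (\<lambda>a b. a * scl H (counit H b) 1) (comult H x))"
      by (rule tensor_fold_hom[OF \<Delta> alg alg id e]) (simp add: H.scale_mult_left H.scale_mult_right)
    then have "algebra_hom (scl H) (scl H) (\<lambda>x. tlift (scl H) (\<lambda>a b. scl H (counit H b) a) (comult H x))"
      by (simp add: H.scale_mult_right)
    from algebra_hom_eq_on_alg_span[OF this id counit(2) span]
    show "tlift (scl H) (\<lambda>x y. scl H (counit H y) x) (comult H h) = h" for h .
    show "tlift (scl H) (\<lambda>x y. antipode H x * y) (comult H h) = scl H (counit H h) 1" for h
      using span[of h]
    proof induction
      case (mult x y)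
      have "tlift (scl H) (\<lambda>a b. antipode H a * b) (comult H (x * y)) =
          tlift (scl H) (\<lambda>a b. tlift (scl H) (\<lambda>c d. antipode H c * (antipode H a * b) * d) (comult H y)) (comult H x)"
        by (simp add: tensor_algebra_homD(4)[OF \<Delta>(1) vs bil(1)] S(3) mult.assoc)
      also have "\<dots> = tlift (scl H) (\<lambda>c d. antipode H c * scl H (counit H x) 1 * d) (comult H y)"
        by (subst H.tlift_swap) (simp add: tlift_mult[OF alg] mult.IH(1))
      also have "\<dots> = scl H (counit H (x * y)) 1"
        by (simp add: H.scale_mult_left H.scale_mult_right H.tlift_fun_scale mult.IH(2) algebra_homD[OF \<epsilon>])
      finally show ?case .
    qed (simp_all add: antipode \<Delta>(2) tlift_tcls[OF vs bil(1)] S(2) algebra_homD[OF \<epsilon>] H.lext_fbasis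
        tensor_algebra_homD(2,3)[OF \<Delta>(1) vs bil(1)] H.scale_left_distrib)
    show "tlift (scl H) (\<lambda>x y. x * antipode H y) (comult H h) = scl H (counit H h) 1" for h
      using span[of h]
    proof induction
      case (mult x y)
      have "tlift (scl H) (\<lambda>a b. a * antipode H b) (comult H (x * y)) =
          tlift (scl H) (\<lambda>a b. tlift (scl H) (\<lambda>c d. a * (c * antipode H d) * antipode H b) (comult H y)) (comult H x)"
        by (simp add: tensor_algebra_homD(4)[OF \<Delta>(1) vs bil(2)] S(3) mult.assoc)
      also have "\<dots> = tlift (scl H) (\<lambda>a b. a * scl H (counit H y) 1 * antipode H b) (comult H x)"
        by (simp add: tlift_mult[OF alg] mult.IH(2))
      also have "\<dots> = scl H (counit H (x * y)) 1"
        by (simp add: H.scale_mult_left H.scale_mult_right H.tlift_fun_scale mult.IH(1) algebra_homD[OF \<epsilon>]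
            mult.commute)
      finally show ?case .
    qed (simp_all add: antipode \<Delta>(2) tlift_tcls[OF vs bil(2)] S(2) algebra_homD[OF \<epsilon>] H.lext_fbasis
        tensor_algebra_homD(2,3)[OF \<Delta>(1) vs bil(2)] H.scale_left_distrib)
  qed (fact alg \<Delta> \<epsilon> S(1))+
qed

text \<open>
  Both iterated coproducts of \<open>x\<close> are \<open>x \<otimes> c \<otimes> c + g \<otimes> x \<otimes> c + g \<otimes> g \<otimes> x\<close>.
\<close>

lemma coassoc_at_skew_primitive:
  assumes \<Delta>: "tensor_algebra_hom s s s \<Delta>"
    and g: "\<Delta> g = tcls s s (fbasis (g, g))" and c: "\<Delta> c = tcls s s (fbasis (c, c))"
    and x: "\<Delta> x = tcls s s (fbasis (x, c) + fbasis (g, x))"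
  shows "coassoc_at s s \<Delta> \<Delta> x"
  unfolding coassoc_at_def
proof (intro allI impI)
  fix \<gamma> assume \<gamma>: "trilin s s s (*) \<gamma>"
  note t = tlift_tcls_field
  show "tlift (*) (\<lambda>a h. tlift (*) (\<lambda>a' h'. \<gamma> a' h' h) (\<Delta> a)) (\<Delta> x) =
      tlift (*) (\<lambda>a h. tlift (*) (\<lambda>h' h''. \<gamma> a h' h'') (\<Delta> h)) (\<Delta> x)"
    unfolding x t[OF bilin_coact_left[OF \<Delta> \<gamma>]] t[OF bilin_coact_right[OF \<Delta> \<gamma>]]
    by (simp add: lext_field x g c t[OF trilin_bilin(1)[OF \<gamma>]] t[OF trilin_bilin(3)[OF \<gamma>]])
qed

lemma coassoc_at_grouplike:
  assumes \<Delta>: "tensor_algebra_hom s s s \<Delta>" and g: "\<Delta> g = tcls s s (fbasis (g, g))"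
  shows "coassoc_at s s \<Delta> \<Delta> g"
  unfolding coassoc_at_def
proof (intro allI impI)
  fix \<gamma> assume \<gamma>: "trilin s s s (*) \<gamma>"
  note t = tlift_tcls_field
  show "tlift (*) (\<lambda>a h. tlift (*) (\<lambda>a' h'. \<gamma> a' h' h) (\<Delta> a)) (\<Delta> g) =
      tlift (*) (\<lambda>a h. tlift (*) (\<lambda>h' h''. \<gamma> a h' h'') (\<Delta> h)) (\<Delta> g)"
    unfolding g t[OF bilin_coact_left[OF \<Delta> \<gamma>]] t[OF bilin_coact_right[OF \<Delta> \<gamma>]]
    by (simp add: lext_field g t[OF trilin_bilin(1)[OF \<gamma>]] t[OF trilin_bilin(3)[OF \<gamma>]])
qed

text \<open>
  On group-like and skew-primitive generators the Hopf algebra axioms are identities in the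
  algebra \<open>H\<close>. The Hopf algebras of the classification are all generated by such elements.
\<close>

lemma hopf_algebra_pointedI:
  assumes alg: "k_algebra (scl H)"
    and \<Delta>: "tensor_algebra_hom (scl H) (scl H) (scl H) (comult H)"
      "comult H 1 = tcls (scl H) (scl H) (fbasis (1, 1))"
    and \<epsilon>: "algebra_hom (scl H) (*) (counit H)"
    and S: "Vector_Spaces.linear (scl H) (scl H) (antipode H)" "antipode H 1 = 1"
      "\<And>x y. antipode H (x * y) = antipode H y * antipode H x"
    and gen: "alg_span (scl H) (G \<union> P) = UNIV"
    and G: "\<And>g. g \<in> G \<Longrightarrow> comult H g = tcls (scl H) (scl H) (fbasis (g, g)) \<and> counit H g = 1 \<and>
      antipode H g * g = 1 \<and> g * antipode H g = 1"
    and P: "\<And>x. x \<in> P \<Longrightarrow> \<exists>g\<in>insert 1 G. \<exists>c\<in>insert 1 G.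
      comult H x = tcls (scl H) (scl H) (fbasis (x, c) + fbasis (g, x)) \<and> counit H x = 0 \<and>
      antipode H x * c + antipode H g * x = 0 \<and> x * antipode H c + g * antipode H x = 0"
  shows "hopf_algebra H"
proof -
  interpret H: k_algebra "scl H" by fact
  interpret S: Vector_Spaces.linear "scl H" "scl H" "antipode H" by fact
  have bil: "bilin (scl H) (scl H) (scl H) (\<lambda>x y. scl H (counit H x) y)"
    "bilin (scl H) (scl H) (scl H) (\<lambda>x y. scl H (counit H y) x)"
    "bilin (scl H) (scl H) (scl H) (\<lambda>x y. antipode H x * y)"
    "bilin (scl H) (scl H) (scl H) (\<lambda>x y. x * antipode H y)"
    by (rule bilinI; simp add: algebra_homD[OF \<epsilon>] H.scale_left_distrib H.scale_right_distrib S.add S.scale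
        distrib_left distrib_right H.scale_mult_left H.scale_mult_right mult.commute)+
  note t = bil[THEN tlift_tcls[OF H.vector_space_axioms]]
  have G1: "comult H g = tcls (scl H) (scl H) (fbasis (g, g)) \<and> counit H g = 1" if "g \<in> insert 1 G" for g
    using that G \<Delta>(2) algebra_homD(1)[OF \<epsilon>] by auto
  have ax: "coassoc_at (scl H) (scl H) (comult H) (comult H) x \<and>
      tlift (scl H) (\<lambda>x y. scl H (counit H x) y) (comult H x) = x \<and>
      tlift (scl H) (\<lambda>x y. scl H (counit H y) x) (comult H x) = x \<and>
      tlift (scl H) (\<lambda>x y. antipode H x * y) (comult H x) = scl H (counit H x) 1 \<and>
      tlift (scl H) (\<lambda>x y. x * antipode H y) (comult H x) = scl H (counit H x) 1"
    if "x \<in> G \<union> P" for x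
  proof (cases "x \<in> G")
    case True
    from G[OF this] show ?thesis
      by (auto intro: coassoc_at_grouplike[OF \<Delta>(1)] simp: t H.lext_fbasis)
  next
    case False
    then obtain g c where gc: "g \<in> insert 1 G" "c \<in> insert 1 G"
      and x: "comult H x = tcls (scl H) (scl H) (fbasis (x, c) + fbasis (g, x))" "counit H x = 0"
        "antipode H x * c + antipode H g * x = 0" "x * antipode H c + g * antipode H x = 0"
      using P \<open>x \<in> G \<union> P\<close> by blast
    have "coassoc_at (scl H) (scl H) (comult H) (comult H) x"
      using coassoc_at_skew_primitive[OF \<Delta>(1) conjunct1[OF G1[OF gc(1)]] conjunct1[OF G1[OF gc(2)]] x(1)] .
    then show ?thesis
      using G1[OF gc(1)] G1[OF gc(2)] x(2-) by (simp add: x(1) t H.lext_fbasis H.lext_add)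
  qed
  show ?thesis
    by (rule hopf_algebraI[OF alg \<Delta> \<epsilon> S gen]) (use ax in auto)
qed

context hopf_algebra
begin

sublocale k_algebra "scl H" by (rule k_alg)

sublocale S: Vector_Spaces.linear "scl H" "scl H" "antipode H" by (rule antipode_linear)

lemmas vs = vector_space_axioms
lemmas counitD = algebra_homD[OF counit_hom]

lemma coassoc_all: "coassoc_at (scl H) (scl H) (comult H) (comult H) x"
  using coassoc[of x] unfolding coassoc_iff coassoc_at_def .

lemma bilin_antipode:
  "bilin (scl H) (scl H) (scl H) (\<lambda>x y. antipode H x * y)"
  "bilin (scl H) (scl H) (scl H) (\<lambda>x y. x * antipode H y)"
  by (rule bilinI; simp add: S.add S.scale distrib_left distrib_right scale_mult_left scale_mult_right)+

lemma grouplike_antipode: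
  assumes "comult H c = tcls (scl H) (scl H) (fbasis (c, c))" "counit H c = 1"
  shows "antipode H c * c = 1" "c * antipode H c = 1"
  using antipode_left[of c] antipode_right[of c]
  by (simp_all add: assms tlift_tcls[OF vs bilin_antipode(1)] tlift_tcls[OF vs bilin_antipode(2)] lext_fbasis)

text \<open>
  In \<open>H \<otimes> H\<close> we have \<open>\<Delta> d = \<Delta> d (c \<otimes> c) (d \<otimes> d) = \<Delta> (d c) (d \<otimes> d) = d \<otimes> d\<close>.
\<close>

lemma comult_grouplike_inverse:
  assumes c: "comult H c = tcls (scl H) (scl H) (fbasis (c, c))" and cd: "d * c = 1" "c * d = 1"
  shows "comult H d = tcls (scl H) (scl H) (fbasis (d, d))"
proof (rule tensor_eqI)
  show "comult H d \<in> tensor_space (scl H) (scl H)" by (rule tensor_algebra_homD(1)[OF comult_hom])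
  show "tcls (scl H) (scl H) (fbasis (d, d)) \<in> tensor_space (scl H) (scl H)" by simp
  fix \<beta> assume \<beta>: "bilin (scl H) (scl H) (*) \<beta>"
  note \<beta>' = bilin_mult(2)[OF k_alg k_alg \<beta>, of d d]
  have "tlift (*) (\<lambda>a b. \<beta> (a * d) (b * d)) (comult H (d * c)) = tlift (*) \<beta> (comult H d)"
    unfolding tensor_algebra_homD(4)[OF comult_hom vector_space_mult \<beta>'] c
      tlift_tcls_field[OF bilin_mult(1)[OF k_alg k_alg \<beta>']]
    by (simp add: lext_field mult.assoc cd)
  then show "tlift (*) \<beta> (comult H d) = tlift (*) \<beta> (tcls (scl H) (scl H) (fbasis (d, d)))"
    by (simp add: cd(1) comult_one lext_field tlift_tcls_field[OF \<beta>'] tlift_tcls_field[OF \<beta>])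
qed

lemma counit_inverse:
  assumes "counit H c = 1" "d * c = 1"
  shows "counit H d = 1"
  using counitD(4)[of d c] assms counitD(1) by simp

end

text \<open>
  Both \<open>antipode G \<circ> \<phi>\<close> and \<open>\<phi> \<circ> antipode H\<close> are inverses of \<open>\<phi>\<close> for the convolution product. The
  threefold convolution of the first, \<open>\<phi>\<close> and the second is evaluated in two ways.
\<close>

lemma bialgebra_hom_antipode:
  assumes H: "hopf_algebra H" and G: "hopf_algebra G" and \<phi>: "algebra_hom (scl H) (scl G) \<phi>"
    and comult: "\<And>x. comult G (\<phi> x) = tmap (scl G) (scl G) \<phi> \<phi> (comult H x)"
    and counit: "\<And>x. counit G (\<phi> x) = counit H x"
  shows "antipode G (\<phi> x) = \<phi> (antipode H x)"
proof (rule functionals_separate_points[OF hopf_algebra.vs[OF G]])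
  fix l assume l: "Vector_Spaces.linear (scl G) (*) l"
  interpret H: hopf_algebra H by fact
  interpret G: hopf_algebra G by fact
  interpret l: Vector_Spaces.linear "scl G" "(*)" l by fact
  note \<phi>s = algebra_homD[OF \<phi>]
  have \<phi>l: "Vector_Spaces.linear (scl H) (scl G) \<phi>" using \<phi> by (simp add: algebra_hom_def)
  define \<gamma> where "\<gamma> = (\<lambda>a b c. l (antipode G (\<phi> a) * \<phi> b * \<phi> (antipode H c)))"
  have \<gamma>: "trilin (scl H) (scl H) (scl H) (*) \<gamma>"
    by (simp add: \<gamma>_def trilin_def bilin_def \<phi>s G.S.add G.S.scale H.S.add H.S.scale l.add l.scale
        distrib_left distrib_right G.scale_mult_left G.scale_mult_right)
  have "tlift (*) (\<lambda>a b. tlift (*) (\<lambda>a' b'. \<gamma> a' b' b) (comult H a)) (comult H x) =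
     l (tlift (scl G) (\<lambda>a b. tlift (scl G) (\<lambda>a' b'. antipode G (\<phi> a') * \<phi> b') (comult H a) *
       \<phi> (antipode H b)) (comult H x))"
    unfolding \<gamma>_def
    by (simp flip: linear_tlift[OF l] add: tlift_mult[OF G.k_alg])
  also have "\<dots> = l (tlift (scl G) (\<lambda>a b. \<phi> (antipode H (scl H (counit H a) b))) (comult H x))"
    using G.antipode_left[of "\<phi> a" for a]
    by (simp add: comult tlift_tmap[OF G.vs G.bilin_antipode(1)] counit G.scale_mult_left \<phi>s H.S.scale)
  also have "\<dots> = l (\<phi> (antipode H x))"
    by (simp flip: linear_tlift[OF \<phi>l] linear_tlift[OF H.antipode_linear] add: H.counit_left)
  finally have 1: "tlift (*) (\<lambda>a b. tlift (*) (\<lambda>a' b'. \<gamma> a' b' b) (comult H a)) (comult H x) =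
    l (\<phi> (antipode H x))" .
  have "tlift (*) (\<lambda>a b. tlift (*) (\<lambda>b' b''. \<gamma> a b' b'') (comult H b)) (comult H x) =
     l (tlift (scl G) (\<lambda>a b. antipode G (\<phi> a) * \<phi> (tlift (scl H) (\<lambda>b' b''. b' * antipode H b'') (comult H b)))
       (comult H x))"
    unfolding \<gamma>_def
    by (simp flip: linear_tlift[OF l] add: mult.assoc tlift_mult[OF G.k_alg] linear_tlift[OF \<phi>l] \<phi>s)
  also have "\<dots> = l (tlift (scl G) (\<lambda>a b. antipode G (\<phi> (scl H (counit H b) a))) (comult H x))"
    by (simp add: H.antipode_right \<phi>s G.S.scale G.scale_mult_right)
  also have "\<dots> = l (antipode G (\<phi> x))"
    by (simp flip: linear_tlift[OF \<phi>l] linear_tlift[OF G.antipode_linear] add: H.counit_right)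
  finally have 2: "tlift (*) (\<lambda>a b. tlift (*) (\<lambda>b' b''. \<gamma> a b' b'') (comult H b)) (comult H x) =
    l (antipode G (\<phi> x))" .
  show "l (antipode G (\<phi> x)) = l (\<phi> (antipode H x))"
    using H.coassoc_all[of x] \<gamma> 1 2 unfolding coassoc_at_def by metis
qed

lemma hopf_homI:
  assumes H: "hopf_algebra H" and G: "hopf_algebra G" and \<phi>: "algebra_hom (scl H) (scl G) \<phi>"
    and X: "alg_span (scl H) X = UNIV"
    and comult: "\<And>x. x \<in> X \<Longrightarrow> comult G (\<phi> x) = tmap (scl G) (scl G) \<phi> \<phi> (comult H x)"
    and counit: "\<And>x. x \<in> X \<Longrightarrow> counit G (\<phi> x) = counit H x"
  shows "hopf_hom H G \<phi>"
proof -
  interpret H: hopf_algebra H by fact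
  interpret G: hopf_algebra G by fact
  have span: "x \<in> alg_span (scl H) X" for x using X by simp
  have one: "comult G (\<phi> 1) = tmap (scl G) (scl G) \<phi> \<phi> (comult H 1)"
  proof (rule tensor_eqI)
    fix \<beta> assume \<beta>: "bilin (scl G) (scl G) (*) \<beta>"
    have bil: "bilin (scl H) (scl H) (*) (\<lambda>a b. \<beta> (\<phi> a) (\<phi> b))"
      by (rule bilinI) (simp_all add: algebra_homD[OF \<phi>] bilin_simps[OF \<beta>])
    show "tlift (*) \<beta> (comult G (\<phi> 1)) = tlift (*) \<beta> (tmap (scl G) (scl G) \<phi> \<phi> (comult H 1))"
      by (simp add: tlift_tmap[OF vector_space_mult \<beta>] algebra_homD[OF \<phi>] lext_field G.comult_one H.comult_one
        tlift_tcls_field[OF \<beta>] tlift_tcls_field[OF bil])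
  qed (simp_all add: tmap_def tensor_algebra_homD(1)[OF G.comult_hom])
  have \<Delta>: "comult G (\<phi> x) = tmap (scl G) (scl G) \<phi> \<phi> (comult H x)" for x
    by (rule tensor_algebra_hom_eq_on_alg_span[OF tensor_algebra_hom_comp[OF G.comult_hom \<phi>]
          tensor_algebra_hom_tmap[OF H.comult_hom G.k_alg G.k_alg \<phi> \<phi>] one comult span])
  have "algebra_hom (scl H) (*) (\<lambda>x. counit G (\<phi> x))"
    by (intro algebra_homI H.k_alg k_algebra_mult)
      (simp_all add: algebra_homD[OF \<phi>] G.counitD)
  from algebra_hom_eq_on_alg_span[OF this H.counit_hom counit span]
  have \<epsilon>: "counit G (\<phi> x) = counit H x" for x .
  show ?thesis
    using bialgebra_hom_antipode[OF H G \<phi> \<Delta> \<epsilon>] \<phi> \<Delta> \<epsilon> by (simp add: hopf_hom_def)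
qed

section \<open>Dual numbers and triangular operators\<close>

lemma dn_decomp: "a = dn_scale (dn_coord1 a) 1 + dn_scale (dn_coordx a) dn_x"
  using dn_coords_unique by blast

lemma dn_eqI: "dn_coord1 a = dn_coord1 b \<Longrightarrow> dn_coordx a = dn_coordx b \<Longrightarrow> a = b"
  using dn_decomp[of a] dn_decomp[of b] by simp

lemma dn_eq_iff: "a = b \<longleftrightarrow> dn_coord1 a = dn_coord1 b \<and> dn_coordx a = dn_coordx b"
  using dn_eqI by auto

lemma dn_coord_simps [simp]:
  "dn_coord1 0 = 0" "dn_coordx 0 = 0"
  "dn_coord1 1 = 1" "dn_coordx 1 = 0"
  "dn_coord1 dn_x = 0" "dn_coordx dn_x = 1"
  "dn_coord1 (a + b) = dn_coord1 a + dn_coord1 b" "dn_coordx (a + b) = dn_coordx a + dn_coordx b"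
  "dn_coord1 (a - b) = dn_coord1 a - dn_coord1 b" "dn_coordx (a - b) = dn_coordx a - dn_coordx b"
  "dn_coord1 (- a) = - dn_coord1 a" "dn_coordx (- a) = - dn_coordx a"
  "dn_coord1 (dn_scale r a) = r * dn_coord1 a" "dn_coordx (dn_scale r a) = r * dn_coordx a"
  "dn_coord1 (a * b) = dn_coord1 a * dn_coord1 b"
  "dn_coordx (a * b) = dn_coord1 a * dn_coordx b + dn_coordx a * dn_coord1 b"
  by (transfer; simp add: coeff_mult)+

lemma k_algebra_dn: "k_algebra dn_scale"
  by unfold_locales (simp_all add: dn_eq_iff algebra_simps)

interpretation dn: k_algebra dn_scale by (rule k_algebra_dn)

lemma dn_x_mult_self [simp]: "dn_x * dn_x = 0"
  by (simp add: dn_eq_iff)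

lemma alg_span_dn: "alg_span dn_scale {dn_x} = UNIV"
proof -
  have "a \<in> alg_span dn_scale {dn_x}" for a :: "'a dual_num"
    by (subst dn_decomp) (intro alg_span.intros, simp)
  then show ?thesis by auto
qed

text \<open>
  The operator with matrix rows \<open>(\<alpha> \<beta>)\<close> and \<open>(0 \<delta>)\<close> in the basis \<open>1, x\<close>.
\<close>

definition upper_op :: "'k::field \<Rightarrow> 'k \<Rightarrow> 'k \<Rightarrow> 'k dual_num \<Rightarrow> 'k dual_num" where
  "upper_op \<alpha> \<beta> \<delta> a =
     dn_scale (dn_coord1 a * \<alpha> + dn_coordx a * \<beta>) 1 + dn_scale (dn_coordx a * \<delta>) dn_x"

lemma upper_op_eq_iff:
  "upper_op \<alpha> \<beta> \<delta> = upper_op \<alpha>' \<beta>' \<delta>' \<longleftrightarrow> \<alpha> = \<alpha>' \<and> \<beta> = \<beta>' \<and> \<delta> = \<delta>'"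
proof
  assume *: "upper_op \<alpha> \<beta> \<delta> = upper_op \<alpha>' \<beta>' \<delta>'"
  show "\<alpha> = \<alpha>' \<and> \<beta> = \<beta>' \<and> \<delta> = \<delta>'"
    using fun_cong[OF *, of 1] fun_cong[OF *, of dn_x] by (simp add: upper_op_def dn_eq_iff)
qed simp

lemma has_matrix_iff_upper_op: "has_matrix T \<alpha> \<beta> 0 \<delta> \<longleftrightarrow> T = upper_op \<alpha> \<beta> \<delta>"
proof
  assume T: "has_matrix T \<alpha> \<beta> 0 \<delta>"
  then interpret T: Vector_Spaces.linear dn_scale dn_scale T by (simp add: has_matrix_def)
  show "T = upper_op \<alpha> \<beta> \<delta>"
  proof
    fix a
    have "T a = dn_scale (dn_coord1 a) (T 1) + dn_scale (dn_coordx a) (T dn_x)"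
      by (subst dn_decomp[of a]) (simp only: T.add T.scale)
    also have "\<dots> = upper_op \<alpha> \<beta> \<delta> a"
      using T by (simp add: has_matrix_def upper_op_def dn_eq_iff)
    finally show "T a = upper_op \<alpha> \<beta> \<delta> a" .
  qed
next
  assume "T = upper_op \<alpha> \<beta> \<delta>"
  then show "has_matrix T \<alpha> \<beta> 0 \<delta>"
    by (simp add: has_matrix_def Vector_Spaces.linear_iff dn.vector_space_axioms upper_op_def
        dn_eq_iff algebra_simps)
qed

lemma upper_op_scalar: "upper_op \<alpha> 0 \<alpha> = dn_scale \<alpha>"
  by (rule ext) (simp add: upper_op_def dn_eq_iff)

lemma upper_op_arith:
  "upper_op \<alpha> \<beta> \<delta> + upper_op \<alpha>' \<beta>' \<delta>' = upper_op (\<alpha> + \<alpha>') (\<beta> + \<beta>') (\<delta> + \<delta>')"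
  "upper_op \<alpha> \<beta> \<delta> - upper_op \<alpha>' \<beta>' \<delta>' = upper_op (\<alpha> - \<alpha>') (\<beta> - \<beta>') (\<delta> - \<delta>')"
  "op_scale dn_scale r (upper_op \<alpha> \<beta> \<delta>) = upper_op (r * \<alpha>) (r * \<beta>) (r * \<delta>)"
  "upper_op \<alpha> \<beta> \<delta> \<circ> upper_op \<alpha>' \<beta>' \<delta>' = upper_op (\<alpha> * \<alpha>') (\<alpha> * \<beta>' + \<beta> * \<delta>') (\<delta> * \<delta>')"
  "(0 :: 'k::field dual_num \<Rightarrow> 'k dual_num) = upper_op 0 0 0"
  "id = upper_op 1 0 1"
  by (rule ext; simp add: upper_op_def op_scale_def dn_eq_iff algebra_simps)+

lemma vector_space_op_scale: "vector_space (op_scale dn_scale)"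
  by unfold_locales (rule ext; simp add: op_scale_def dn_eq_iff algebra_simps)+

interpretation op: vector_space "op_scale dn_scale" by (rule vector_space_op_scale)

lemma dim_upper_ops:
  fixes \<theta> :: "'k::field"
  shows "op.dim {upper_op \<alpha> 0 (\<alpha> :: 'k) | \<alpha>. True} = 1"
    and "op.dim {upper_op \<alpha> \<beta> (\<alpha> :: 'k) | \<alpha> \<beta>. True} = 2"
    and "op.dim {upper_op \<alpha> (\<theta> * (\<alpha> + \<delta>)) \<delta> | \<alpha> \<delta>. True} = 2"
    and "op.dim {upper_op \<alpha> \<beta> (\<delta> :: 'k) | \<alpha> \<beta> \<delta>. True} = 3"
proof -
  note s = op.span_breakdown_eq upper_op_arith upper_op_eq_iff
  show "op.dim {upper_op \<alpha> 0 (\<alpha> :: 'k) | \<alpha>. True} = 1"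
    by (rule op.dim_unique[of "{upper_op 1 0 1}"]) (auto simp: s)
  let ?B = "{upper_op 0 1 0, upper_op 1 0 (1 :: 'k)}"
  have "op.independent ?B" by (intro op.independent_insertI op.independent_empty) (auto simp: s)
  moreover have "card ?B = 2" by (simp add: upper_op_eq_iff)
  ultimately show "op.dim {upper_op \<alpha> \<beta> (\<alpha> :: 'k) | \<alpha> \<beta>. True} = 2"
    by (intro op.dim_unique[of ?B]) (auto simp: s)
  let ?B = "{upper_op 1 \<theta> 0, upper_op 0 \<theta> 1}"
  have "op.independent ?B" by (intro op.independent_insertI op.independent_empty) (auto simp: s)
  moreover have "card ?B = 2" by (simp add: upper_op_eq_iff)
  ultimately show "op.dim {upper_op \<alpha> (\<theta> * (\<alpha> + \<delta>)) \<delta> | \<alpha> \<delta>. True} = 2"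
    by (intro op.dim_unique[of ?B]) (auto simp: s algebra_simps)
  let ?B = "{upper_op 1 0 0, upper_op 0 1 0, upper_op 0 0 (1 :: 'k)}"
  have "op.independent ?B" by (intro op.independent_insertI op.independent_empty) (auto simp: s)
  moreover have "card ?B = 3" by (simp add: upper_op_eq_iff)
  ultimately show "op.dim {upper_op \<alpha> \<beta> (\<delta> :: 'k) | \<alpha> \<beta> \<delta>. True} = 3"
    by (intro op.dim_unique[of ?B]) (auto simp: s)
qed

section \<open>Coactions on the dual numbers\<close>

text \<open>
  The conditions under which \<open>x \<mapsto> 1 \<otimes> h + x \<otimes> c\<close> defines a unital coaction on the dual numbers:
  \<open>1 \<otimes> h + x \<otimes> c\<close> has square zero, \<open>c\<close> is group-like and \<open>h\<close> is skew-primitive.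
\<close>

definition skew_pair :: "('k::field, 'h::ring_1) hopf \<Rightarrow> 'h \<Rightarrow> 'h \<Rightarrow> bool" where
  "skew_pair H h c \<longleftrightarrow>
     h * h = 0 \<and> h * c + c * h = 0 \<and>
     comult H c = tcls (scl H) (scl H) (fbasis (c, c)) \<and>
     comult H h = tcls (scl H) (scl H) (fbasis (h, c) + fbasis (1, h)) \<and>
     counit H c = 1 \<and> counit H h = 0"

lemma (in hopf_algebra) skew_pair_zero:
  assumes "comult H c = tcls (scl H) (scl H) (fbasis (c, c))" "counit H c = 1"
  shows "skew_pair H 0 c"
proof -
  have "comult H 0 = tcls (scl H) (scl H) (fbasis (0, c) + fbasis (1, 0))"
  proof (rule tensor_eqI[OF tensor_algebra_homD(1)[OF comult_hom]])
    fix \<beta> assume \<beta>: "bilin (scl H) (scl H) (*) \<beta>"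
    show "tlift (*) \<beta> (comult H 0) = tlift (*) \<beta> (tcls (scl H) (scl H) (fbasis (0, c) + fbasis (1, 0)))"
      using tensor_algebra_homD(3)[OF comult_hom vector_space_mult \<beta>, of 0 0]
      by (simp add: tlift_tcls_field[OF \<beta>] lext_field bilin_simps[OF \<beta>])
  qed simp
  with assms show ?thesis by (simp add: skew_pair_def counitD)
qed

abbreviation dn_coact ::
  "('k::field, 'h::ring_1) hopf \<Rightarrow> 'h \<Rightarrow> 'h \<Rightarrow> 'k dual_num \<Rightarrow> ('k dual_num \<times> 'h \<Rightarrow>\<^sub>0 'k) set" where
  "dn_coact H h c \<equiv> dn_tensor_map (scl H) (fbasis (1, h) + fbasis (dn_x, c))"

lemma tlift_dn_coact:
  assumes "vector_space sV" "bilin dn_scale sH sV \<beta>"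
  shows "tlift sV \<beta> (dn_tensor_map sH (fbasis (1, h) + fbasis (dn_x, c)) a) =
    sV (dn_coord1 a) (\<beta> 1 1) + sV (dn_coordx a) (\<beta> 1 h + \<beta> dn_x c)"
proof -
  interpret V: vector_space sV by fact
  show ?thesis
    by (simp add: dn_tensor_map_def tlift_tcls[OF assms] V.lext_add V.lext_fscale V.lext_fbasis)
qed

lemmas tlift_dn_coact_field = tlift_dn_coact[OF vector_space_mult]

lemma dn_tensor_map_graded:
  fixes sH :: "'k::field \<Rightarrow> 'h::ring_1 \<Rightarrow> 'h"
  shows "dn_tensor_map sH (fbasis (dn_x, c)) a = dn_tensor_map sH (fbasis (1, 0) + fbasis (dn_x, c)) a"
proof (rule tensor_eqI[of _ dn_scale sH])
  fix \<beta> assume \<beta>: "bilin dn_scale sH (*) \<beta>"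
  show "tlift (*) \<beta> (dn_tensor_map sH (fbasis (dn_x, c)) a) =
      tlift (*) \<beta> (dn_tensor_map sH (fbasis (1, 0) + fbasis (dn_x, c)) a)"
    unfolding tlift_dn_coact_field[OF \<beta>]
    by (simp add: dn_tensor_map_def tlift_tcls_field[OF \<beta>] lext_field bilin_simps[OF \<beta>])
qed (simp_all add: dn_tensor_map_def)

text \<open>
  The square of \<open>1 \<otimes> h + x \<otimes> c\<close> is \<open>1 \<otimes> h\<^sup>2 + x \<otimes> (hc + ch)\<close>.
\<close>

lemma tensor_algebra_hom_dn_coact:
  assumes sH: "k_algebra sH" and h: "h * h = 0" "h * c + c * h = 0"
  shows "tensor_algebra_hom dn_scale dn_scale sH
    (dn_tensor_map sH (fbasis (1, h) + fbasis (dn_x, c)))" (is "tensor_algebra_hom _ _ _ ?\<rho>")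
proof (rule tensor_algebra_homI)
  show "?\<rho> x \<in> tensor_space dn_scale sH" for x by (simp add: dn_tensor_map_def)
  fix \<beta> :: "'a dual_num \<Rightarrow> 'b \<Rightarrow> 'a" assume \<beta>: "bilin dn_scale sH (*) \<beta>"
  note t = tlift_dn_coact_field[OF \<beta>]
  show "tlift (*) \<beta> (?\<rho> (x + y)) = tlift (*) \<beta> (?\<rho> x) + tlift (*) \<beta> (?\<rho> y)" for x y
    unfolding t by (simp add: algebra_simps)
  show "tlift (*) \<beta> (?\<rho> (dn_scale r x)) = r * tlift (*) \<beta> (?\<rho> x)" for r x
    unfolding t by (simp add: algebra_simps)
  have hc: "\<beta> dn_x (h * c) + \<beta> dn_x (c * h) = 0"
    by (simp add: h(2) bilin_simps[OF \<beta>] flip: bilin_simps(2)[OF \<beta>])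
  note b = bilin_mult[OF k_algebra_dn sH \<beta>]
  show "tlift (*) \<beta> (?\<rho> (x * y)) =
    tlift (*) (\<lambda>a b. tlift (*) (\<lambda>a' b'. \<beta> (a * a') (b * b')) (?\<rho> y)) (?\<rho> x)" for x y
    unfolding t tlift_dn_coact_field[OF bilin_tlift[OF vector_space_mult b(2)]]
    unfolding tlift_dn_coact_field[OF b(1)]
    using hc by (simp add: h(1) bilin_simps[OF \<beta>] algebra_simps)
      (simp add: add.assoc flip: distrib_left)
qed

lemma unital_coaction_dn_coact:
  assumes H: "hopf_algebra H" and p: "skew_pair H h c"
  shows "unital_coaction dn_scale H (dn_coact H h c)"
proof -
  interpret H: hopf_algebra H by fact
  note p = p[unfolded skew_pair_def]
  have hom: "tensor_algebra_hom dn_scale dn_scale (scl H) (dn_coact H h c)"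
    using p by (intro tensor_algebra_hom_dn_coact H.k_alg) auto
  have "coassoc_at dn_scale (scl H) (dn_coact H h c) (comult H) a" for a
    unfolding coassoc_at_def
  proof (intro allI impI)
    fix \<gamma> assume \<gamma>: "trilin dn_scale (scl H) (scl H) (*) \<gamma>"
    note t = tlift_dn_coact_field[OF bilin_coact_left[OF hom \<gamma>]]
      tlift_dn_coact_field[OF bilin_coact_right[OF H.comult_hom \<gamma>]]
    note t' = tlift_dn_coact_field[OF trilin_bilin(3)[OF \<gamma>]]
    show "tlift (*) (\<lambda>a y. tlift (*) (\<lambda>a' y'. \<gamma> a' y' y) (dn_coact H h c a)) (dn_coact H h c a) =
      tlift (*) (\<lambda>a y. tlift (*) (\<lambda>y' y''. \<gamma> a y' y'') (comult H y)) (dn_coact H h c a)"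
      unfolding t unfolding t' using p
      by (simp add: H.comult_one tlift_tcls_field[OF trilin_bilin(1)[OF \<gamma>]] lext_field algebra_simps)
  qed
  moreover have "tlift dn_scale (\<lambda>a' h. dn_scale (counit H h) a') (dn_coact H h c a) = a" for a
  proof -
    have "bilin dn_scale (scl H) dn_scale (\<lambda>a' h. dn_scale (counit H h) a')"
      by (rule bilinI) (simp_all add: dn_eq_iff H.counitD algebra_simps)
    then show ?thesis
      using p by (simp add: tlift_dn_coact[OF dn.vector_space_axioms] H.counitD dn_eq_iff)
  qed
  moreover have "dn_coact H h c 1 = tcls dn_scale (scl H) (fbasis (1, 1))"
    by (rule tensor_eqI[of _ dn_scale "scl H"])
      (simp_all add: dn_tensor_map_def tlift_tcls_field lext_field)
  ultimately show ?thesis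
    using hom H k_algebra_dn unfolding unital_coaction_def coaction_def coassoc_iff coassoc_at_def by blast
qed

lemma bilin_coord:
  assumes "k_algebra sH"
  shows "bilin dn_scale sH sH (\<lambda>a y. sH (dn_coord1 a) y)"
    and "bilin dn_scale sH sH (\<lambda>a y. sH (dn_coordx a) y)"
proof -
  interpret H: k_algebra sH by fact
  show "bilin dn_scale sH sH (\<lambda>a y. sH (dn_coord1 a) y)" "bilin dn_scale sH sH (\<lambda>a y. sH (dn_coordx a) y)"
    by (rule bilinI; simp add: H.scale_left_distrib H.scale_right_distrib mult.commute)+
qed

lemma dn_coact_inject:
  assumes "k_algebra sH" and
    "dn_tensor_map sH (fbasis (1, h) + fbasis (dn_x, c)) = dn_tensor_map sH (fbasis (1, h') + fbasis (dn_x, c'))"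
  shows "h = h'" "c = c'"
proof -
  interpret H: k_algebra sH by fact
  note b = bilin_coord[OF assms(1), THEN tlift_dn_coact[OF H.vector_space_axioms]]
  show "h = h'" "c = c'"
    using b[of h c dn_x] b[of h' c' dn_x] by (simp_all add: assms(2))
qed

text \<open>
  The elements \<open>h\<close> and \<open>c\<close> are the coordinates of \<open>\<rho> x\<close>. The conditions on them are read off by
  comparing the coefficients of \<open>1\<close> and \<open>x\<close> in \<open>\<rho> (x\<^sup>2) = 0\<close>, in coassociativity at \<open>x\<close> and in the
  counit axiom at \<open>x\<close>.
\<close>

lemma unital_coaction_skew_pair:
  assumes H: "hopf_algebra H" and u: "unital_coaction dn_scale H \<rho>"
  obtains h c where "skew_pair H h c" "\<rho> = dn_coact H h c"
proof -
  interpret H: hopf_algebra H by fact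
  note coords = bilin_coord[OF H.k_alg]
  have hom: "tensor_algebra_hom dn_scale dn_scale (scl H) \<rho>"
    and coassoc: "coassoc_at dn_scale (scl H) \<rho> (comult H) a"
    and counit: "tlift dn_scale (\<lambda>a' h. dn_scale (counit H h) a') (\<rho> a) = a"
    and one: "\<rho> 1 = tcls dn_scale (scl H) (fbasis (1, 1))" for a
    using u unfolding unital_coaction_def coaction_def coassoc_iff coassoc_at_def by blast+
  define h where "h = tlift (scl H) (\<lambda>a y. scl H (dn_coord1 a) y) (\<rho> dn_x)"
  define c where "c = tlift (scl H) (\<lambda>a y. scl H (dn_coordx a) y) (\<rho> dn_x)"
  have \<rho>: "\<rho> a = dn_coact H h c a" for a
  proof (rule tensor_eqI)
    show "\<rho> a \<in> tensor_space dn_scale (scl H)" by (rule tensor_algebra_homD(1)[OF hom])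
    show "dn_coact H h c a \<in> tensor_space dn_scale (scl H)" by (simp add: dn_tensor_map_def)
    fix \<beta> :: "'a dual_num \<Rightarrow> 'b \<Rightarrow> 'a" assume \<beta>: "bilin dn_scale (scl H) (*) \<beta>"
    note b = bilin_simps[OF \<beta>]
    have lin: "Vector_Spaces.linear (scl H) (*) (\<beta> z)" for z
      by (simp add: linearI_field H.vs b)
    have "tlift (*) \<beta> (\<rho> dn_x) = tlift (*) (\<lambda>a y. \<beta> 1 (scl H (dn_coord1 a) y) + \<beta> dn_x (scl H (dn_coordx a) y)) (\<rho> dn_x)"
    proof -
      have "\<beta> = (\<lambda>a y. \<beta> 1 (scl H (dn_coord1 a) y) + \<beta> dn_x (scl H (dn_coordx a) y))"
        by (intro ext, subst dn_decomp) (simp only: b)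
      then show ?thesis by simp
    qed
    also have "\<dots> = \<beta> 1 h + \<beta> dn_x c"
      by (simp add: tlift_field(1) h_def c_def linear_tlift[OF lin])
    finally have x: "tlift (*) \<beta> (\<rho> dn_x) = \<beta> 1 h + \<beta> dn_x c" .
    have o: "tlift (*) \<beta> (\<rho> 1) = \<beta> 1 1"
      by (simp add: one tlift_tcls_field[OF \<beta>] lext_field)
    show "tlift (*) \<beta> (\<rho> a) = tlift (*) \<beta> (dn_coact H h c a)"
      by (subst dn_decomp[of a])
        (simp only: tensor_algebra_homD(2,3)[OF hom vector_space_mult \<beta>] x o tlift_dn_coact_field[OF \<beta>])
  qed
  have \<rho>c: "\<rho> = dn_coact H h c" using \<rho> by (rule ext)
  note tb = tlift_dn_coact[OF H.vs]
  have mult: "tlift (scl H) (\<lambda>a b. tlift (scl H) (\<lambda>a' b'. \<beta> (a * a') (b * b')) (\<rho> dn_x)) (\<rho> dn_x) = 0"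
    if "bilin dn_scale (scl H) (scl H) \<beta>" for \<beta>
  proof -
    have "tlift (scl H) \<beta> (\<rho> (dn_x * dn_x)) = 0"
      unfolding \<rho> by (simp add: tb[OF that])
    then show ?thesis by (simp only: tensor_algebra_homD(4)[OF hom H.vs that])
  qed
  have hh: "h * h = 0" and hc: "h * c + c * h = 0"
    using mult[OF coords(1)] mult[OF coords(2)]
    unfolding \<rho> tb[OF bilin_tlift[OF H.vs bilin_mult(2)[OF k_algebra_dn H.k_alg coords(1)]]]
      tb[OF bilin_tlift[OF H.vs bilin_mult(2)[OF k_algebra_dn H.k_alg coords(2)]]]
    unfolding tb[OF bilin_mult(1)[OF k_algebra_dn H.k_alg coords(1)]]
      tb[OF bilin_mult(1)[OF k_algebra_dn H.k_alg coords(2)]]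
    by simp_all
  have co: "tlift (*) \<beta> (comult H h) = \<beta> h c + \<beta> 1 h" "tlift (*) \<beta> (comult H c) = \<beta> c c"
    if \<beta>: "bilin (scl H) (scl H) (*) \<beta>" for \<beta>
  proof -
    have eq: "tlift (*) (\<lambda>a h. tlift (*) (\<lambda>a' h'. \<gamma> a' h' h) (\<rho> a)) (\<rho> dn_x) =
      tlift (*) (\<lambda>a h. tlift (*) (\<lambda>h' h''. \<gamma> a h' h'') (comult H h)) (\<rho> dn_x)"
      if "trilin dn_scale (scl H) (scl H) (*) \<gamma>" for \<gamma>
      using coassoc[of dn_x] that unfolding coassoc_at_def by blast
    have \<gamma>: "trilin dn_scale (scl H) (scl H) (*) (\<lambda>a y z. dn_coord1 a * \<beta> y z)"
        "trilin dn_scale (scl H) (scl H) (*) (\<lambda>a y z. dn_coordx a * \<beta> y z)"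
      by (simp_all add: trilin_def bilin_def bilin_simps[OF \<beta>] algebra_simps)
    note hom' = hom[unfolded \<rho>c]
    have t: "tlift (*) (\<lambda>a h. tlift (*) (\<lambda>a' h'. \<gamma> a' h' h) (\<rho> a)) (\<rho> dn_x) = \<gamma> 1 1 h + \<gamma> 1 h c + \<gamma> dn_x c c"
      "tlift (*) (\<lambda>a h. tlift (*) (\<lambda>h' h''. \<gamma> a h' h'') (comult H h)) (\<rho> dn_x) =
        tlift (*) (\<gamma> 1) (comult H h) + tlift (*) (\<gamma> dn_x) (comult H c)"
      if "trilin dn_scale (scl H) (scl H) (*) \<gamma>" for \<gamma>
      unfolding \<rho> tlift_dn_coact_field[OF bilin_coact_left[OF hom' that]]
        tlift_dn_coact_field[OF bilin_coact_right[OF H.comult_hom that]]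
      unfolding tlift_dn_coact_field[OF trilin_bilin(3)[OF that]]
      by simp_all
    show "tlift (*) \<beta> (comult H h) = \<beta> h c + \<beta> 1 h" "tlift (*) \<beta> (comult H c) = \<beta> c c"
      using eq[OF \<gamma>(1)] eq[OF \<gamma>(2)] unfolding t[OF \<gamma>(1)] t[OF \<gamma>(2)]
      by (simp_all add: tlift_field add.commute)
  qed
  have "comult H c = tcls (scl H) (scl H) (fbasis (c, c))"
    by (rule tensor_eqI[OF tensor_algebra_homD(1)[OF H.comult_hom]])
      (simp_all add: co tlift_tcls_field lext_field)
  moreover have "comult H h = tcls (scl H) (scl H) (fbasis (h, c) + fbasis (1, h))"
    by (rule tensor_eqI[OF tensor_algebra_homD(1)[OF H.comult_hom]])
      (simp_all add: co tlift_tcls_field lext_field)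
  moreover have "counit H h = 0 \<and> counit H c = 1"
  proof -
    have "bilin dn_scale (scl H) dn_scale (\<lambda>a' h. dn_scale (counit H h) a')"
      by (rule bilinI) (simp_all add: dn_eq_iff H.counitD algebra_simps)
    from tlift_dn_coact[OF dn.vector_space_axioms this, of h c dn_x] show ?thesis
      using counit[of dn_x] unfolding \<rho> by (simp add: dn_eq_iff)
  qed
  ultimately have "skew_pair H h c" using hh hc by (simp add: skew_pair_def)
  then show ?thesis using \<rho>c by (rule that)
qed

section \<open>Cosupports of coactions on the dual numbers\<close>

text \<open>
  A functional on \<open>H\<close> enters the operator only through its values at \<open>1\<close>, \<open>h\<close> and \<open>c\<close>. Hence the
  cosupport is determined by the linear relations between these three elements.
\<close>

lemma cosupp_dn_coact:
  "cosupp dn_scale H (dn_coact H h c) =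
    {upper_op (l 1) (l h) (l c) | l. Vector_Spaces.linear (scl H) (*) l}"
proof -
  have "coact_dual dn_scale (dn_coact H h c) l = upper_op (l 1) (l h) (l c)"
    if l: "Vector_Spaces.linear (scl H) (*) l" for l
  proof
    fix a
    interpret l: Vector_Spaces.linear "scl H" "(*)" l by fact
    have "bilin dn_scale (scl H) dn_scale (\<lambda>a' y. dn_scale (l y) a')"
      by (rule bilinI) (simp_all add: dn_eq_iff l.add l.scale algebra_simps)
    then show "coact_dual dn_scale (dn_coact H h c) l a = upper_op (l 1) (l h) (l c) a"
      by (simp add: coact_dual_def tlift_dn_coact[OF dn.vector_space_axioms] upper_op_def dn_eq_iff)
  qed
  then show ?thesis
    unfolding cosupp_def by (intro Collect_cong ex_cong1) metis
qed

lemma functional_extend: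
  assumes "vector_space s" "\<not> module.dependent s B"
  obtains l where "Vector_Spaces.linear s (*) l" "\<And>b. b \<in> B \<Longrightarrow> l b = f b"
proof -
  interpret V: vector_space s by fact
  interpret K: vector_space "(*) :: 'a \<Rightarrow> 'a \<Rightarrow> 'a" by (rule vector_space_mult)
  interpret VK: vector_space_pair s "(*)" ..
  show ?thesis
    using VK.linear_independent_extend[OF assms(2), of f] that by blast
qed

lemma char_2_iff: "(2 :: 'k::field) = 0 \<longleftrightarrow> CHAR('k) = 2"
proof -
  have "(2 :: 'k) = 0 \<longleftrightarrow> CHAR('k) dvd 2"
    using of_nat_eq_0_iff_char_dvd[of 2, where ?'a = 'k] by simp
  also have "\<dots> \<longleftrightarrow> CHAR('k) = 2"
  proof
    assume d: "CHAR('k) dvd 2"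
    then have "CHAR('k) \<le> 2" "CHAR('k) \<noteq> 0" by (auto dest: dvd_imp_le intro!: Nat.gr0I)
    moreover have "CHAR('k) \<noteq> 1" by simp
    ultimately show "CHAR('k) = 2" by linarith
  qed simp
  finally show ?thesis .
qed

text \<open>
  The counit maps \<open>h\<close> to \<open>0\<close> and \<open>c\<close> to \<open>1\<close>, so \<open>c\<close> is not a multiple of \<open>1\<close> unless \<open>c = 1\<close>, \<open>h\<close> is
  not a multiple of \<open>1\<close> unless \<open>h = 0\<close>, and every expression of \<open>h\<close> in \<open>1\<close> and \<open>c\<close> is a multiple of
  \<open>1 - c\<close>. Functionals can be prescribed on the elements that remain independent.
\<close>

lemma cosupp_dn_coact_shape:
  assumes H: "hopf_algebra H" and p: "skew_pair H h c"
  defines "V \<equiv> cosupp dn_scale H (dn_coact H h c)"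
  shows "h = 0 \<Longrightarrow> c = 1 \<Longrightarrow> V = {upper_op \<alpha> 0 \<alpha> | \<alpha>. True}"
    and "h \<noteq> 0 \<Longrightarrow> c = 1 \<Longrightarrow> V = {upper_op \<alpha> \<beta> \<alpha> | \<alpha> \<beta>. True}"
    and "h = scl H \<theta> (1 + c) \<Longrightarrow> c \<noteq> 1 \<Longrightarrow> V = {upper_op \<alpha> (\<theta> * (\<alpha> + \<delta>)) \<delta> | \<alpha> \<delta>. True}"
    and "h = 0 \<Longrightarrow> c \<noteq> 1 \<Longrightarrow> V = {upper_op \<alpha> 0 \<delta> | \<alpha> \<delta>. True}"
    and "c \<noteq> 1 \<Longrightarrow> (\<And>\<theta>. h \<noteq> scl H \<theta> (1 - c)) \<Longrightarrow> V = {upper_op \<alpha> \<beta> \<delta> | \<alpha> \<beta> \<delta>. True}"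
proof -
  interpret H: hopf_algebra H by fact
  have V: "V = {upper_op (l 1) (l h) (l c) | l. Vector_Spaces.linear (scl H) (*) l}"
    unfolding V_def by (rule cosupp_dn_coact)
  note lin = Vector_Spaces.linear_iff
  have lin0: "l 0 = 0" if "Vector_Spaces.linear (scl H) (*) l" for l
  proof -
    interpret l: Vector_Spaces.linear "scl H" "(*)" l by fact
    show ?thesis by simp
  qed
  have \<epsilon>: "counit H h = 0" "counit H c = 1" using p by (simp_all add: skew_pair_def)
  have c1: "c \<notin> H.span {1}" if "c \<noteq> 1"
  proof
    assume "c \<in> H.span {1}"
    then obtain k where k: "c = scl H k 1" by (auto simp: H.span_breakdown_eq)
    with \<epsilon> have "k = 1" by (simp add: H.counitD)
    with k that show False by simp
  qed
  have h1: "h \<notin> H.span {1}" if "h \<noteq> 0"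
  proof
    assume "h \<in> H.span {1}"
    then obtain k where k: "h = scl H k 1" by (auto simp: H.span_breakdown_eq)
    with \<epsilon> have "k = 0" by (simp add: H.counitD)
    with k that show False by simp
  qed
  have hc1: "h \<notin> H.span {c, 1}" if h: "\<And>\<theta>. h \<noteq> scl H \<theta> (1 - c)"
  proof
    assume "h \<in> H.span {c, 1}"
    then obtain k k' where k: "h = scl H k c + scl H k' 1" by (auto simp: H.span_breakdown_eq algebra_simps)
    with \<epsilon> have "k = - k'" by (simp add: H.counitD eq_neg_iff_add_eq_0)
    with k h[of k'] show False by (simp add: H.scale_right_diff_distrib)
  qed
  have i: "H.independent {1}" by simp
  show "V = {upper_op \<alpha> 0 \<alpha> | \<alpha>. True}" if "h = 0" "c = 1"
  proof -
    have "\<exists>l. Vector_Spaces.linear (scl H) (*) l \<and> l 1 = \<alpha>" for \<alpha>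
      by (rule functional_extend[OF H.vs i, of "\<lambda>_. \<alpha>"]) auto
    then show ?thesis unfolding V that by (auto simp: upper_op_eq_iff lin0) (metis lin0)
  qed
  show "V = {upper_op \<alpha> \<beta> \<alpha> | \<alpha> \<beta>. True}" if "h \<noteq> 0" "c = 1"
  proof -
    have i: "H.independent {h, 1}" using h1 i that by (intro H.independent_insertI H.independent_empty) auto
    have n: "h \<noteq> 1" using \<epsilon> by (auto simp: H.counitD)
    have "\<exists>l. Vector_Spaces.linear (scl H) (*) l \<and> l 1 = \<alpha> \<and> l h = \<beta>" for \<alpha> \<beta>
      by (rule functional_extend[OF H.vs i, of "\<lambda>x. if x = 1 then \<alpha> else \<beta>"]) (use n in auto)
    then show ?thesis unfolding V that(2) by (auto simp: upper_op_eq_iff) metis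
  qed
  have lc: "\<exists>l. Vector_Spaces.linear (scl H) (*) l \<and> l 1 = \<alpha> \<and> l c = \<delta>" if "c \<noteq> 1" for \<alpha> \<delta>
  proof -
    have i: "H.independent {c, 1}" using c1 i that by (intro H.independent_insertI H.independent_empty) auto
    show ?thesis
      by (rule functional_extend[OF H.vs i, of "\<lambda>x. if x = 1 then \<alpha> else \<delta>"]) (use that in auto)
  qed
  show "V = {upper_op \<alpha> (\<theta> * (\<alpha> + \<delta>)) \<delta> | \<alpha> \<delta>. True}" if "h = scl H \<theta> (1 + c)" "c \<noteq> 1"
  proof -
    have "l (scl H \<theta> (1 + c)) = \<theta> * (l 1 + l c)" if "Vector_Spaces.linear (scl H) (*) l" for l
      using that by (simp add: lin)
    then show ?thesis
      using lc[OF that(2)] unfolding V that(1) by (auto simp: upper_op_eq_iff) metis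
  qed
  show "V = {upper_op \<alpha> 0 \<delta> | \<alpha> \<delta>. True}" if "h = 0" "c \<noteq> 1"
    using lc[OF that(2)] unfolding V that(1) by (auto simp: upper_op_eq_iff lin0) (metis lin0)
  show "V = {upper_op \<alpha> \<beta> \<delta> | \<alpha> \<beta> \<delta>. True}" if c: "c \<noteq> 1" and h: "\<And>\<theta>. h \<noteq> scl H \<theta> (1 - c)"
  proof -
    have "H.independent {h, c, 1}" using hc1[OF h] c1 i c by (intro H.independent_insertI H.independent_empty) auto
    moreover have n: "h \<noteq> 1" "h \<noteq> c" using \<epsilon> by (auto simp: H.counitD)
    ultimately have "\<exists>l. Vector_Spaces.linear (scl H) (*) l \<and> l 1 = \<alpha> \<and> l h = \<beta> \<and> l c = \<delta>" for \<alpha> \<beta> \<delta>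
      by (rule_tac functional_extend[OF H.vs, of "{h, c, 1}" "\<lambda>x. if x = 1 then \<alpha> else if x = h then \<beta> else \<delta>"])
        (use c n in auto)
    then show ?thesis unfolding V by (auto simp: upper_op_eq_iff) metis
  qed
qed

text \<open>
  For \<open>c = 1\<close> the relation \<open>hc + ch = 0\<close> says \<open>2h = 0\<close>.
\<close>

lemma skew_pair_trivial_grouplike:
  assumes H: "hopf_algebra (H :: ('k::field, 'h::ring_1) hopf)" and p: "skew_pair H h 1" and "h \<noteq> 0"
  shows "CHAR('k) = 2"
proof -
  interpret H: hopf_algebra H by fact
  have "scl H (1 + 1) h = 0" using p by (simp only: H.scale_left_distrib) (simp add: skew_pair_def)
  then show ?thesis using \<open>h \<noteq> 0\<close> by (simp add: char_2_iff)
qed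

text \<open>
  Up to the factors \<open>\<theta>\<close> and \<open>\<theta>\<^sup>2\<close>, the relation \<open>hc + ch = 0\<close> is \<open>2(c - c\<^sup>2) = 0\<close> and \<open>h\<^sup>2 = 0\<close> is
  \<open>(1 - c)\<^sup>2 = 0\<close>. If \<open>2\<close> were invertible, then \<open>c\<^sup>2 = c\<close>, hence \<open>1 - c = (1 - c)\<^sup>2 = 0\<close>.
\<close>

lemma skew_pair_dependent:
  assumes H: "hopf_algebra (H :: ('k::field, 'h::ring_1) hopf)" and p: "skew_pair H (scl H \<theta> (1 - c)) c"
    and "\<theta> \<noteq> 0" "c \<noteq> 1"
  shows "CHAR('k) = 2" and "1 - c = 1 + c"
proof -
  interpret H: hopf_algebra H by fact
  have "scl H (\<theta> * \<theta>) ((1 - c) * (1 - c)) = 0"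
    using p by (simp add: skew_pair_def H.scale_mult_left H.scale_mult_right)
  then have 1: "(1 - c) * (1 - c) = 0" using \<open>\<theta> \<noteq> 0\<close> by simp
  have "scl H \<theta> (c * (1 - c) + (1 - c) * c) = 0"
    using p by (simp add: skew_pair_def H.scale_mult_left H.scale_mult_right add.commute H.scale_right_distrib)
  then have "c * (1 - c) + (1 - c) * c = 0" using \<open>\<theta> \<noteq> 0\<close> by (simp only: H.scale_eq_0_iff) simp
  then have "(c - c * c) + (c - c * c) = 0" by (simp add: algebra_simps)
  then have 2: "scl H (1 + 1) (c - c * c) = 0" by (simp only: H.scale_left_distrib) simp
  have "c - c * c \<noteq> 0"
    using 1 \<open>c \<noteq> 1\<close> by (auto simp: algebra_simps)
  with 2 have z: "(1 + 1 :: 'k) = 0" by (simp only: H.scale_eq_0_iff) simp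
  then show "CHAR('k) = 2" by (simp add: char_2_iff)
  have "c + c = scl H (1 + 1) c" by (simp only: H.scale_left_distrib) simp
  then show "1 - c = 1 + c" using z by (simp add: algebra_simps eq_neg_iff_add_eq_0)
qed

lemma equivalent_via_id_iff:
  "equivalent_via id dn_scale H \<rho> dn_scale G \<sigma> \<longleftrightarrow> cosupp dn_scale H \<rho> = cosupp dn_scale G \<sigma>"
  by (simp add: equivalent_via_def algebra_iso_def algebra_homI k_algebra_dn)

text \<open>
  The identity operator comes from the counit, and the composition of two operators comes from
  the convolution of the corresponding functionals.
\<close>

lemma unital_subalgebra_cosupp_dn_coact:
  assumes H: "hopf_algebra H" and p: "skew_pair H h c"
  shows "unital_subalgebra_End dn_scale (cosupp dn_scale H (dn_coact H h c))"
proof -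
  interpret H: hopf_algebra H by fact
  note p = p[unfolded skew_pair_def]
  note lin = Vector_Spaces.linear_iff
  note V = cosupp_dn_coact[of H h c]
  have V': "upper_op (l 1) (l h) (l c) \<in> cosupp dn_scale H (dn_coact H h c)"
    if "Vector_Spaces.linear (scl H) (*) l" for l using that V by blast
  have "Vector_Spaces.linear dn_scale dn_scale (upper_op \<alpha> \<beta> \<delta>)" for \<alpha> \<beta> \<delta> :: 'a
    using has_matrix_iff_upper_op[of "upper_op \<alpha> \<beta> \<delta>" \<alpha> \<beta> \<delta>] by (simp add: has_matrix_def)
  then have "\<forall>T\<in>cosupp dn_scale H (dn_coact H h c). Vector_Spaces.linear dn_scale dn_scale T"
    unfolding V by blast
  moreover have "op.subspace (cosupp dn_scale H (dn_coact H h c))"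
  proof (rule op.subspaceI)
    show "0 \<in> cosupp dn_scale H (dn_coact H h c)"
      using V'[of "\<lambda>_. 0"] by (simp add: upper_op_arith linearI_field H.vs)
  next
    fix T U assume T: "T \<in> cosupp dn_scale H (dn_coact H h c)" and U: "U \<in> cosupp dn_scale H (dn_coact H h c)"
    from T U V obtain l m where l: "Vector_Spaces.linear (scl H) (*) l" "T = upper_op (l 1) (l h) (l c)"
      and m: "Vector_Spaces.linear (scl H) (*) m" "U = upper_op (m 1) (m h) (m c)" by blast
    have "Vector_Spaces.linear (scl H) (*) (\<lambda>y. l y + m y)"
      using l(1) m(1) by (auto simp: lin algebra_simps)
    from V'[OF this] show "T + U \<in> cosupp dn_scale H (dn_coact H h c)" by (simp add: l m upper_op_arith)
  next
    fix r T assume T: "T \<in> cosupp dn_scale H (dn_coact H h c)"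
    from T V obtain l where l: "Vector_Spaces.linear (scl H) (*) l" "T = upper_op (l 1) (l h) (l c)" by blast
    have "Vector_Spaces.linear (scl H) (*) (\<lambda>y. r * l y)"
      using l(1) by (auto simp: lin algebra_simps)
    from V'[OF this] show "op_scale dn_scale r T \<in> cosupp dn_scale H (dn_coact H h c)"
      by (simp add: l upper_op_arith)
  qed
  moreover have "id \<in> cosupp dn_scale H (dn_coact H h c)"
    using V'[of "counit H"] H.counit_hom p by (simp add: upper_op_arith(6) H.counitD algebra_hom_def)
  moreover have "T \<circ> U \<in> cosupp dn_scale H (dn_coact H h c)"
    if T: "T \<in> cosupp dn_scale H (dn_coact H h c)" and U: "U \<in> cosupp dn_scale H (dn_coact H h c)" for T U
  proof -
    from T U V obtain l m where l: "Vector_Spaces.linear (scl H) (*) l" "T = upper_op (l 1) (l h) (l c)"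
      and m: "Vector_Spaces.linear (scl H) (*) m" "U = upper_op (m 1) (m h) (m c)" by blast
    have b: "bilin (scl H) (scl H) (*) (\<lambda>x y. l x * m y)"
      using l(1) m(1) by (intro bilinI) (auto simp: lin algebra_simps)
    \<comment> \<open>the convolution product of \<open>l\<close> and \<open>m\<close>\<close>
    define n where "n y = tlift (*) (\<lambda>x y. l x * m y) (comult H y)" for y
    have "Vector_Spaces.linear (scl H) (*) n"
      unfolding n_def by (intro linearI_field H.vs) (simp_all add: tensor_algebra_homD(2,3)[OF H.comult_hom vector_space_mult b])
    moreover have "n 1 = l 1 * m 1" "n h = l h * m c + l 1 * m h" "n c = l c * m c"
      using p by (simp_all add: n_def H.comult_one tlift_tcls_field[OF b] lext_field)
    ultimately show ?thesis using V'[of n] by (simp add: l m upper_op_arith add.commute)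
  qed
  ultimately show ?thesis unfolding unital_subalgebra_End_def by blast
qed

section \<open>Universality\<close>

lemma tmap_dn_coact:
  assumes \<phi>: "algebra_hom (scl H) (scl G) \<phi>"
  shows "tmap dn_scale (scl G) id \<phi> (dn_coact H h c a) = dn_coact G (\<phi> h) (\<phi> c) a"
proof (rule tensor_eqI[of _ dn_scale "scl G"])
  fix \<beta> assume \<beta>: "bilin dn_scale (scl G) (*) \<beta>"
  have "bilin dn_scale (scl H) (*) (\<lambda>a b. \<beta> (id a) (\<phi> b))"
    by (rule bilinI) (simp_all add: algebra_homD[OF \<phi>] bilin_simps[OF \<beta>])
  then show "tlift (*) \<beta> (tmap dn_scale (scl G) id \<phi> (dn_coact H h c a)) =
      tlift (*) \<beta> (dn_coact G (\<phi> h) (\<phi> c) a)"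
    by (simp add: tlift_tmap[OF vector_space_mult \<beta>] tlift_dn_coact_field \<beta> algebra_homD[OF \<phi>])
qed (simp_all add: tmap_def dn_tensor_map_def)

text \<open>
  Universality reduces to the existence of an algebra homomorphism that matches the pairs: it is
  then a Hopf algebra homomorphism because the generators of \<open>H0\<close> and their images are group-like
  or skew-primitive, and it is unique because a Hopf algebra homomorphism also determines the image
  of \<open>antipode H0 c0\<close>.
\<close>

lemma V_universal_dn_coact:
  fixes H0 :: "('k::field, 'g::ring_1) hopf"
  assumes H0: "hopf_algebra H0" and p0: "skew_pair H0 h0 c0"
    and gen: "alg_span (scl H0) {c0, antipode H0 c0, h0} = UNIV"
    and ex: "\<And>(H :: ('k, 'h::ring_1) hopf) h c. hopf_algebra H \<Longrightarrow> skew_pair H h c \<Longrightarrow>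
      (\<And>l. Vector_Spaces.linear (scl H) (*) l \<Longrightarrow>
        upper_op (l 1) (l h) (l c) \<in> cosupp dn_scale H0 (dn_coact H0 h0 c0)) \<Longrightarrow>
      \<exists>\<phi>. algebra_hom (scl H0) (scl H) \<phi> \<and> \<phi> h0 = h \<and> \<phi> c0 = c"
  shows "V_universal TYPE('h) dn_scale (cosupp dn_scale H0 (dn_coact H0 h0 c0)) H0 (dn_coact H0 h0 c0)"
  unfolding V_universal_def
proof (intro conjI allI impI)
  show "unital_subalgebra_End dn_scale (cosupp dn_scale H0 (dn_coact H0 h0 c0))"
    by (rule unital_subalgebra_cosupp_dn_coact[OF H0 p0])
  show "unital_coaction dn_scale H0 (dn_coact H0 h0 c0)"
    by (rule unital_coaction_dn_coact[OF H0 p0])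
  interpret H0: hopf_algebra H0 by fact
  fix H :: "('k, 'h) hopf" and \<rho>
  assume *: "hopf_algebra H \<and> unital_coaction dn_scale H \<rho> \<and>
      cosupp dn_scale H \<rho> \<subseteq> cosupp dn_scale H0 (dn_coact H0 h0 c0)"
  then have H: "hopf_algebra H" by blast
  interpret H: hopf_algebra H by fact
  obtain h c where p: "skew_pair H h c" and \<rho>: "\<rho> = dn_coact H h c"
    using unital_coaction_skew_pair[OF H] * by blast
  have "upper_op (l 1) (l h) (l c) \<in> cosupp dn_scale H0 (dn_coact H0 h0 c0)"
    if "Vector_Spaces.linear (scl H) (*) l" for l
    using * that unfolding \<rho> cosupp_dn_coact[of H] by blast
  from ex[OF H p this] obtain \<phi> where \<phi>: "algebra_hom (scl H0) (scl H) \<phi>" "\<phi> h0 = h" "\<phi> c0 = c" by blast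
  note p' = p[unfolded skew_pair_def] and p0' = p0[unfolded skew_pair_def]
  have d0: "antipode H0 c0 * c0 = 1" "c0 * antipode H0 c0 = 1"
    using p0' H0.grouplike_antipode by auto
  have d: "\<phi> (antipode H0 c0) * c = 1" "c * \<phi> (antipode H0 c0) = 1"
    using algebra_homD(1,4)[OF \<phi>(1)] d0 \<phi>(3) by metis+
  have hom: "hopf_hom H0 H \<phi>"
  proof (rule hopf_homI[OF H0 H \<phi>(1) gen])
    fix x assume x: "x \<in> {c0, antipode H0 c0, h0}"
    show "counit H (\<phi> x) = counit H0 x"
      using x p' p0' H0.counit_inverse[OF _ d0(1)] H.counit_inverse[OF _ d(1)] \<phi> by auto
    have cs: "comult H0 (antipode H0 c0) = tcls (scl H0) (scl H0) (fbasis (antipode H0 c0, antipode H0 c0))"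
      using p0' by (intro H0.comult_grouplike_inverse[OF _ d0]) auto
    have cs': "comult H (\<phi> (antipode H0 c0)) = tcls (scl H) (scl H) (fbasis (\<phi> (antipode H0 c0), \<phi> (antipode H0 c0)))"
      using p' by (intro H.comult_grouplike_inverse[OF _ d]) auto
    have cm: "comult H0 c0 = tcls (scl H0) (scl H0) (fbasis (c0, c0))"
        "comult H0 h0 = tcls (scl H0) (scl H0) (fbasis (h0, c0) + fbasis (1, h0))"
        "comult H c = tcls (scl H) (scl H) (fbasis (c, c))"
        "comult H h = tcls (scl H) (scl H) (fbasis (h, c) + fbasis (1, h))"
      using p' p0' by blast+
    show "comult H (\<phi> x) = tmap (scl H) (scl H) \<phi> \<phi> (comult H0 x)"
    proof (rule tensor_eqI)
      fix \<beta> assume \<beta>: "bilin (scl H) (scl H) (*) \<beta>"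
      have b: "bilin (scl H0) (scl H0) (*) (\<lambda>a b. \<beta> (\<phi> a) (\<phi> b))"
        by (rule bilinI) (simp_all add: algebra_homD[OF \<phi>(1)] bilin_simps[OF \<beta>])
      note t = tlift_tmap[OF vector_space_mult \<beta>] tlift_tcls_field[OF b]
        tlift_tcls_field[OF \<beta>]
      show "tlift (*) \<beta> (comult H (\<phi> x)) = tlift (*) \<beta> (tmap (scl H) (scl H) \<phi> \<phi> (comult H0 x))"
        using x by (elim insertE emptyE)
          (simp_all add: t cs cs' cm \<phi>(2,3) lext_field algebra_homD[OF \<phi>(1)])
    qed (simp_all add: tensor_algebra_homD(1)[OF H.comult_hom] tmap_def)
  qed
  have eq: "\<rho> a = tmap dn_scale (scl H) id \<phi> (dn_coact H0 h0 c0 a)" for a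
    by (simp add: tmap_dn_coact[OF \<phi>(1)] \<rho> \<phi>)
  have uniq: "\<psi> = \<phi>" if \<psi>: "hopf_hom H0 H \<psi>" "\<forall>a. \<rho> a = tmap dn_scale (scl H) id \<psi> (dn_coact H0 h0 c0 a)" for \<psi>
  proof
    fix x
    have \<psi>h: "algebra_hom (scl H0) (scl H) \<psi>" using \<psi>(1) by (simp add: hopf_hom_def)
    have "dn_coact H h c = dn_coact H (\<psi> h0) (\<psi> c0)"
      using \<psi>(2) by (intro ext) (simp add: tmap_dn_coact[OF \<psi>h] \<rho>)
    from dn_coact_inject[OF H.k_alg this] have hc: "\<psi> h0 = \<phi> h0" "\<psi> c0 = \<phi> c0" by (simp_all add: \<phi>)
    moreover have "\<psi> (antipode H0 c0) = \<phi> (antipode H0 c0)"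
      using \<psi>(1) hom hc unfolding hopf_hom_def by metis
    ultimately have "\<psi> y = \<phi> y" if "y \<in> {c0, antipode H0 c0, h0}" for y using that by auto
    from algebra_hom_eq_on_alg_span[OF \<psi>h \<phi>(1) this] show "\<psi> x = \<phi> x" using gen by blast
  qed
  show "\<exists>!\<phi>. hopf_hom H0 H \<phi> \<and> (\<forall>a. \<rho> a = tmap dn_scale (scl H) id \<phi> (dn_coact H0 h0 c0 a))"
    using hom eq uniq by (intro ex1I[of _ \<phi>]) simp_all
qed (use H0 in auto)

section \<open>The base field and the dual numbers in characteristic two\<close>

lemma tlift_base_comult:
  assumes "bilin (*) (*) (*) \<beta>"
  shows "tlift (*) \<beta> (comult base_hopf r) = \<beta> r 1"
  by (simp add: base_hopf_def tlift_tcls_field[OF assms] lext_field)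

lemma hopf_algebra_base: "hopf_algebra (base_hopf :: ('k::field, 'k) hopf)"
proof (rule hopf_algebra_pointedI[where G = "{}" and P = "{}"])
  let ?H = "base_hopf :: ('k, 'k) hopf"
  have [simp]: "scl ?H = (*)" "counit ?H = (\<lambda>r. r)" "antipode ?H = (\<lambda>r. r)"
    by (simp_all add: base_hopf_def)
  show "k_algebra (scl ?H)" by (simp add: k_algebra_mult)
  show "tensor_algebra_hom (scl ?H) (scl ?H) (scl ?H) (comult ?H)"
  proof (rule tensor_algebra_homI)
    fix \<beta> assume "bilin (scl ?H) (scl ?H) (*) \<beta>"
    then have \<beta>: "bilin (*) (*) (*) \<beta>" by simp
    note t = tlift_base_comult[OF \<beta>] and b = bilin_mult[OF k_algebra_mult k_algebra_mult \<beta>]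
    show "tlift (*) \<beta> (comult ?H (x + y)) = tlift (*) \<beta> (comult ?H x) + tlift (*) \<beta> (comult ?H y)" for x y
      by (simp add: t bilin_simps[OF \<beta>])
    show "tlift (*) \<beta> (comult ?H (scl ?H r x)) = r * tlift (*) \<beta> (comult ?H x)" for r x
      by (simp add: t bilin_simps[OF \<beta>])
    show "tlift (*) \<beta> (comult ?H (x * y)) =
        tlift (*) (\<lambda>a b. tlift (*) (\<lambda>a' b'. \<beta> (a * a') (b * b')) (comult ?H y)) (comult ?H x)" for x y
      unfolding t tlift_base_comult[OF bilin_tlift[OF vector_space_mult b(2)]]
      unfolding tlift_base_comult[OF b(1)] by simp
  qed (simp add: base_hopf_def)
  show "comult ?H 1 = tcls (scl ?H) (scl ?H) (fbasis (1, 1))"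
    by (simp add: base_hopf_def)
  show "algebra_hom (scl ?H) (*) (counit ?H)"
    by (simp add: algebra_homI k_algebra_mult)
  show "Vector_Spaces.linear (scl ?H) (scl ?H) (antipode ?H)"
    by (simp add: Vector_Spaces.linear_iff vector_space_mult)
  have "r \<in> alg_span (*) {}" for r :: 'k
    using alg_span.scale[OF alg_span.one, of "(*)" r "{}"] by simp
  then show "alg_span (scl ?H) ({} \<union> {}) = UNIV" by auto
qed (simp_all add: base_hopf_def)

lemma rho1_eq: "rho1 = dn_coact base_hopf 0 1"
proof
  fix a :: "'a dual_num"
  show "rho1 a = dn_coact base_hopf 0 1 a"
  proof (rule tensor_eqI[of _ dn_scale "(*)"])
    fix \<beta> :: "'a dual_num \<Rightarrow> 'a \<Rightarrow> 'a" assume \<beta>: "bilin dn_scale (*) (*) \<beta>"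
    show "tlift (*) \<beta> (rho1 a) = tlift (*) \<beta> (dn_coact base_hopf 0 1 a)"
      by (subst dn_decomp[of a], simp only: rho1_def tlift_tcls_field[OF \<beta>])
        (simp add: base_hopf_def tlift_dn_coact_field[OF \<beta>] lext_field bilin_simps[OF \<beta>])
  qed (simp_all add: rho1_def dn_tensor_map_def base_hopf_def)
qed

lemma skew_pair_base: "skew_pair base_hopf 0 1"
  by (rule hopf_algebra.skew_pair_zero[OF hopf_algebra_base]) (simp_all add: base_hopf_def)

context
  assumes char2: "CHAR('k::field) = 2"
begin

lemma double_eq_0: "x + x = (0 :: 'k)"
proof -
  have "(2 :: 'k) = 0" using char2 by (simp add: char_2_iff)
  then have "2 * x = 0" by simp
  then show ?thesis by (simp only: mult_2)
qed

lemma dn_double: "a + a = (0 :: 'k dual_num)"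
  by (simp only: dn_eq_iff dn_coord_simps double_eq_0)

lemma comult_dual_num: "comult dual_num_hopf = dn_coact dual_num_hopf (dn_x :: 'k dual_num) 1"
  by (simp add: dual_num_hopf_def add.commute)

lemma dual_num_hopf_simps:
  "scl dual_num_hopf = dn_scale" "counit dual_num_hopf = dn_coord1" "antipode dual_num_hopf = (\<lambda>a. a)"
  by (simp_all add: dual_num_hopf_def flip: dn_decomp)

lemma comult_dn_x:
  "comult dual_num_hopf (dn_x :: 'k dual_num) = tcls dn_scale dn_scale (fbasis (dn_x, 1) + fbasis (1, dn_x))"
  by (rule tensor_eqI[of _ dn_scale dn_scale])
    (simp_all add: dual_num_hopf_def dn_tensor_map_def tlift_tcls_field lext_field)

lemma hopf_algebra_dual_num: "hopf_algebra (dual_num_hopf :: ('k, 'k dual_num) hopf)"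
proof (rule hopf_algebra_pointedI[where G = "{}" and P = "{dn_x}"])
  let ?H = "dual_num_hopf :: ('k, 'k dual_num) hopf"
  note [simp] = dual_num_hopf_simps
  note xx = dn_double[of dn_x]
  show "k_algebra (scl ?H)" by (simp add: k_algebra_dn)
  show hom: "tensor_algebra_hom (scl ?H) (scl ?H) (scl ?H) (comult ?H)"
    by (simp add: comult_dual_num tensor_algebra_hom_dn_coact k_algebra_dn xx)
  show one: "comult ?H 1 = tcls (scl ?H) (scl ?H) (fbasis (1, 1))"
    by (rule tensor_eqI[of _ dn_scale dn_scale])
      (simp_all add: comult_dual_num dn_tensor_map_def tlift_tcls_field lext_field)
  show "algebra_hom (scl ?H) (*) (counit ?H)"
    by (simp add: algebra_homI k_algebra_mult k_algebra_dn)
  show "Vector_Spaces.linear (scl ?H) (scl ?H) (antipode ?H)"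
    by (simp add: Vector_Spaces.linear_iff dn.vector_space_axioms)
  show "alg_span (scl ?H) ({} \<union> {dn_x}) = UNIV" by (simp add: alg_span_dn)
  fix x :: "'k dual_num" assume "x \<in> {dn_x}"
  then show "\<exists>g\<in>insert 1 {}. \<exists>c\<in>insert 1 {}. comult ?H x = tcls (scl ?H) (scl ?H) (fbasis (x, c) + fbasis (g, x)) \<and>
      counit ?H x = 0 \<and> antipode ?H x * c + antipode ?H g * x = 0 \<and> x * antipode ?H c + g * antipode ?H x = 0"
    using comult_dn_x xx by simp
qed (simp_all add: dual_num_hopf_simps mult.commute)

lemma skew_pair_dual_num: "skew_pair (dual_num_hopf :: ('k, 'k dual_num) hopf) dn_x 1"
  using hopf_algebra.comult_one[OF hopf_algebra_dual_num] comult_dn_x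
  by (simp add: skew_pair_def dual_num_hopf_simps dn_double)

lemma rho2_eq: "rho2 = dn_coact dual_num_hopf (dn_x :: 'k dual_num) 1"
  by (simp add: rho2_def comult_dual_num)

end

section \<open>Monoid algebras and group algebras\<close>

lemma lext_times:
  fixes f g :: "'g::monoid_add \<Rightarrow>\<^sub>0 'k::field"
  assumes "vector_space s"
  shows "lext s \<phi> (f * g) = lext s (\<lambda>x. lext s (\<lambda>y. \<phi> (x + y)) g) f"
proof -
  interpret vector_space s by fact
  show ?thesis
  proof (induction f rule: poly_mapping_sum_induct)
    case (single x r f)
    have "lext s \<phi> (Poly_Mapping.single x r * g) = s r (lext s (\<lambda>y. \<phi> (x + y)) g)" for x r
      by (induction g rule: poly_mapping_sum_induct)
        (simp_all add: distrib_left lext_add mult_single lext_single scale_right_distrib)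
    with single show ?case by (simp add: distrib_right lext_add lext_single)
  qed simp
qed

lemma lext_one_field: "lext (*) g (1 :: 'g::monoid_add \<Rightarrow>\<^sub>0 'k::field) = g 0"
  by (simp add: lext_def flip: single_one)

lemma k_algebra_fscale: "k_algebra (fscale :: 'k::field \<Rightarrow> ('g::monoid_add \<Rightarrow>\<^sub>0 'k) \<Rightarrow> _)"
proof -
  interpret vector_space "fscale :: 'k \<Rightarrow> ('g \<Rightarrow>\<^sub>0 'k) \<Rightarrow> _" by (rule vector_space_fscale)
  have comm: "x * Poly_Mapping.single 0 c = Poly_Mapping.single 0 c * x" for x :: "'g \<Rightarrow>\<^sub>0 'k" and c
    by (induction x rule: poly_mapping_sum_induct)
      (simp_all add: distrib_left distrib_right mult_single mult.commute)
  show ?thesis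
    by unfold_locales (simp_all add: fscale_conv_mult mult.assoc, simp add: comm flip: mult.assoc)
qed

lemma group_hopf_simps:
  "scl group_hopf = fscale" "counit group_hopf = lext (*) (\<lambda>_. 1)"
  "antipode group_hopf = lext fscale (\<lambda>g. fbasis (- g))"
  by (simp_all add: group_hopf_def fext_conv_lext lext_def fun_eq_iff)

lemma tlift_group_comult:
  assumes "vector_space sV" "bilin fscale fscale sV \<beta>"
  shows "tlift sV \<beta> (comult group_hopf f) = lext sV (\<lambda>g. \<beta> (fbasis g) (fbasis g)) f"
proof -
  interpret V: vector_space sV by fact
  show ?thesis
    by (simp add: group_hopf_def tlift_tcls[OF assms] V.lext_fext V.lext_fbasis)
qed

lemma comult_group_fbasis: "comult group_hopf (fbasis g) = tcls fscale fscale (fbasis (fbasis g, fbasis g))"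
  by (simp add: group_hopf_def fext_conv_lext vector_space.lext_fbasis[OF vector_space_fscale])

lemma alg_span_fbasis: "alg_span fscale (range fbasis) = (UNIV :: ('g::monoid_add \<Rightarrow>\<^sub>0 'k::field) set)"
proof -
  have "f \<in> alg_span fscale (range fbasis)" for f :: "'g \<Rightarrow>\<^sub>0 'k"
  proof (induction f rule: poly_mapping_sum_induct)
    case zero
    have "fscale 0 1 \<in> alg_span fscale (range (fbasis :: 'g \<Rightarrow> 'g \<Rightarrow>\<^sub>0 'k))"
      by (intro alg_span.intros)
    then show ?case by (simp add: fscale_single flip: single_one)
  next
    case (single w r q)
    have "fscale r (fbasis w) \<in> alg_span fscale (range (fbasis :: 'g \<Rightarrow> 'g \<Rightarrow>\<^sub>0 'k))"
      by (intro alg_span.intros) simp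
    with single show ?case by (intro alg_span.add) (simp_all add: fscale_single)
  qed
  then show ?thesis by auto
qed

text \<open>
  The universal property of a monoid algebra; it is used for group algebras and, with words as
  monoid, for the free algebra.
\<close>

lemma algebra_hom_lext:
  assumes "k_algebra s" "u 0 = 1" "\<And>x y. u (x + y) = u x * u y"
  shows "algebra_hom fscale s (lext s u)"
proof -
  interpret k_algebra s by fact
  show ?thesis
  proof (rule algebra_homI)
    show "lext s u 1 = 1" by (simp add: lext_single assms(2) flip: single_one)
    show "lext s u (x * y) = lext s u x * lext s u y" for x y
      unfolding lext_times[OF vector_space_axioms]
      by (simp add: assms(3) lext_def scale_sum_right sum_distrib_left sum_distrib_right
          scale_mult_left scale_mult_right mult.commute) (rule sum.swap)
  qed (simp_all add: assms k_algebra_fscale lext_add lext_fscale)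
qed

lemma hopf_algebra_group: "hopf_algebra (group_hopf :: ('k::field, 'g::group_add \<Rightarrow>\<^sub>0 'k) hopf)"
proof (rule hopf_algebra_pointedI[where G = "range fbasis" and P = "{}"])
  let ?H = "group_hopf :: ('k, 'g \<Rightarrow>\<^sub>0 'k) hopf"
  interpret F: k_algebra "fscale :: 'k \<Rightarrow> ('g \<Rightarrow>\<^sub>0 'k) \<Rightarrow> _" by (rule k_algebra_fscale)
  note [simp] = group_hopf_simps
  show "k_algebra (scl ?H)" by (simp add: k_algebra_fscale)
  show hom: "tensor_algebra_hom (scl ?H) (scl ?H) (scl ?H) (comult ?H)"
  proof (rule tensor_algebra_homI)
    interpret K: vector_space "(*) :: 'k \<Rightarrow> 'k \<Rightarrow> 'k" by (rule vector_space_mult)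
    fix \<beta> assume "bilin (scl ?H) (scl ?H) (*) \<beta>"
    then have \<beta>: "bilin fscale fscale (*) \<beta>" by simp
    note tg = tlift_group_comult[OF vector_space_mult]
    note t = tg[OF \<beta>] and b = bilin_mult[OF k_algebra_fscale k_algebra_fscale \<beta>]
    show "tlift (*) \<beta> (comult ?H (x + y)) = tlift (*) \<beta> (comult ?H x) + tlift (*) \<beta> (comult ?H y)" for x y
      by (simp add: t K.lext_add)
    show "tlift (*) \<beta> (comult ?H (scl ?H r x)) = r * tlift (*) \<beta> (comult ?H x)" for r x
      by (simp add: t K.lext_fscale)
    show "tlift (*) \<beta> (comult ?H (x * y)) =
        tlift (*) (\<lambda>a b. tlift (*) (\<lambda>a' b'. \<beta> (a * a') (b * b')) (comult ?H y)) (comult ?H x)" for x y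
      unfolding t tg[OF bilin_tlift[OF vector_space_mult b(2)]]
      by (simp add: tg[OF b(1)] lext_times[OF vector_space_mult] mult_single)
  qed (simp add: group_hopf_def)
  show "comult ?H 1 = tcls (scl ?H) (scl ?H) (fbasis (1, 1))"
    using comult_group_fbasis[of 0] by simp
  show "algebra_hom (scl ?H) (*) (counit ?H)"
    by (simp add: algebra_hom_lext k_algebra_mult)
  show "Vector_Spaces.linear (scl ?H) (scl ?H) (antipode ?H)"
    by (simp add: Vector_Spaces.linear_iff F.vector_space_axioms F.lext_add F.lext_fscale)
  show "antipode ?H 1 = 1"
    by (simp add: F.lext_single flip: single_one)
  show "antipode ?H (x * y) = antipode ?H y * antipode ?H x" for x y
  proof (induction x rule: poly_mapping_sum_induct)
    case (single w r x)
    have "antipode ?H (Poly_Mapping.single w r * y) = antipode ?H y * antipode ?H (Poly_Mapping.single w r)"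
      by (induction y rule: poly_mapping_sum_induct)
        (simp_all add: distrib_left distrib_right F.lext_add F.lext_single mult_single fscale_single
          minus_add mult.commute)
    with single show ?case by (simp add: distrib_left distrib_right F.lext_add)
  qed simp
  show "alg_span (scl ?H) (range fbasis \<union> {}) = UNIV" by (simp add: alg_span_fbasis)
  fix x :: "'g \<Rightarrow>\<^sub>0 'k" assume "x \<in> range fbasis"
  then show "comult ?H x = tcls (scl ?H) (scl ?H) (fbasis (x, x)) \<and> counit ?H x = 1 \<and>
      antipode ?H x * x = 1 \<and> x * antipode ?H x = 1"
    by (auto simp: comult_group_fbasis F.lext_fbasis lext_field mult_single)
qed simp

lemma skew_pair_group: "skew_pair group_hopf 0 (fbasis g)"
  by (rule hopf_algebra.skew_pair_zero[OF hopf_algebra_group])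
    (simp_all add: group_hopf_simps comult_group_fbasis lext_field)

lemma rho4_eq: "rho4 = dn_coact kCinf 0 (fbasis 1)" and rho4a_eq: "rho4a = dn_coact kC2 0 (fbasis 1)"
  by (intro ext, simp add: rho4_def rho4a_def group_hopf_simps dn_tensor_map_graded)+

lemma alg_span_trans:
  assumes "X \<subseteq> alg_span s Y"
  shows "alg_span s X \<subseteq> alg_span s Y"
proof
  fix x assume "x \<in> alg_span s X"
  then show "x \<in> alg_span s Y"
    by induction (use assms in \<open>auto intro: alg_span.intros\<close>)
qed

lemma alg_span_kCinf:
  "alg_span fscale {fbasis 1, fbasis (- 1), h} = (UNIV :: (int \<Rightarrow>\<^sub>0 'k::field) set)"
proof -
  let ?S = "alg_span fscale {fbasis 1, fbasis (- 1), h} :: (int \<Rightarrow>\<^sub>0 'k) set"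
  have "fbasis n \<in> ?S" for n :: int
  proof (induction n rule: int_induct[of _ 0])
    case base
    then show ?case by (simp add: alg_span.one)
  next
    case (step1 i)
    have "fbasis i * fbasis 1 \<in> ?S" by (intro alg_span.mult step1 alg_span.gen) simp
    then show ?case by (simp add: mult_single)
  next
    case (step2 i)
    have "fbasis i * fbasis (- 1) \<in> ?S" by (intro alg_span.mult step2 alg_span.gen) simp
    then show ?case by (simp add: mult_single)
  qed
  then have "range fbasis \<subseteq> ?S" by blast
  from alg_span_trans[OF this] show ?thesis by (simp add: alg_span_fbasis top.extremum_unique)
qed

lemma alg_span_kC2:
  assumes "fbasis 1 \<in> X"
  shows "alg_span fscale X = (UNIV :: (bit \<Rightarrow>\<^sub>0 'k::field) set)"
proof -
  have "fbasis g \<in> alg_span fscale X" for g :: bit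
    using assms by (cases g) (auto intro: alg_span.intros)
  then have "range fbasis \<subseteq> alg_span fscale X" by blast
  from alg_span_trans[OF this] show ?thesis by (simp add: alg_span_fbasis top.extremum_unique)
qed

lemma kCinf_universal_map:
  fixes c d :: "'h::ring_1"
  assumes s: "k_algebra s" and cd: "c * d = 1" "d * c = 1"
  shows "\<exists>\<phi>. algebra_hom fscale s \<phi> \<and> \<phi> (fbasis (1 :: int)) = c"
proof -
  interpret k_algebra s by fact
  define u :: "int \<Rightarrow> 'h" where "u n = (if n \<ge> 0 then c ^ nat n else d ^ nat (- n))" for n
  have cdd: "c * (d * x) = x" "d * (c * x) = x" for x using cd by (simp_all flip: mult.assoc)
  have u1: "u (1 + n) = c * u n" for n
  proof (cases "n \<ge> 0")
    case True
    then show ?thesis by (simp add: u_def nat_add_distrib)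
  next
    case False
    then obtain m where "n = - int (Suc m)" by (metis int_cases linorder_not_le of_nat_0_le_iff)
    then show ?thesis by (auto simp: u_def cdd nat_add_distrib)
  qed
  have u2: "u (n - 1) = d * u n" for n
    using u1[of "n - 1"] by (simp add: cdd)
  have "u (m + n) = u m * u n" for m n
  proof (induction m rule: int_induct[of _ 0])
    case base
    then show ?case by (simp add: u_def)
  next
    case (step1 i)
    then show ?case using u1[of "i + n"] u1[of i] by (simp add: algebra_simps)
  next
    case (step2 i)
    then show ?case using u2[of "i + n"] u2[of i] by (simp add: algebra_simps)
  qed
  then have "algebra_hom fscale s (lext s u)"
    by (intro algebra_hom_lext s) (simp_all add: u_def)
  moreover have "lext s u (fbasis 1) = c" by (simp add: lext_fbasis u_def)
  ultimately show ?thesis by blast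
qed

lemma kC2_universal_map:
  fixes c :: "'h::ring_1"
  assumes s: "k_algebra s" and cc: "c * c = 1"
  shows "\<exists>\<phi>. algebra_hom fscale s \<phi> \<and> \<phi> (fbasis (1 :: bit)) = c"
proof -
  interpret k_algebra s by fact
  define u :: "bit \<Rightarrow> 'h" where "u g = (if g = 0 then 1 else c)" for g
  have "u (x + y) = u x * u y" for x y
    using cc by (cases x; cases y) (simp_all add: u_def)
  then have "algebra_hom fscale s (lext s u)"
    by (intro algebra_hom_lext s) (simp_all add: u_def)
  moreover have "lext s u (fbasis 1) = c" by (simp add: lext_fbasis u_def)
  ultimately show ?thesis by blast
qed

lemma finite_span_dimensional:
  assumes "vector_space s" "finite S" "module.span s S = UNIV"
  shows "\<exists>B. finite_dimensional_vector_space s B"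
proof -
  interpret vector_space s by fact
  obtain B where "B \<subseteq> S" "independent B" "S \<subseteq> span B"
    using maximal_independent_subset by blast
  moreover from this have "span B = UNIV"
    using assms(3) span_mono[of S "span B"] by (simp add: span_span top.extremum_unique)
  ultimately have "finite_dimensional_vector_space s B"
    using assms(2) finite_subset by unfold_locales auto
  then show ?thesis by blast
qed

lemma kC2_expand: "f = fscale (Poly_Mapping.lookup f 0) 1 + fscale (Poly_Mapping.lookup f 1) (fbasis (1 :: bit))"
  by (rule poly_mapping_eqI)
    (auto simp: lookup_fscale lookup_add lookup_single when_def lookup_one split: bit.splits)

lemma kC2_finite_dimensional: "\<exists>B. finite_dimensional_vector_space (scl (kC2 :: ('k::field, _) hopf)) B"
proof -
  interpret F: k_algebra "fscale :: 'k \<Rightarrow> (bit \<Rightarrow>\<^sub>0 'k) \<Rightarrow> _" by (rule k_algebra_fscale)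
  have "f \<in> F.span {1, fbasis 1}" for f :: "bit \<Rightarrow>\<^sub>0 'k"
    by (subst kC2_expand[of f]) (intro F.span_add F.span_scale F.span_base; simp)
  then show ?thesis
    unfolding group_hopf_simps
    by (intro finite_span_dimensional[of _ "{1, fbasis 1}"] F.vector_space_axioms) auto
qed

context
  fixes \<theta> :: "'k::field"
  assumes char2: "CHAR('k) = 2" and \<theta>: "\<theta> \<noteq> 0"
begin

abbreviation kC2_h :: "bit \<Rightarrow>\<^sub>0 'k" where "kC2_h \<equiv> fscale \<theta> (1 + fbasis 1)"

lemma kC2_h_square: "kC2_h * kC2_h = 0"
proof -
  interpret F: k_algebra "fscale :: 'k \<Rightarrow> (bit \<Rightarrow>\<^sub>0 'k) \<Rightarrow> _" by (rule k_algebra_fscale)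
  have "(1 + fbasis 1) * (1 + fbasis 1) = (fscale (1 + 1) (1 + fbasis 1) :: bit \<Rightarrow>\<^sub>0 'k)"
    by (simp only: F.scale_left_distrib) (simp add: algebra_simps mult_single)
  also have "\<dots> = 0" by (simp only: double_eq_0[OF char2] F.scale_zero_left)
  finally show ?thesis by (simp add: F.scale_mult_left F.scale_mult_right)
qed

lemma kC2_double: "f + f = (0 :: bit \<Rightarrow>\<^sub>0 'k)"
  by (rule poly_mapping_eqI) (simp only: lookup_add double_eq_0[OF char2] lookup_zero)

lemma algebra_hom_dn_kC2: "algebra_hom dn_scale fscale (dn_kC2 \<theta>)"
proof -
  interpret F: k_algebra "fscale :: 'k \<Rightarrow> (bit \<Rightarrow>\<^sub>0 'k) \<Rightarrow> _" by (rule k_algebra_fscale)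
  define u where "u = kC2_h"
  have u: "dn_kC2 \<theta> a = fscale (dn_coord1 a) 1 + fscale (dn_coordx a) u" for a
    by (simp add: dn_kC2_def u_def)
  have uu: "u * u = 0" by (simp only: u_def kC2_h_square)
  show ?thesis
    by (intro algebra_homI k_algebra_dn k_algebra_fscale)
      (simp_all add: u uu F.scale_left_distrib F.scale_right_distrib distrib_left distrib_right
        F.scale_mult_left F.scale_mult_right mult.commute)
qed

text \<open>
  The inverse of \<open>dn_kC2 \<theta>\<close>: in characteristic 2 the equation \<open>x = \<theta> (1 + c)\<close> gives
  \<open>c = 1 + x / \<theta>\<close>.
\<close>

definition kC2_dn :: "(bit \<Rightarrow>\<^sub>0 'k) \<Rightarrow> 'k dual_num" where
  "kC2_dn f = dn_scale (Poly_Mapping.lookup f 0 + Poly_Mapping.lookup f 1) 1 +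
     dn_scale (Poly_Mapping.lookup f 1 / \<theta>) dn_x"

lemma dn_kC2_inverse: "kC2_dn (dn_kC2 \<theta> a) = a" "dn_kC2 \<theta> (kC2_dn f) = f"
proof -
  show "kC2_dn (dn_kC2 \<theta> a) = a"
    using \<theta> char2[folded char_2_iff]
    by (simp add: kC2_dn_def dn_kC2_def dn_eq_iff lookup_fscale lookup_add lookup_single lookup_one when_def
        add.assoc flip: distrib_left)
  show "dn_kC2 \<theta> (kC2_dn f) = f"
  proof (rule poly_mapping_eqI)
    fix g
    have "x + y + y = x" for x y :: 'k by (simp only: add.assoc double_eq_0[OF char2]) simp
    then show "Poly_Mapping.lookup (dn_kC2 \<theta> (kC2_dn f)) g = Poly_Mapping.lookup f g"
      using \<theta> by (cases g) (simp_all add: kC2_dn_def dn_kC2_def lookup_fscale lookup_add lookup_single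
          lookup_one when_def)
  qed
qed

lemma bij_dn_kC2: "bij (dn_kC2 \<theta>)"
  by (rule o_bij[of kC2_dn]) (simp_all add: fun_eq_iff dn_kC2_inverse)

lemma inv_dn_kC2: "inv (dn_kC2 \<theta>) = kC2_dn"
  by (rule inv_equality) (simp_all add: dn_kC2_inverse)

lemma algebra_iso_dn_kC2: "algebra_iso dn_scale (scl kC2) (dn_kC2 \<theta>)"
  by (simp add: algebra_iso_def algebra_hom_dn_kC2 bij_dn_kC2 group_hopf_simps)

lemma tlift_rho3:
  assumes \<beta>: "bilin dn_scale fscale (*) \<beta>"
  shows "tlift (*) \<beta> (rho3 \<theta> a) = lext (*) (\<lambda>g. \<beta> (kC2_dn (fbasis g)) (fbasis g)) (dn_kC2 \<theta> a)"
proof -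
  have "bilin fscale fscale (*) (\<lambda>c d. \<beta> (kC2_dn c) d)"
    by (rule bilinI) (simp_all add: kC2_dn_def lookup_add lookup_fscale bilin_simps[OF \<beta>] 
        add_divide_distrib algebra_simps)
  then show ?thesis
    by (simp add: rho3_def inv_dn_kC2 tlift_tmap[OF vector_space_mult \<beta>] tlift_group_comult[OF vector_space_mult])
qed

lemma rho3_graded:
  "rho3 \<theta> (inv (dn_kC2 \<theta>) (fbasis g)) =
     tcls dn_scale (scl kC2) (fbasis (inv (dn_kC2 \<theta>) (fbasis g), fbasis g))"
proof (rule tensor_eqI[of _ dn_scale fscale])
  fix \<beta> :: "'k dual_num \<Rightarrow> (bit \<Rightarrow>\<^sub>0 'k) \<Rightarrow> 'k" assume \<beta>: "bilin dn_scale fscale (*) \<beta>"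
  show "tlift (*) \<beta> (rho3 \<theta> (inv (dn_kC2 \<theta>) (fbasis g))) =
      tlift (*) \<beta> (tcls dn_scale (scl kC2) (fbasis (inv (dn_kC2 \<theta>) (fbasis g), fbasis g)))"
    by (simp add: tlift_rho3[OF \<beta>] inv_dn_kC2 dn_kC2_inverse group_hopf_simps lext_field
        tlift_tcls_field[OF \<beta>])
qed (simp_all add: rho3_def tmap_def group_hopf_simps)

text \<open>
  Indeed \<open>\<rho> x = \<theta> (1 \<otimes> 1 + c \<otimes> c)\<close>, where the left tensor factor \<open>c\<close> stands for \<open>1 + x / \<theta>\<close>.
\<close>

lemma rho3_eq: "rho3 \<theta> = dn_coact kC2 kC2_h (fbasis 1)"
proof
  fix a
  show "rho3 \<theta> a = dn_coact kC2 kC2_h (fbasis 1) a"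
  proof (rule tensor_eqI[of _ dn_scale fscale])
    fix \<beta> :: "'k dual_num \<Rightarrow> (bit \<Rightarrow>\<^sub>0 'k) \<Rightarrow> 'k" assume \<beta>: "bilin dn_scale fscale (*) \<beta>"
    have one: "kC2_dn 1 = 1" "kC2_dn (fbasis 1) = 1 + dn_scale (1 / \<theta>) dn_x"
      by (simp_all add: kC2_dn_def lookup_one lookup_single when_def dn_eq_iff)
    show "tlift (*) \<beta> (rho3 \<theta> a) = tlift (*) \<beta> (dn_coact kC2 kC2_h (fbasis 1) a)"
      unfolding group_hopf_simps tlift_rho3[OF \<beta>] tlift_dn_coact_field[OF \<beta>]
      using \<theta>
      by (simp add: dn_kC2_def lext_field lext_one_field one bilin_simps[OF \<beta>] field_simps)
  qed (simp_all add: rho3_def tmap_def group_hopf_simps dn_tensor_map_def)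
qed

lemma skew_pair_kC2: "skew_pair kC2 kC2_h (fbasis 1)"
proof -
  interpret F: k_algebra "fscale :: 'k \<Rightarrow> (bit \<Rightarrow>\<^sub>0 'k) \<Rightarrow> _" by (rule k_algebra_fscale)
  have "comult kC2 kC2_h = tcls fscale fscale (fbasis (kC2_h, fbasis 1) + fbasis (1, kC2_h))"
  proof (rule tensor_eqI[of _ fscale fscale])
    fix \<beta> :: "(bit \<Rightarrow>\<^sub>0 'k) \<Rightarrow> (bit \<Rightarrow>\<^sub>0 'k) \<Rightarrow> 'k" assume \<beta>: "bilin fscale fscale (*) \<beta>"
    show "tlift (*) \<beta> (comult kC2 kC2_h) =
        tlift (*) \<beta> (tcls fscale fscale (fbasis (kC2_h, fbasis 1) + fbasis (1, kC2_h)))"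
      using char2[folded char_2_iff]
      by (simp add: tlift_group_comult[OF vector_space_mult \<beta>] tlift_tcls_field[OF \<beta>]
          lext_field lext_one_field bilin_simps[OF \<beta>] distrib_left)
  qed (simp_all add: group_hopf_def)
  moreover have "kC2_h * fbasis 1 + fbasis 1 * kC2_h = 0"
    by (simp only: mult.commute[of "fbasis 1" kC2_h] kC2_double)
  moreover have "lext (*) (\<lambda>_. 1) kC2_h = 0"
    by (simp add: lext_field lext_one_field double_eq_0[OF char2] del: one_add_one)
  ultimately show ?thesis
    by (simp add: skew_pair_def group_hopf_simps comult_group_fbasis kC2_h_square lext_field)
qed

end

section \<open>The Sweedler algebra\<close>

lemma k_algebra_sweedler: "k_algebra sweedler_scale"
  by unfold_locales (simp_all add: sweedler_scale_def plus_sweedler_def times_sweedler_def sweedler.expand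
      algebra_simps)

abbreviation sweedler_w :: "'k::field sweedler" where
  "sweedler_w \<equiv> sweedler_c * sweedler_v"

lemma sweedler_mult_table:
  "sweedler_c * sweedler_c = (1 :: 'k::field sweedler)"
  "sweedler_c * sweedler_w = (sweedler_v :: 'k sweedler)"
  "sweedler_v * sweedler_c = (- sweedler_w :: 'k sweedler)"
  "sweedler_v * sweedler_v = (0 :: 'k sweedler)"
  "sweedler_v * sweedler_w = (0 :: 'k sweedler)"
  "sweedler_w * sweedler_c = (- sweedler_v :: 'k sweedler)"
  "sweedler_w * sweedler_v = (0 :: 'k sweedler)"
  "sweedler_w * sweedler_w = (0 :: 'k sweedler)"
  by (simp_all add: sweedler_c_def sweedler_v_def zero_sweedler_def
      one_sweedler_def uminus_sweedler_def times_sweedler_def)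

lemma sweedler_coord_simps [simp]:
  "sw_1 0 = 0" "sw_c 0 = 0" "sw_v 0 = 0" "sw_cv 0 = 0"
  "sw_1 1 = 1" "sw_c 1 = 0" "sw_v 1 = 0" "sw_cv 1 = 0"
  "sw_1 sweedler_c = 0" "sw_c sweedler_c = 1" "sw_v sweedler_c = 0" "sw_cv sweedler_c = 0"
  "sw_1 sweedler_v = 0" "sw_c sweedler_v = 0" "sw_v sweedler_v = 1" "sw_cv sweedler_v = 0"
  "sw_1 (a + b) = sw_1 a + sw_1 b" "sw_c (a + b) = sw_c a + sw_c b"
  "sw_v (a + b) = sw_v a + sw_v b" "sw_cv (a + b) = sw_cv a + sw_cv b"
  "sw_1 (a - b) = sw_1 a - sw_1 b" "sw_c (a - b) = sw_c a - sw_c b"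
  "sw_v (a - b) = sw_v a - sw_v b" "sw_cv (a - b) = sw_cv a - sw_cv b"
  "sw_1 (- a) = - sw_1 a" "sw_c (- a) = - sw_c a" "sw_v (- a) = - sw_v a" "sw_cv (- a) = - sw_cv a"
  "sw_1 (sweedler_scale r a) = r * sw_1 a" "sw_c (sweedler_scale r a) = r * sw_c a"
  "sw_v (sweedler_scale r a) = r * sw_v a" "sw_cv (sweedler_scale r a) = r * sw_cv a"
  by (simp_all add: zero_sweedler_def one_sweedler_def sweedler_c_def sweedler_v_def plus_sweedler_def
      minus_sweedler_def uminus_sweedler_def sweedler_scale_def)

lemma sweedler_coord_mult:
  "sw_1 (a * b) = sw_1 a * sw_1 b + sw_c a * sw_c b"
  "sw_c (a * b) = sw_1 a * sw_c b + sw_c a * sw_1 b"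
  "sw_v (a * b) = sw_1 a * sw_v b + sw_v a * sw_1 b + sw_c a * sw_cv b - sw_cv a * sw_c b"
  "sw_cv (a * b) = sw_1 a * sw_cv b + sw_cv a * sw_1 b + sw_c a * sw_v b - sw_v a * sw_c b"
  by (simp_all add: times_sweedler_def)

lemma sweedler_eq_iff:
  "a = b \<longleftrightarrow> sw_1 a = sw_1 b \<and> sw_c a = sw_c b \<and> sw_v a = sw_v b \<and> sw_cv a = sw_cv b"
  by (auto intro: sweedler.expand)

lemma tlift_sweedler_comult:
  assumes "vector_space sV" "bilin sweedler_scale sweedler_scale sV \<beta>"
  shows "tlift sV \<beta> (comult sweedler_hopf a) =
    sV (sw_1 a) (\<beta> 1 1) + sV (sw_c a) (\<beta> sweedler_c sweedler_c)
    + sV (sw_v a) (\<beta> sweedler_c sweedler_v + \<beta> sweedler_v 1)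
    + sV (sw_cv a) (\<beta> 1 sweedler_w + \<beta> sweedler_w sweedler_c)"
proof -
  interpret V: vector_space sV by fact
  show ?thesis
    by (simp add: sweedler_hopf_def Let_def tlift_tcls[OF assms] V.lext_add V.lext_fscale V.lext_fbasis
        lext_ftimes[OF assms(1)] sweedler_mult_table)
qed

lemma sweedler_hopf_simps:
  "scl sweedler_hopf = sweedler_scale" "counit sweedler_hopf = (\<lambda>a. sw_1 a + sw_c a)"
  "antipode sweedler_hopf = (\<lambda>a. Sw (sw_1 a) (sw_c a) (sw_cv a) (- sw_v a))"
  by (simp_all add: sweedler_hopf_def Let_def fun_eq_iff sweedler_eq_iff sweedler_coord_mult)

lemma comult_sweedler:
  "comult (sweedler_hopf :: ('k::field, 'k sweedler) hopf) sweedler_c =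
     tcls sweedler_scale sweedler_scale (fbasis (sweedler_c, sweedler_c))" (is "?c")
  "comult (sweedler_hopf :: ('k, 'k sweedler) hopf) sweedler_v =
     tcls sweedler_scale sweedler_scale (fbasis (sweedler_v, 1) + fbasis (sweedler_c, sweedler_v))" (is "?v")
  "comult (sweedler_hopf :: ('k, 'k sweedler) hopf) sweedler_w =
     tcls sweedler_scale sweedler_scale (fbasis (sweedler_w, sweedler_c) + fbasis (1, sweedler_w))" (is "?w")
proof -
  have *: "comult sweedler_hopf a = tcls sweedler_scale sweedler_scale f"
    if "\<And>\<beta>. bilin sweedler_scale sweedler_scale (*) \<beta> \<Longrightarrow>
      tlift (*) \<beta> (comult sweedler_hopf a) = lext (*) (\<lambda>(a, b). \<beta> a b) f"
    for a :: "'k sweedler" and f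
    by (rule tensor_eqI[of _ sweedler_scale sweedler_scale])
      (simp_all add: that tlift_tcls_field, simp add: sweedler_hopf_def Let_def)
  note t = tlift_sweedler_comult[OF vector_space_mult] lext_field sweedler_coord_mult
  show ?c by (rule *) (simp add: t)
  show ?v by (rule *) (simp add: t)
  show ?w by (rule *) (simp add: t)
qed

lemma hopf_algebra_sweedler: "hopf_algebra (sweedler_hopf :: ('k::field, 'k sweedler) hopf)"
proof (rule hopf_algebra_pointedI[where G = "{sweedler_c}" and P = "{sweedler_v}"])
  let ?H = "sweedler_hopf :: ('k, 'k sweedler) hopf"
  interpret S: k_algebra "sweedler_scale :: 'k \<Rightarrow> _" by (rule k_algebra_sweedler)
  note [simp] = sweedler_hopf_simps
  note tg = tlift_sweedler_comult[OF vector_space_mult]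
  show "k_algebra (scl ?H)" by (simp add: k_algebra_sweedler)
  show hom: "tensor_algebra_hom (scl ?H) (scl ?H) (scl ?H) (comult ?H)"
  proof (rule tensor_algebra_homI)
    fix \<beta> assume "bilin (scl ?H) (scl ?H) (*) \<beta>"
    then have \<beta>: "bilin sweedler_scale sweedler_scale (*) \<beta>" by simp
    note t = tg[OF \<beta>] and b = bilin_mult[OF k_algebra_sweedler k_algebra_sweedler \<beta>]
    show "tlift (*) \<beta> (comult ?H (x + y)) = tlift (*) \<beta> (comult ?H x) + tlift (*) \<beta> (comult ?H y)" for x y
      unfolding t by (simp add: algebra_simps)
    show "tlift (*) \<beta> (comult ?H (scl ?H r x)) = r * tlift (*) \<beta> (comult ?H x)" for r x
      unfolding t by (simp add: algebra_simps)
    show "tlift (*) \<beta> (comult ?H (x * y)) =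
        tlift (*) (\<lambda>a b. tlift (*) (\<lambda>a' b'. \<beta> (a * a') (b * b')) (comult ?H y)) (comult ?H x)" for x y
      unfolding t tg[OF bilin_tlift[OF vector_space_mult b(2)]]
      unfolding tg[OF b(1)]
      by (simp add: sweedler_mult_table bilin_simps[OF \<beta>] sweedler_coord_mult) (simp add: algebra_simps)
  qed (simp add: sweedler_hopf_def Let_def)
  show "comult ?H 1 = tcls (scl ?H) (scl ?H) (fbasis (1, 1))"
    by (rule tensor_eqI[of _ sweedler_scale sweedler_scale])
      (simp_all add: tg tlift_tcls_field lext_field, simp add: sweedler_hopf_def Let_def)
  show "algebra_hom (scl ?H) (*) (counit ?H)"
    by (rule algebra_homI) (simp_all add: k_algebra_mult k_algebra_sweedler sweedler_coord_mult algebra_simps)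
  show "Vector_Spaces.linear (scl ?H) (scl ?H) (antipode ?H)"
    by (simp add: Vector_Spaces.linear_iff S.vector_space_axioms sweedler_eq_iff)
  show "antipode ?H 1 = 1" by (simp add: sweedler_eq_iff)
  show "antipode ?H (x * y) = antipode ?H y * antipode ?H x" for x y
    by (simp add: sweedler_eq_iff sweedler_coord_mult algebra_simps)
  have "a \<in> alg_span sweedler_scale {sweedler_c, sweedler_v}" for a :: "'k sweedler"
  proof -
    have "a = sweedler_scale (sw_1 a) 1 + sweedler_scale (sw_c a) sweedler_c + sweedler_scale (sw_v a) sweedler_v
       + sweedler_scale (sw_cv a) sweedler_w"
      using sweedler_basis[of "sw_1 a" "sw_c a" "sw_v a" "sw_cv a"] by simp
    moreover have "\<dots> \<in> alg_span sweedler_scale {sweedler_c, sweedler_v}"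
      by (intro alg_span.add alg_span.scale alg_span.mult alg_span.one; rule alg_span.gen; simp)
    ultimately show ?thesis by simp
  qed
  then show "alg_span (scl ?H) ({sweedler_c} \<union> {sweedler_v}) = UNIV" by (auto simp: insert_commute)
  show "comult ?H x = tcls (scl ?H) (scl ?H) (fbasis (x, x)) \<and> counit ?H x = 1 \<and>
      antipode ?H x * x = 1 \<and> x * antipode ?H x = 1" if "x \<in> {sweedler_c}" for x
  proof -
    from that have x: "x = sweedler_c" by simp
    show ?thesis unfolding x using comult_sweedler(1) by (simp add: sweedler_eq_iff sweedler_coord_mult)
  qed
  show "\<exists>g\<in>insert 1 {sweedler_c}. \<exists>c\<in>insert 1 {sweedler_c}.
      comult ?H x = tcls (scl ?H) (scl ?H) (fbasis (x, c) + fbasis (g, x)) \<and> counit ?H x = 0 \<and>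
      antipode ?H x * c + antipode ?H g * x = 0 \<and> x * antipode ?H c + g * antipode ?H x = 0"
    if "x \<in> {sweedler_v}" for x
  proof -
    from that have x: "x = sweedler_v" by simp
    show ?thesis unfolding x using comult_sweedler(2)
      by (intro bexI[of _ sweedler_c] bexI[of _ 1]) (simp_all add: sweedler_eq_iff sweedler_coord_mult)
  qed
qed

lemma skew_pair_sweedler: "skew_pair (sweedler_hopf :: ('k::field, 'k sweedler) hopf) sweedler_w sweedler_c"
  using comult_sweedler(1,3)
  by (simp add: skew_pair_def sweedler_hopf_simps sweedler_mult_table sweedler_coord_mult)

lemma rho5a_eq: "rho5a = dn_coact sweedler_hopf sweedler_w sweedler_c"
  by (simp add: rho5a_def sweedler_hopf_simps add.commute)

lemma sweedler_finite_dimensional: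
  "\<exists>B. finite_dimensional_vector_space (scl (sweedler_hopf :: ('k::field, 'k sweedler) hopf)) B"
proof -
  interpret S: k_algebra "sweedler_scale :: 'k \<Rightarrow> _" by (rule k_algebra_sweedler)
  have "a \<in> S.span {1, sweedler_c, sweedler_v, sweedler_w}" for a :: "'k sweedler"
  proof (cases a)
    case (Sw p q r s)
    show ?thesis unfolding Sw sweedler_basis
      by (intro S.span_add S.span_scale S.span_base; simp)
  qed
  then show ?thesis
    unfolding sweedler_hopf_simps
    by (intro finite_span_dimensional[of _ "{1, sweedler_c, sweedler_v, sweedler_w}"] S.vector_space_axioms) auto
qed

section \<open>The Hopf algebra $k\langle c,d,h\rangle/I_0$\<close>

lemma free_eval_conv_lext: "free_eval s \<phi> = lext s (\<lambda>w. prod_list (map \<phi> (letters w)))"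
  by (simp add: free_eval_def lext_def fun_eq_iff)

lemma free_anti_eval_conv_lext: "free_anti_eval s \<phi> = lext s (\<lambda>w. prod_list (map \<phi> (rev (letters w))))"
  by (simp add: free_anti_eval_def lext_def fun_eq_iff)

lemma algebra_hom_free_eval: "k_algebra s \<Longrightarrow> algebra_hom fscale s (free_eval s \<phi>)"
  unfolding free_eval_conv_lext
  by (rule algebra_hom_lext) (simp_all add: zero_word_def plus_word_def)

lemma free_eval_fgen: "k_algebra s \<Longrightarrow> free_eval s \<phi> (fgen g) = \<phi> g"
  by (simp add: free_eval_conv_lext vector_space.lext_fbasis k_algebra_vector_space)

lemma I0_subset:
  assumes "two_sided_ideal K" "fgen gC * fgen gD - 1 \<in> K" "fgen gD * fgen gC - 1 \<in> K"
    "fgen gH * fgen gH \<in> K" "fgen gH * fgen gC + fgen gC * fgen gH \<in> K"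
  shows "I0 \<subseteq> K"
  unfolding I0_def generated_ideal_def using assms by (auto simp: power2_eq_square)

lemma free_eval_I0:
  assumes s: "k_algebra s" and rels: "\<phi> gC * \<phi> gD = 1" "\<phi> gD * \<phi> gC = 1"
    "\<phi> gH * \<phi> gH = 0" "\<phi> gH * \<phi> gC + \<phi> gC * \<phi> gH = 0"
    and p: "p \<in> I0"
  shows "free_eval s \<phi> p = 0"
proof -
  note h = algebra_homD[OF algebra_hom_free_eval[OF s, of \<phi>]] free_eval_fgen[OF s, of \<phi>]
  have "I0 \<subseteq> {p. free_eval s \<phi> p = 0}"
    by (rule I0_subset) (simp_all add: two_sided_ideal_def h rels)
  with p show ?thesis by blast
qed

lemma abs_rep_cdh: "abs_cdh (rep_cdh q) = q"
  by (rule Quotient_abs_rep[OF Quotient_cdh])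

lemma rep_abs_cdh: "rep_cdh (abs_cdh p) - p \<in> I0"
  using abs_rep_cdh[of "abs_cdh p"] by (simp add: cdh.abs_eq_iff)

lemma abs_cdh_hom:
  "1 = abs_cdh 1" "abs_cdh p + abs_cdh q = abs_cdh (p + q)" "abs_cdh p * abs_cdh q = abs_cdh (p * q)"
  "cdh_scale r (abs_cdh p) = abs_cdh (fscale r p)"
  by (simp_all add: one_cdh_def plus_cdh.abs_eq times_cdh.abs_eq cdh_scale.abs_eq)

lemma k_algebra_cdh: "k_algebra (cdh_scale :: 'k::field \<Rightarrow> _)"
proof -
  interpret F: k_algebra "fscale :: 'k \<Rightarrow> ((cdh_gen, 'k) free_alg) \<Rightarrow> _" by (rule k_algebra_fscale)
  show ?thesis
    by unfold_locales
      (transfer; simp add: I0_zero F.scale_right_distrib F.scale_left_distrib F.scale_mult_left F.scale_mult_right)+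
qed

interpretation cdh: k_algebra cdh_scale by (rule k_algebra_cdh)

lemma cdh_relations:
  "cdh_c * cdh_d = (1 :: 'k::field cdh)" "cdh_d * cdh_c = (1 :: 'k cdh)"
  "cdh_h * cdh_h = (0 :: 'k cdh)" "cdh_h * cdh_c + cdh_c * cdh_h = (0 :: 'k cdh)"
proof -
  have "fgen gC * fgen gD - 1 \<in> (I0 :: (cdh_gen, 'k) free_alg set)"
    "fgen gD * fgen gC - 1 \<in> (I0 :: (cdh_gen, 'k) free_alg set)"
    "fgen gH * fgen gH \<in> (I0 :: (cdh_gen, 'k) free_alg set)"
    "fgen gH * fgen gC + fgen gC * fgen gH \<in> (I0 :: (cdh_gen, 'k) free_alg set)"
    unfolding I0_def generated_ideal_def power2_eq_square by blast+
  then show "cdh_c * cdh_d = (1 :: 'k cdh)" "cdh_d * cdh_c = (1 :: 'k cdh)"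
    "cdh_h * cdh_h = (0 :: 'k cdh)" "cdh_h * cdh_c + cdh_c * cdh_h = (0 :: 'k cdh)"
    by (simp_all add: cdh_c_def cdh_d_def cdh_h_def times_cdh.abs_eq plus_cdh.abs_eq one_cdh_def
        zero_cdh_def cdh.abs_eq_iff)
qed

definition cdh_eval :: "('k::field \<Rightarrow> 'a::ring_1 \<Rightarrow> 'a) \<Rightarrow> (cdh_gen \<Rightarrow> 'a) \<Rightarrow> 'k cdh \<Rightarrow> 'a" where
  "cdh_eval s \<phi> q = free_eval s \<phi> (rep_cdh q)"

lemma cdh_eval:
  assumes s: "k_algebra s" and rels: "\<phi> gC * \<phi> gD = 1" "\<phi> gD * \<phi> gC = 1"
    "\<phi> gH * \<phi> gH = 0" "\<phi> gH * \<phi> gC + \<phi> gC * \<phi> gH = 0"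
  shows "algebra_hom cdh_scale s (cdh_eval s \<phi>)"
    and "cdh_eval s \<phi> cdh_c = \<phi> gC" "cdh_eval s \<phi> cdh_d = \<phi> gD" "cdh_eval s \<phi> cdh_h = \<phi> gH"
proof -
  note h = algebra_homD[OF algebra_hom_free_eval[OF s, of \<phi>]] free_eval_fgen[OF s, of \<phi>]
  have abs: "cdh_eval s \<phi> (abs_cdh p) = free_eval s \<phi> p" for p
    using free_eval_I0[OF s rels rep_abs_cdh, of p] by (simp add: cdh_eval_def h)
  show "algebra_hom cdh_scale s (cdh_eval s \<phi>)"
  proof (rule algebra_homI)
    show "cdh_eval s \<phi> 1 = 1" by (simp only: abs_cdh_hom(1) abs h)
    fix x y r
    show "cdh_eval s \<phi> (x + y) = cdh_eval s \<phi> x + cdh_eval s \<phi> y"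
      using abs[of "rep_cdh x + rep_cdh y"] by (simp add: h abs_rep_cdh flip: abs_cdh_hom(2)) (simp add: cdh_eval_def)
    show "cdh_eval s \<phi> (x * y) = cdh_eval s \<phi> x * cdh_eval s \<phi> y"
      using abs[of "rep_cdh x * rep_cdh y"] by (simp add: h abs_rep_cdh flip: abs_cdh_hom(3)) (simp add: cdh_eval_def)
    show "cdh_eval s \<phi> (cdh_scale r x) = s r (cdh_eval s \<phi> x)"
      using abs[of "fscale r (rep_cdh x)"] by (simp add: h abs_rep_cdh flip: abs_cdh_hom(4)) (simp add: cdh_eval_def)
  qed (simp_all add: s k_algebra_cdh)
  show "cdh_eval s \<phi> cdh_c = \<phi> gC" "cdh_eval s \<phi> cdh_d = \<phi> gD" "cdh_eval s \<phi> cdh_h = \<phi> gH"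
    by (simp_all add: cdh_c_def cdh_d_def cdh_h_def abs h)
qed

lemma cdh_cases: obtains p where "q = abs_cdh p"
  using abs_rep_cdh[of q] by metis

lemma alg_span_cdh: "alg_span cdh_scale {cdh_c, cdh_d, cdh_h} = UNIV"
proof -
  let ?S = "alg_span cdh_scale {cdh_c, cdh_d, cdh_h} :: 'a cdh set"
  have g: "abs_cdh (fgen g) \<in> ?S" for g
    by (cases g) (auto intro!: alg_span.gen simp: cdh_c_def cdh_d_def cdh_h_def)
  have w: "abs_cdh (fbasis (Word gs)) \<in> ?S" for gs
  proof (induction gs)
    case Nil
    have "1 \<in> ?S" by (rule alg_span.one)
    then show ?case unfolding abs_cdh_hom(1) by (simp flip: single_one zero_word_def)
  next
    case (Cons a gs)
    have "abs_cdh (fgen a) * abs_cdh (fbasis (Word gs)) \<in> ?S" by (intro alg_span.mult g Cons)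
    then show ?case by (simp add: abs_cdh_hom(3) mult_single plus_word_def)
  qed
  have "abs_cdh p \<in> ?S" for p
  proof (induction p rule: poly_mapping_sum_induct)
    case zero
    have "cdh_scale 0 1 \<in> ?S" by (intro alg_span.intros)
    then show ?case by (simp add: zero_cdh_def)
  next
    case (single w r q)
    have "cdh_scale r (abs_cdh (fbasis w)) \<in> ?S"
      using w[of "letters w"] by (intro alg_span.scale) simp
    from alg_span.add[OF single this] show ?case by (simp add: abs_cdh_hom(2-) fscale_single)
  qed
  then have "q \<in> ?S" for q by (metis abs_rep_cdh)
  then show ?thesis by auto
qed

abbreviation cdh_comult_free :: "(cdh_gen, 'k::field) free_alg \<Rightarrow> ('k cdh \<times> 'k cdh \<Rightarrow>\<^sub>0 'k)" where
  "cdh_comult_free \<equiv> free_tensor_eval cdh_comult_gen"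

lemma lext_foldr_ftimes:
  "lext (*) F (foldr (\<lambda>g t. ftimes (\<phi> g) t) (gs @ gs') (fbasis (1, 1))) =
    lext (*) (\<lambda>(a, b). lext (*) (\<lambda>(a', b'). F (a * a', b * b')) (foldr (\<lambda>g t. ftimes (\<phi> g) t) gs' (fbasis (1, 1))))
      (foldr (\<lambda>g t. ftimes (\<phi> g) t) gs (fbasis (1, 1)))"
proof (induction gs arbitrary: F)
  case Nil
  then show ?case by (simp add: lext_field)
next
  case (Cons g gs)
  have m: "lext (*) F (ftimes p q) = lext (*) (\<lambda>(a, b). lext (*) (\<lambda>(a', b'). F (a * a', b * b')) q) p" for F p q
    using lext_ftimes[OF vector_space_mult, of "\<lambda>a b. F (a, b)"] by simp
  show ?case
    by (simp add: m case_prod_unfold Cons mult.assoc del: foldr_append)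
qed

text \<open>
  Already at the level of formal sums \<open>free_tensor_eval\<close> is multiplicative for the componentwise
  product, so \<open>F\<close> may be an arbitrary function of pairs.
\<close>

lemma lext_free_tensor_eval_mult:
  fixes \<phi> :: "'g \<Rightarrow> ('a::ring_1 \<times> 'b::ring_1 \<Rightarrow>\<^sub>0 'k::field)"
  shows "lext (*) F (free_tensor_eval \<phi> (p * q)) =
    lext (*) (\<lambda>(a, b). lext (*) (\<lambda>(a', b'). F (a * a', b * b')) (free_tensor_eval \<phi> q)) (free_tensor_eval \<phi> p)"
proof -
  interpret K: vector_space "(*) :: 'k \<Rightarrow> 'k \<Rightarrow> 'k" by (rule vector_space_mult)
  show ?thesis
    unfolding free_tensor_eval_def K.lext_fext lext_times[OF vector_space_mult]
    by (simp add: plus_word_def lext_foldr_ftimes case_prod_unfold K.lext_swap[of _ _ q] del: foldr_append)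
qed

lemma lext_free_tensor_eval:
  fixes \<phi> :: "'g \<Rightarrow> ('a::ring_1 \<times> 'b::ring_1 \<Rightarrow>\<^sub>0 'k::field)"
  shows "lext (*) F (free_tensor_eval \<phi> (p + q)) = lext (*) F (free_tensor_eval \<phi> p) + lext (*) F (free_tensor_eval \<phi> q)"
  "lext (*) F (free_tensor_eval \<phi> (p - q)) = lext (*) F (free_tensor_eval \<phi> p) - lext (*) F (free_tensor_eval \<phi> q)"
  "lext (*) F (free_tensor_eval \<phi> (fscale r p)) = r * lext (*) F (free_tensor_eval \<phi> p)"
  "lext (*) F (free_tensor_eval \<phi> 0) = 0"
  "lext (*) F (free_tensor_eval \<phi> 1) = F (1, 1)"
  "lext (*) F (free_tensor_eval \<phi> (fgen g)) = lext (*) F (\<phi> g)"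
  using lext_ftimes[OF vector_space_mult, of "\<lambda>a b. F (a, b)"]
  by (simp_all add: free_tensor_eval_def vector_space.lext_fext[OF vector_space_mult] lext_field
      lext_one_field zero_word_def)

text \<open>
  The elements of the free algebra whose coproduct vanishes form an ideal. It contains the
  relations of \<open>I0\<close>; for example, the square of \<open>h \<otimes> c + 1 \<otimes> h\<close> is
  \<open>h\<^sup>2 \<otimes> c\<^sup>2 + h \<otimes> (ch + hc) + 1 \<otimes> h\<^sup>2\<close>.
\<close>

lemma cdh_comult_free_I0:
  assumes "p \<in> I0"
  shows "cdh_comult_free p \<in> bilin_rels cdh_scale (cdh_scale :: 'k::field \<Rightarrow> _)"
proof -
  define K where "K = {p. \<forall>\<beta>. bilin cdh_scale (cdh_scale :: 'k \<Rightarrow> _) (*) \<beta> \<longrightarrow>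
    lext (*) (\<lambda>(a, b). \<beta> a b) (cdh_comult_free p) = 0}"
  note lt = lext_free_tensor_eval lext_free_tensor_eval_mult
  have "I0 \<subseteq> K"
  proof (rule I0_subset)
    have "r * a \<in> K" "a * r \<in> K" if a: "a \<in> K" for a r
    proof -
      show "r * a \<in> K"
        unfolding K_def
      proof (intro CollectI allI impI)
        fix \<beta> assume \<beta>: "bilin cdh_scale (cdh_scale :: 'k \<Rightarrow> _) (*) \<beta>"
        have "lext (*) (\<lambda>(a', b'). \<beta> (x * a') (y * b')) (cdh_comult_free a) = 0" for x y
          using a bilin_mult(1)[OF k_algebra_cdh k_algebra_cdh \<beta>] unfolding K_def by blast
        then show "lext (*) (\<lambda>(a, b). \<beta> a b) (cdh_comult_free (r * a)) = 0"
          unfolding lt by (simp add: case_prod_unfold vector_space.lext_fun_zero[OF vector_space_mult])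
      qed
      show "a * r \<in> K"
        unfolding K_def
      proof (intro CollectI allI impI)
        fix \<beta> assume \<beta>: "bilin cdh_scale (cdh_scale :: 'k \<Rightarrow> _) (*) \<beta>"
        have "bilin cdh_scale cdh_scale (*)
            (\<lambda>x y. lext (*) (\<lambda>z. \<beta> (x * fst z) (y * snd z)) (cdh_comult_free r))"
          by (intro bilin_lext vector_space_mult bilin_mult(2)[OF k_algebra_cdh k_algebra_cdh \<beta>])
        with a have "lext (*) (\<lambda>(x, y). lext (*) (\<lambda>z. \<beta> (x * fst z) (y * snd z)) (cdh_comult_free r))
            (cdh_comult_free a) = 0"
          unfolding K_def by blast
        then show "lext (*) (\<lambda>(a, b). \<beta> a b) (cdh_comult_free (a * r)) = 0"
          unfolding lt by (simp add: case_prod_unfold)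
      qed
    qed
    moreover have "a - b \<in> K" if "a \<in> K" "b \<in> K" for a b
      using that by (simp add: K_def lt(2))
    moreover have "0 \<in> K" by (simp add: K_def lt(4))
    ultimately show "two_sided_ideal K" by (simp add: two_sided_ideal_def)
    have hc: "\<beta> x (cdh_h * cdh_c) + \<beta> x (cdh_c * cdh_h) = 0" "\<beta> (cdh_h * cdh_c) x + \<beta> (cdh_c * cdh_h) x = 0"
      if "bilin cdh_scale (cdh_scale :: 'k \<Rightarrow> _) (*) \<beta>" for \<beta> x
      using cdh_relations(4)[where 'k = 'k] bilin_simps[OF that] by metis+
    note rel = cdh_comult_gen_def lext_field case_prod_unfold cdh_relations(1-3)
    show "fgen gC * fgen gD - 1 \<in> K" "fgen gD * fgen gC - 1 \<in> K"
      by (simp_all add: K_def lt rel)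
    show "fgen gH * fgen gH \<in> K"
      unfolding K_def
    proof (intro CollectI allI impI)
      fix \<beta> assume \<beta>: "bilin cdh_scale (cdh_scale :: 'k \<Rightarrow> _) (*) \<beta>"
      show "lext (*) (\<lambda>(a, b). \<beta> a b) (cdh_comult_free (fgen gH * fgen gH)) = 0"
        using hc(1)[OF \<beta>, of cdh_h] by (simp add: lt rel bilin_simps[OF \<beta>] add.commute)
    qed
    show "fgen gH * fgen gC + fgen gC * fgen gH \<in> K"
      unfolding K_def
    proof (intro CollectI allI impI)
      fix \<beta> assume \<beta>: "bilin cdh_scale (cdh_scale :: 'k \<Rightarrow> _) (*) \<beta>"
      have "\<beta> (cdh_h * cdh_c) (cdh_c * cdh_c) + \<beta> cdh_c (cdh_h * cdh_c) +
        (\<beta> (cdh_c * cdh_h) (cdh_c * cdh_c) + \<beta> cdh_c (cdh_c * cdh_h)) = 0"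
        using hc(1)[OF \<beta>, of cdh_c] hc(2)[OF \<beta>, of "cdh_c * cdh_c"] by (simp add: algebra_simps)
      then show "lext (*) (\<lambda>(a, b). \<beta> a b) (cdh_comult_free (fgen gH * fgen gC + fgen gC * fgen gH)) = 0"
        by (simp add: lt rel)
    qed
  qed
  then show ?thesis
    using assms by (intro bilin_relsI) (auto simp: K_def)
qed

lemma comult_cdh_abs: "comult cdh_hopf (abs_cdh p) = tcls cdh_scale cdh_scale (cdh_comult_free p)"
proof -
  have "cdh_comult_free (rep_cdh (abs_cdh p)) - cdh_comult_free p = cdh_comult_free (rep_cdh (abs_cdh p) - p)"
    unfolding free_tensor_eval_def fext_conv_lext vector_space.lext_diff[OF vector_space_fscale] ..
  then show ?thesis
    using cdh_comult_free_I0[OF rep_abs_cdh, of p] by (simp add: cdh_hopf_def tcls_eq_iff)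
qed

lemma comult_cdh_gen:
  shows "comult (cdh_hopf :: ('k::field, 'k cdh) hopf) cdh_c = tcls cdh_scale cdh_scale (fbasis (cdh_c, cdh_c))"
  "comult (cdh_hopf :: ('k::field, 'k cdh) hopf) cdh_d = tcls cdh_scale cdh_scale (fbasis (cdh_d, cdh_d))"
  "comult (cdh_hopf :: ('k::field, 'k cdh) hopf) cdh_h = tcls cdh_scale cdh_scale (fbasis (cdh_h, cdh_c) + fbasis (1, cdh_h))"
  "comult (cdh_hopf :: ('k::field, 'k cdh) hopf) 1 = tcls cdh_scale cdh_scale (fbasis (1, 1))"
proof -
  have "tcls cdh_scale cdh_scale (cdh_comult_free p) = tcls cdh_scale cdh_scale f"
    if "\<And>\<beta>. lext (*) (\<lambda>(a, b). \<beta> a b) (cdh_comult_free p) = lext (*) (\<lambda>(a, b). \<beta> a b) f"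
    for p and f :: "'k cdh \<times> 'k cdh \<Rightarrow>\<^sub>0 'k"
    unfolding tcls_eq_iff using that by (intro bilin_relsI) (simp add: lext_field)
  note * = this
  have gen: "comult cdh_hopf (abs_cdh (fgen g)) =
      tcls cdh_scale cdh_scale (cdh_comult_gen g :: 'k cdh \<times> 'k cdh \<Rightarrow>\<^sub>0 'k)" for g
    unfolding comult_cdh_abs by (rule *) (simp add: lext_free_tensor_eval)
  show "comult cdh_hopf cdh_c = tcls cdh_scale cdh_scale (fbasis (cdh_c, cdh_c :: 'k cdh))"
    using gen[of gC] by (simp add: cdh_comult_gen_def flip: cdh_c_def)
  show "comult cdh_hopf cdh_d = tcls cdh_scale cdh_scale (fbasis (cdh_d, cdh_d :: 'k cdh))"
    using gen[of gD] by (simp add: cdh_comult_gen_def flip: cdh_d_def)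
  show "comult cdh_hopf cdh_h = tcls cdh_scale cdh_scale (fbasis (cdh_h, cdh_c) + fbasis (1, cdh_h :: 'k cdh))"
    using gen[of gH] by (simp add: cdh_comult_gen_def flip: cdh_h_def)
  have "comult cdh_hopf (abs_cdh 1) = tcls cdh_scale cdh_scale (fbasis (1, 1 :: 'k cdh))"
    unfolding comult_cdh_abs by (rule *) (simp add: lext_free_tensor_eval lext_field)
  then show "comult cdh_hopf 1 = tcls cdh_scale cdh_scale (fbasis (1, 1 :: 'k cdh))"
    by (simp flip: abs_cdh_hom(1))
qed

lemma cdh_h_d: "cdh_h * cdh_d = - (cdh_d * cdh_h :: 'k::field cdh)"
proof -
  have "cdh_d * (cdh_h * cdh_c + cdh_c * cdh_h) * cdh_d = (0 :: 'k cdh)"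
    by (simp only: cdh_relations(4)) simp
  moreover have "cdh_d * (cdh_h * cdh_c + cdh_c * cdh_h) * cdh_d =
      cdh_d * cdh_h * (cdh_c * cdh_d) + (cdh_d * cdh_c) * cdh_h * (cdh_d :: 'k cdh)"
    by (simp only: distrib_left distrib_right mult.assoc)
  ultimately have "cdh_d * cdh_h + cdh_h * cdh_d = (0 :: 'k cdh)"
    by (simp only: cdh_relations) simp
  then show ?thesis by (simp add: eq_neg_iff_add_eq_0 add.commute)
qed

text \<open>
  The antihomomorphism on the free algebra kills \<open>I0\<close>, since \<open>hd = - dh\<close> turns \<open>(hd)\<^sup>2\<close> into a
  multiple of \<open>h\<^sup>2\<close> and makes \<open>dhd\<close> and \<open>hd\<^sup>2\<close> cancel.
\<close>

lemma antipode_cdh: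
  fixes x y :: "'k::field cdh"
  shows "Vector_Spaces.linear cdh_scale cdh_scale (antipode (cdh_hopf :: ('k, _) hopf))"
    and "antipode cdh_hopf (x * y) = antipode cdh_hopf y * antipode cdh_hopf x"
    and "antipode cdh_hopf 1 = (1 :: 'k cdh)" "antipode cdh_hopf cdh_c = (cdh_d :: 'k cdh)"
      "antipode cdh_hopf cdh_d = (cdh_c :: 'k cdh)" "antipode cdh_hopf cdh_h = - (cdh_h * cdh_d :: 'k cdh)"
proof -
  define S :: "(cdh_gen, 'k) free_alg \<Rightarrow> 'k cdh" where "S = free_anti_eval cdh_scale cdh_antipode_gen"
  have add: "S (p + q) = S p + S q" and diff: "S (p - q) = S p - S q"
    and scale: "S (fscale r p) = cdh_scale r (S p)" and zero: "S 0 = 0" for p q r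
    by (simp_all add: S_def free_anti_eval_conv_lext cdh.lext_add cdh.lext_diff cdh.lext_fscale)
  have one: "S 1 = 1"
    by (simp add: S_def free_anti_eval_conv_lext zero_word_def cdh.lext_single flip: single_one)
  have gen: "S (fgen g) = cdh_antipode_gen g" for g
    by (simp add: S_def free_anti_eval_conv_lext)
  have mult: "S (p * q) = S q * S p" for p q
    unfolding S_def free_anti_eval_conv_lext lext_times[OF cdh.vector_space_axioms]
    by (simp add: plus_word_def lext_def cdh.scale_sum_right sum_distrib_left sum_distrib_right
          cdh.scale_mult_left cdh.scale_mult_right mult.commute)
  have hdhd: "cdh_h * cdh_d * (cdh_h * cdh_d) = (0 :: 'k cdh)"
  proof -
    have "cdh_h * cdh_d * (cdh_h * cdh_d) = - (cdh_h * cdh_d) * (cdh_d * cdh_h :: 'k cdh)"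
      by (simp add: cdh_h_d)
    also have "\<dots> = (cdh_d * cdh_h) * (cdh_d * cdh_h)" by (simp add: cdh_h_d)
    also have "\<dots> = cdh_d * (cdh_h * cdh_d) * cdh_h" by (simp only: mult.assoc)
    also have "\<dots> = - (cdh_d * cdh_d * (cdh_h * cdh_h))" by (simp add: cdh_h_d mult.assoc)
    finally show ?thesis by (simp add: cdh_relations)
  qed
  have "I0 \<subseteq> {p. S p = 0}"
  proof (rule I0_subset)
    show "two_sided_ideal {p. S p = 0}" by (simp add: two_sided_ideal_def zero diff mult)
    show "fgen gH * fgen gC + fgen gC * fgen gH \<in> {p. S p = 0}"
      by (simp add: add mult gen cdh_antipode_gen_def mult.assoc cdh_h_d)
  qed (simp_all add: diff mult gen one cdh_antipode_gen_def cdh_relations hdhd)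
  then have abs: "antipode cdh_hopf (abs_cdh p) = S p" for p
    using rep_abs_cdh[of p] diff[of "rep_cdh (abs_cdh p)" p] by (auto simp: cdh_hopf_def S_def)
  have a: "antipode cdh_hopf (x + y) = antipode cdh_hopf x + antipode cdh_hopf y" for x y :: "'k cdh"
    by (cases x rule: cdh_cases; cases y rule: cdh_cases; simp add: abs_cdh_hom(2) abs add)
  have sc: "antipode cdh_hopf (cdh_scale r x) = cdh_scale r (antipode cdh_hopf x)" for x :: "'k cdh" and r
    by (cases x rule: cdh_cases; simp add: abs_cdh_hom(4) abs scale)
  have m: "antipode cdh_hopf (x * y) = antipode cdh_hopf y * antipode cdh_hopf x" for x y :: "'k cdh"
    by (cases x rule: cdh_cases; cases y rule: cdh_cases; simp add: abs_cdh_hom(3) abs mult)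
  show "Vector_Spaces.linear cdh_scale cdh_scale (antipode (cdh_hopf :: ('k, _) hopf))"
    by (simp add: Vector_Spaces.linear_iff cdh.vector_space_axioms a sc)
  show "antipode cdh_hopf (x * y) = antipode cdh_hopf y * antipode cdh_hopf x" by (rule m)
  show "antipode cdh_hopf 1 = (1 :: 'k cdh)"
    by (subst abs_cdh_hom(1)) (simp only: abs one)
  show "antipode cdh_hopf cdh_c = (cdh_d :: 'k cdh)" "antipode cdh_hopf cdh_d = (cdh_c :: 'k cdh)"
    "antipode cdh_hopf cdh_h = - (cdh_h * cdh_d :: 'k cdh)"
    unfolding cdh_c_def[where 'k = 'k] cdh_d_def[where 'k = 'k] cdh_h_def[where 'k = 'k] abs gen
    by (simp_all add: cdh_antipode_gen_def cdh_c_def cdh_d_def cdh_h_def)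
qed

lemma counit_cdh: "counit cdh_hopf = cdh_eval (*) cdh_counit_gen"
  by (simp add: cdh_hopf_def cdh_eval_def fun_eq_iff)

lemma scl_cdh: "scl cdh_hopf = cdh_scale"
  by (simp add: cdh_hopf_def)

lemmas counit_cdh_eval = cdh_eval[OF k_algebra_mult, of cdh_counit_gen, folded counit_cdh,
    simplified cdh_counit_gen_def cdh_gen.case, simplified]

lemma hopf_algebra_cdh: "hopf_algebra (cdh_hopf :: ('k::field, 'k cdh) hopf)"
proof (rule hopf_algebra_pointedI[where G = "{cdh_c, cdh_d}" and P = "{cdh_h}"])
  let ?H = "cdh_hopf :: ('k, 'k cdh) hopf"
  note [simp] = scl_cdh
  show "k_algebra (scl ?H)" by (simp add: k_algebra_cdh)
  show hom: "tensor_algebra_hom (scl ?H) (scl ?H) (scl ?H) (comult ?H)"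
  proof (rule tensor_algebra_homI)
    fix \<beta> assume "bilin (scl ?H) (scl ?H) (*) \<beta>"
    then have \<beta>: "bilin cdh_scale cdh_scale (*) \<beta>" by simp
    note t = comult_cdh_abs tlift_tcls_field[OF \<beta>] lext_free_tensor_eval lext_free_tensor_eval_mult
    note b = bilin_mult[OF k_algebra_cdh k_algebra_cdh \<beta>]
    show "tlift (*) \<beta> (comult ?H (x + y)) = tlift (*) \<beta> (comult ?H x) + tlift (*) \<beta> (comult ?H y)" for x y
      by (cases x rule: cdh_cases; cases y rule: cdh_cases; simp add: abs_cdh_hom(2) t)
    show "tlift (*) \<beta> (comult ?H (scl ?H r x)) = r * tlift (*) \<beta> (comult ?H x)" for r x
      by (cases x rule: cdh_cases; simp add: abs_cdh_hom(4) t)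
    show "tlift (*) \<beta> (comult ?H (x * y)) =
        tlift (*) (\<lambda>a b. tlift (*) (\<lambda>a' b'. \<beta> (a * a') (b * b')) (comult ?H y)) (comult ?H x)" for x y
    proof (cases x rule: cdh_cases; cases y rule: cdh_cases)
      fix p q assume x: "x = abs_cdh p" and y: "y = abs_cdh q"
      show ?thesis
        unfolding x y abs_cdh_hom(3) comult_cdh_abs
        unfolding t tlift_tcls_field[OF bilin_tlift[OF vector_space_mult b(2)]]
        unfolding tlift_tcls_field[OF b(1)] by (simp add: case_prod_unfold)
    qed
  qed (simp add: cdh_hopf_def)
  show "comult ?H 1 = tcls (scl ?H) (scl ?H) (fbasis (1, 1))" by (simp add: comult_cdh_gen)
  show "algebra_hom (scl ?H) (*) (counit ?H)" by (simp add: counit_cdh_eval(1))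
  show "Vector_Spaces.linear (scl ?H) (scl ?H) (antipode ?H)" by (simp add: antipode_cdh(1))
  show "alg_span (scl ?H) ({cdh_c, cdh_d} \<union> {cdh_h}) = UNIV"
    using alg_span_cdh by (simp add: insert_commute)
  show "comult ?H x = tcls (scl ?H) (scl ?H) (fbasis (x, x)) \<and> counit ?H x = 1 \<and>
      antipode ?H x * x = 1 \<and> x * antipode ?H x = 1" if "x \<in> {cdh_c, cdh_d}" for x
    using that by (auto simp: comult_cdh_gen counit_cdh_eval antipode_cdh cdh_relations)
  show "\<exists>g\<in>insert 1 {cdh_c, cdh_d}. \<exists>c\<in>insert 1 {cdh_c, cdh_d}.
      comult ?H x = tcls (scl ?H) (scl ?H) (fbasis (x, c) + fbasis (g, x)) \<and> counit ?H x = 0 \<and>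
      antipode ?H x * c + antipode ?H g * x = 0 \<and> x * antipode ?H c + g * antipode ?H x = 0"
    if "x \<in> {cdh_h}" for x
    by (intro bexI[of _ 1] bexI[of _ cdh_c])
      (use that in \<open>simp_all add: comult_cdh_gen counit_cdh_eval antipode_cdh cdh_relations mult.assoc\<close>)
qed (simp_all add: antipode_cdh)

lemma skew_pair_cdh: "skew_pair cdh_hopf cdh_h cdh_c"
  by (simp add: skew_pair_def scl_cdh comult_cdh_gen cdh_relations counit_cdh_eval)

lemma rho5_eq: "rho5 = dn_coact cdh_hopf cdh_h cdh_c"
  by (simp add: rho5_def scl_cdh)

lemma sweedler_independent:
  "sweedler_c \<noteq> (1 :: 'k::field sweedler)" "sweedler_w \<noteq> sweedler_scale \<theta> (1 - sweedler_c :: 'k sweedler)"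
  by (simp_all add: sweedler_eq_iff sweedler_coord_mult)

text \<open>
  Nothing in the presentation shows directly that the quotient is large enough. The homomorphism
  to the Sweedler algebra with \<open>c, d \<mapsto> c\<close> and \<open>h \<mapsto> cv\<close> reduces the claim to a comparison of
  coordinates there.
\<close>

lemma cdh_independent:
  "cdh_c \<noteq> (1 :: 'k::field cdh)" "cdh_h \<noteq> cdh_scale \<theta> (1 - cdh_c :: 'k cdh)"
proof -
  define f :: "cdh_gen \<Rightarrow> 'k sweedler"
    where "f = case_cdh_gen sweedler_c sweedler_c sweedler_w"
  note e = cdh_eval[OF k_algebra_sweedler, of f]
  have "f gC * f gD = 1" "f gD * f gC = 1" "f gH * f gH = 0" "f gH * f gC + f gC * f gH = 0"
    by (simp_all add: f_def sweedler_mult_table)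
  note e = e[OF this]
  note D = algebra_homD[OF e(1)]
  have f: "f gC = sweedler_c" "f gH = sweedler_w" by (simp_all add: f_def)
  show "cdh_c \<noteq> (1 :: 'k cdh)"
  proof
    assume "cdh_c = (1 :: 'k cdh)"
    with e(2) show False using sweedler_independent(1)[where 'k = 'k] by (simp add: D f)
  qed
  show "cdh_h \<noteq> cdh_scale \<theta> (1 - cdh_c :: 'k cdh)"
  proof
    assume h: "cdh_h = cdh_scale \<theta> (1 - cdh_c :: 'k cdh)"
    have "f gH = sweedler_scale \<theta> (1 - f gC)"
      unfolding e(4)[symmetric] h by (simp add: D e(2))
    with sweedler_independent(2)[where 'k = 'k] show False by (simp add: f)
  qed
qed

section \<open>The five coactions, classification and universality\<close>

lemma fbasis_neq_one:
  assumes "g \<noteq> 0"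
  shows "fbasis g \<noteq> (1 :: 'g::group_add \<Rightarrow>\<^sub>0 'k::field)"
proof -
  have "Poly_Mapping.lookup (fbasis g) 0 \<noteq> Poly_Mapping.lookup (1 :: 'g \<Rightarrow>\<^sub>0 'k) 0"
    using assms by (simp add: lookup_one lookup_single when_def)
  then show ?thesis by auto
qed

lemma cosupp_rho1: "cosupp dn_scale base_hopf rho1 = {upper_op \<alpha> 0 (\<alpha> :: 'k::field) | \<alpha>. True}"
  unfolding rho1_eq by (rule cosupp_dn_coact_shape(1)[OF hopf_algebra_base skew_pair_base refl refl])

lemma cosupp_rho2:
  assumes "CHAR('k::field) = 2"
  shows "cosupp dn_scale dual_num_hopf rho2 = {upper_op \<alpha> \<beta> (\<alpha> :: 'k) | \<alpha> \<beta>. True}"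
  unfolding rho2_eq[OF assms]
  by (rule cosupp_dn_coact_shape(2)[OF hopf_algebra_dual_num[OF assms] skew_pair_dual_num[OF assms] _ refl])
    (simp add: dn_eq_iff)

lemma cosupp_rho3:
  assumes "CHAR('k::field) = 2" "\<theta> \<noteq> 0"
  shows "cosupp dn_scale kC2 (rho3 \<theta>) = {upper_op \<alpha> (\<theta> * (\<alpha> + \<delta>)) (\<delta> :: 'k) | \<alpha> \<delta>. True}"
  unfolding rho3_eq[OF assms]
  by (rule cosupp_dn_coact_shape(3)[OF hopf_algebra_group skew_pair_kC2[OF assms]])
    (simp_all add: group_hopf_simps fbasis_neq_one)

lemma cosupp_rho4: "cosupp dn_scale kCinf rho4 = {upper_op \<alpha> 0 (\<delta> :: 'k::field) | \<alpha> \<delta>. True}"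
  unfolding rho4_eq
  by (rule cosupp_dn_coact_shape(4)[OF hopf_algebra_group skew_pair_group refl fbasis_neq_one]) simp

lemma cosupp_rho4a: "cosupp dn_scale kC2 rho4a = {upper_op \<alpha> 0 (\<delta> :: 'k::field) | \<alpha> \<delta>. True}"
  unfolding rho4a_eq
  by (rule cosupp_dn_coact_shape(4)[OF hopf_algebra_group skew_pair_group refl fbasis_neq_one]) simp

lemma cosupp_rho5: "cosupp dn_scale cdh_hopf rho5 = {upper_op \<alpha> \<beta> (\<delta> :: 'k::field) | \<alpha> \<beta> \<delta>. True}"
  unfolding rho5_eq
  by (rule cosupp_dn_coact_shape(5)[OF hopf_algebra_cdh skew_pair_cdh cdh_independent(1)])
    (simp add: scl_cdh cdh_independent(2))

lemma cosupp_rho5a: "cosupp dn_scale sweedler_hopf rho5a = {upper_op \<alpha> \<beta> (\<delta> :: 'k::field) | \<alpha> \<beta> \<delta>. True}"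
  unfolding rho5a_eq
  by (rule cosupp_dn_coact_shape(5)[OF hopf_algebra_sweedler skew_pair_sweedler sweedler_independent(1)])
    (simp add: sweedler_hopf_simps sweedler_independent(2))

text \<open>
  The five cases are the possible linear relations between \<open>1\<close>, \<open>h\<close> and \<open>c\<close>, and each of the
  listed coactions realizes one of them.
\<close>

lemma unital_coaction_classification:
  fixes H :: "('k::field, 'h::ring_1) hopf"
  assumes H: "hopf_algebra H" and u: "unital_coaction dn_scale H \<rho>"
  shows "cosupp dn_scale H \<rho> = cosupp dn_scale base_hopf rho1 \<or>
    CHAR('k) = 2 \<and> cosupp dn_scale H \<rho> = cosupp dn_scale dual_num_hopf rho2 \<or>
    CHAR('k) = 2 \<and> (\<exists>\<theta>. \<theta> \<noteq> 0 \<and> cosupp dn_scale H \<rho> = cosupp dn_scale kC2 (rho3 \<theta>)) \<or>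
    cosupp dn_scale H \<rho> = cosupp dn_scale kCinf rho4 \<or>
    cosupp dn_scale H \<rho> = cosupp dn_scale cdh_hopf rho5"
proof -
  obtain h c where p: "skew_pair H h c" and \<rho>: "\<rho> = dn_coact H h c"
    using unital_coaction_skew_pair[OF H u] .
  interpret H: hopf_algebra H by fact
  note shape = cosupp_dn_coact_shape[OF H p, folded \<rho>]
  consider "h = 0" "c = 1" | "h \<noteq> 0" "c = 1" | "h = 0" "c \<noteq> 1" |
    \<theta> where "\<theta> \<noteq> 0" "h = scl H \<theta> (1 - c)" "c \<noteq> 1" | "c \<noteq> 1" "\<And>\<theta>. h \<noteq> scl H \<theta> (1 - c)"
    by (metis H.scale_zero_left)
  then show ?thesis
  proof cases
    case 1
    then show ?thesis using shape(1) by (simp add: cosupp_rho1)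
  next
    case 2
    then show ?thesis using shape(2) skew_pair_trivial_grouplike[OF H, of h] p by (simp add: cosupp_rho2)
  next
    case 3
    then show ?thesis using shape(4) by (simp add: cosupp_rho4)
  next
    case 4
    \<comment> \<open>In characteristic 2 the relation takes the form \<open>h = \<theta> (1 + c)\<close> of the group algebra.\<close>
    note d = skew_pair_dependent[OF H p[unfolded 4(2)] 4(1,3)]
    have "h = scl H \<theta> (1 + c)" using 4(2) d(2) by simp
    then have "cosupp dn_scale H \<rho> = cosupp dn_scale kC2 (rho3 \<theta>)"
      unfolding cosupp_rho3[OF d(1) 4(1)] using 4(3) by (rule shape(3))
    with 4(1) d(1) show ?thesis by blast
  next
    case 5
    then show ?thesis using shape(5) by (simp add: cosupp_rho5)
  qed
qed

lemma skew_pair_inverse: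
  assumes "hopf_algebra H" "skew_pair H h c"
  shows "c * antipode H c = 1" "antipode H c * c = 1"
  using hopf_algebra.grouplike_antipode[OF assms(1)] assms(2) by (auto simp: skew_pair_def)

text \<open>
  Translates a condition on the operators of a cosupport into a relation in \<open>H\<close>. For \<open>\<theta> = 0\<close> it
  yields \<open>y = 0\<close>.
\<close>

lemma eq_scalar_combination:
  assumes H: "hopf_algebra H"
    and "\<And>l. Vector_Spaces.linear (scl H) (*) l \<Longrightarrow> l y = \<theta> * (l 1 + l c)"
  shows "y = scl H \<theta> (1 + c)"
proof (rule functionals_separate_points[OF hopf_algebra.vs[OF H]])
  fix l assume "Vector_Spaces.linear (scl H) (*) l"
  then show "l y = l (scl H \<theta> (1 + c))"
    using assms(2) by (simp add: Vector_Spaces.linear_iff)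
qed

lemma universal_rho1: "V_universal TYPE('h::ring_1) dn_scale (cosupp dn_scale base_hopf rho1) (base_hopf :: ('k::field, 'k) hopf) rho1"
  unfolding rho1_eq
proof (rule V_universal_dn_coact[OF hopf_algebra_base skew_pair_base])
  have "r \<in> alg_span (*) {1, antipode base_hopf 1, 0}" for r :: 'k
    using alg_span.scale[OF alg_span.one, of "(*)" r] by simp
  then show "alg_span (scl base_hopf) {1, antipode base_hopf 1, 0 :: 'k} = UNIV"
    by (auto simp: base_hopf_def)
  fix H :: "('k, 'h) hopf" and h c
  assume H: "hopf_algebra H" and p: "skew_pair H h c"
    and V: "\<And>l. Vector_Spaces.linear (scl H) (*) l \<Longrightarrow>
      upper_op (l 1) (l h) (l c) \<in> cosupp dn_scale base_hopf (dn_coact base_hopf 0 1)"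
  interpret H: hopf_algebra H by fact
  have l: "l h = 0" "l c = l 1" if "Vector_Spaces.linear (scl H) (*) l" for l
    using V[OF that] unfolding cosupp_rho1[unfolded rho1_eq] by (auto simp: upper_op_eq_iff)
  have "c = 1" by (rule functionals_separate_points[OF H.vs l(2)])
  moreover have "h = scl H 0 (1 + c)" by (rule eq_scalar_combination[OF H]) (simp add: l)
  ultimately show "\<exists>\<phi>. algebra_hom (scl base_hopf) (scl H) \<phi> \<and> \<phi> 0 = h \<and> \<phi> 1 = c"
    by (intro exI[of _ "\<lambda>r. scl H r 1"] conjI algebra_homI)
      (simp_all add: base_hopf_def k_algebra_mult H.k_alg H.scale_left_distrib H.scale_mult_left)
qed

lemma universal_rho2:
  assumes "CHAR('k::field) = 2"
  shows "V_universal TYPE('h::ring_1) dn_scale (cosupp dn_scale dual_num_hopf rho2) (dual_num_hopf :: ('k, 'k dual_num) hopf) rho2"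
  unfolding rho2_eq[OF assms]
proof (rule V_universal_dn_coact[OF hopf_algebra_dual_num[OF assms] skew_pair_dual_num[OF assms]])
  note [simp] = dual_num_hopf_simps[OF assms]
  have "alg_span dn_scale {dn_x :: 'k dual_num} \<subseteq> alg_span dn_scale {1, antipode dual_num_hopf 1, dn_x}"
    by (rule alg_span_trans) (auto intro: alg_span.gen)
  then show "alg_span (scl dual_num_hopf) {1, antipode dual_num_hopf 1, dn_x :: 'k dual_num} = UNIV"
    by (simp add: alg_span_dn top.extremum_unique)
  fix H :: "('k, 'h) hopf" and h c
  assume H: "hopf_algebra H" and p: "skew_pair H h c"
    and V: "\<And>l. Vector_Spaces.linear (scl H) (*) l \<Longrightarrow>
      upper_op (l 1) (l h) (l c) \<in> cosupp dn_scale dual_num_hopf (dn_coact dual_num_hopf dn_x 1)"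
  interpret H: hopf_algebra H by fact
  have "l c = l 1" if "Vector_Spaces.linear (scl H) (*) l" for l
    using V[OF that] unfolding cosupp_rho2[OF assms, unfolded rho2_eq[OF assms]] by (auto simp: upper_op_eq_iff)
  then have c: "c = 1" by (rule functionals_separate_points[OF H.vs])
  have hh: "h * h = 0" using p by (simp add: skew_pair_def)
  show "\<exists>\<phi>. algebra_hom (scl dual_num_hopf) (scl H) \<phi> \<and> \<phi> dn_x = h \<and> \<phi> 1 = c"
    by (intro exI[of _ "\<lambda>a. scl H (dn_coord1 a) 1 + scl H (dn_coordx a) h"] conjI algebra_homI)
      (simp_all add: k_algebra_dn H.k_alg c hh H.scale_left_distrib H.scale_right_distrib H.scale_mult_left H.scale_mult_right
        distrib_left distrib_right mult.commute)
qed

text \<open>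
  The operators in the cosupport force \<open>h = \<theta> (1 + c)\<close>, and then \<open>h\<^sup>2 = 0\<close> becomes \<open>c\<^sup>2 = 1\<close>.
\<close>

lemma universal_rho3:
  assumes "CHAR('k::field) = 2" "\<theta> \<noteq> 0"
  shows "V_universal TYPE('h::ring_1) dn_scale (cosupp dn_scale kC2 (rho3 \<theta>)) (kC2 :: ('k, bit \<Rightarrow>\<^sub>0 'k) hopf) (rho3 \<theta>)"
  unfolding rho3_eq[OF assms]
proof (rule V_universal_dn_coact[OF hopf_algebra_group skew_pair_kC2[OF assms]])
  let ?h = "fscale \<theta> (1 + fbasis 1) :: bit \<Rightarrow>\<^sub>0 'k"
  show "alg_span (scl kC2) {fbasis 1, antipode kC2 (fbasis 1), ?h} = UNIV"
    unfolding group_hopf_simps by (rule alg_span_kC2) simp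
  fix H :: "('k, 'h) hopf" and h c
  assume H: "hopf_algebra H" and p: "skew_pair H h c"
    and V: "\<And>l. Vector_Spaces.linear (scl H) (*) l \<Longrightarrow>
      upper_op (l 1) (l h) (l c) \<in> cosupp dn_scale kC2 (dn_coact kC2 ?h (fbasis 1))"
  interpret H: hopf_algebra H by fact
  have "l h = \<theta> * (l 1 + l c)" if "Vector_Spaces.linear (scl H) (*) l" for l
    using V[OF that] unfolding cosupp_rho3[OF assms, unfolded rho3_eq[OF assms]] by (auto simp: upper_op_eq_iff)
  then have h: "h = scl H \<theta> (1 + c)" by (rule eq_scalar_combination[OF H])
  have double: "y + y = 0" for y :: 'h
  proof -
    have "y + y = scl H (1 + 1) y" by (simp only: H.scale_left_distrib) simp
    also have "\<dots> = 0" by (simp only: double_eq_0[OF assms(1)] H.scale_zero_left)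
    finally show ?thesis .
  qed
  have "scl H \<theta> (scl H \<theta> ((1 + c) * (1 + c))) = 0"
    using p by (simp add: skew_pair_def h H.scale_mult_left H.scale_mult_right)
  then have "(1 + c) * (1 + c) = 0" using assms(2) by (simp only: H.scale_eq_0_iff) simp
  then have "1 + c * c + (c + c) = 0" by (simp only: distrib_left distrib_right mult_1_left mult_1_right ac_simps)
  then have "c * c + 1 = 1 + 1" by (simp only: double add_0_right) (simp only: add.commute)
  then have "c * c = 1" by (simp only: add_right_cancel)
  then obtain \<phi> where \<phi>: "algebra_hom fscale (scl H) \<phi>" "\<phi> (fbasis (1 :: bit)) = c"
    using kC2_universal_map[OF H.k_alg] by blast
  then show "\<exists>\<phi>. algebra_hom (scl kC2) (scl H) \<phi> \<and> \<phi> ?h = h \<and> \<phi> (fbasis 1) = c"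
    by (intro exI[of _ \<phi>]) (simp add: group_hopf_simps algebra_homD[OF \<phi>(1)] h)
qed

lemma universal_rho4:
  "V_universal TYPE('h::ring_1) dn_scale (cosupp dn_scale kCinf rho4) (kCinf :: ('k::field, int \<Rightarrow>\<^sub>0 'k) hopf) rho4"
  unfolding rho4_eq
proof (rule V_universal_dn_coact[OF hopf_algebra_group skew_pair_group])
  have "antipode kCinf (fbasis 1) = (fbasis (- 1) :: int \<Rightarrow>\<^sub>0 'k)"
    by (simp add: group_hopf_simps vector_space.lext_fbasis[OF vector_space_fscale])
  then show "alg_span (scl kCinf) {fbasis 1, antipode kCinf (fbasis 1), 0 :: int \<Rightarrow>\<^sub>0 'k} = UNIV"
    by (simp add: group_hopf_simps(1) alg_span_kCinf)
  fix H :: "('k, 'h) hopf" and h c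
  assume H: "hopf_algebra H" and p: "skew_pair H h c"
    and V: "\<And>l. Vector_Spaces.linear (scl H) (*) l \<Longrightarrow>
      upper_op (l 1) (l h) (l c) \<in> cosupp dn_scale kCinf (dn_coact kCinf 0 (fbasis 1))"
  interpret H: hopf_algebra H by fact
  have "l h = 0" if "Vector_Spaces.linear (scl H) (*) l" for l
    using V[OF that] unfolding cosupp_rho4[unfolded rho4_eq] by (auto simp: upper_op_eq_iff)
  then have "h = scl H 0 (1 + c)" by (intro eq_scalar_combination[OF H]) simp
  moreover obtain \<phi> where \<phi>: "algebra_hom fscale (scl H) \<phi>" "\<phi> (fbasis (1 :: int)) = c"
    using kCinf_universal_map[OF H.k_alg skew_pair_inverse[OF H p]] by blast
  ultimately show "\<exists>\<phi>. algebra_hom (scl kCinf) (scl H) \<phi> \<and> \<phi> 0 = h \<and> \<phi> (fbasis 1) = c"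
    by (intro exI[of _ \<phi>]) (simp add: group_hopf_simps algebra_homD[OF \<phi>(1)])
qed

text \<open>
  The relations of \<open>k\<langle>c,d,h\<rangle>/I\<^sub>0\<close> are the algebra relations of a skew pair, with \<open>d\<close> as the inverse
  of \<open>c\<close>.
\<close>

lemma universal_rho5:
  "V_universal TYPE('h::ring_1) dn_scale (cosupp dn_scale cdh_hopf rho5) (cdh_hopf :: ('k::field, 'k cdh) hopf) rho5"
  unfolding rho5_eq
proof (rule V_universal_dn_coact[OF hopf_algebra_cdh skew_pair_cdh])
  show "alg_span (scl cdh_hopf) {cdh_c, antipode cdh_hopf cdh_c, cdh_h :: 'k cdh} = UNIV"
    by (simp add: scl_cdh antipode_cdh alg_span_cdh)
  fix H :: "('k, 'h) hopf" and h c
  assume H: "hopf_algebra H" and p: "skew_pair H h c"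
  interpret H: hopf_algebra H by fact
  define f where "f = case_cdh_gen c (antipode H c) h"
  have "f gC * f gD = 1" "f gD * f gC = 1" "f gH * f gH = 0" "f gH * f gC + f gC * f gH = 0"
    using skew_pair_inverse[OF H p] p by (simp_all add: f_def skew_pair_def)
  note e = cdh_eval[OF H.k_alg, of f, OF this]
  show "\<exists>\<phi>. algebra_hom (scl cdh_hopf) (scl H) \<phi> \<and> \<phi> cdh_h = h \<and> \<phi> cdh_c = c"
    using e(1,2,4) by (intro exI[of _ "cdh_eval (scl H) f"]) (simp add: scl_cdh f_def)
qed

lemma unital_coaction_rho4a: "unital_coaction dn_scale kC2 rho4a"
  unfolding rho4a_eq by (rule unital_coaction_dn_coact[OF hopf_algebra_group skew_pair_group])

lemma unital_coaction_rho5a: "unital_coaction dn_scale sweedler_hopf rho5a"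
  unfolding rho5a_eq by (rule unital_coaction_dn_coact[OF hopf_algebra_sweedler skew_pair_sweedler])

lemma V_universalD:
  "V_universal TH sA V H0 \<rho>0 \<Longrightarrow> hopf_algebra H0"
  "V_universal TH sA V H0 \<rho>0 \<Longrightarrow> unital_coaction sA H0 \<rho>0"
  by (simp_all add: V_universal_def)

theorem theorem5p3:
  shows
    "(\<forall>(H :: ('k::field, 'h::ring_1) hopf) \<rho>.
       hopf_algebra H \<and> unital_coaction dn_scale H \<rho> \<longrightarrow>
         equivalent_via id dn_scale H \<rho> dn_scale base_hopf rho1 \<or>
         CHAR('k) = 2 \<and> equivalent_via id dn_scale H \<rho> dn_scale dual_num_hopf rho2 \<or>
         CHAR('k) = 2 \<and> (\<exists>\<theta>. \<theta> \<noteq> 0 \<and> equivalent_via id dn_scale H \<rho> dn_scale kC2 (rho3 \<theta>)) \<or>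
         equivalent_via id dn_scale H \<rho> dn_scale kCinf rho4 \<or>
         equivalent_via id dn_scale H \<rho> dn_scale cdh_hopf rho5)
     \<and>
     (let H = base_hopf :: ('k, 'k) hopf; V = cosupp dn_scale H rho1 in
        hopf_algebra H \<and>
        unital_coaction dn_scale H rho1 \<and>
        V = {dn_scale \<alpha> | \<alpha>. True} \<and>
        vector_space.dim (op_scale dn_scale) V = 1 \<and>
        V_universal TYPE('h) dn_scale V H rho1)
     \<and>
     (CHAR('k) = 2 \<longrightarrow>
       (let H = dual_num_hopf :: ('k, 'k dual_num) hopf; V = cosupp dn_scale H rho2 in
        hopf_algebra H \<and>
        unital_coaction dn_scale H rho2 \<and>
        V = {T. \<exists>\<alpha> \<beta>. has_matrix T \<alpha> \<beta>
                                       0 \<alpha>} \<and>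
        vector_space.dim (op_scale dn_scale) V = 2 \<and>
        V_universal TYPE('h) dn_scale V H rho2))
     \<and>
     (CHAR('k) = 2 \<longrightarrow> (\<forall>\<theta> :: 'k. \<theta> \<noteq> 0 \<longrightarrow>
       (let H = kC2 :: ('k, bit \<Rightarrow>\<^sub>0 'k) hopf; V = cosupp dn_scale H (rho3 \<theta>) in
        hopf_algebra H \<and>
        algebra_iso dn_scale (scl H) (dn_kC2 \<theta>) \<and>
        unital_coaction dn_scale H (rho3 \<theta>) \<and>
        (\<forall>g. rho3 \<theta> (inv (dn_kC2 \<theta>) (fbasis g)) =
             tcls dn_scale (scl H) (fbasis (inv (dn_kC2 \<theta>) (fbasis g), fbasis g))) \<and>
        V = {T. \<exists>\<alpha> \<beta>. has_matrix T \<alpha> (\<theta> * (\<alpha> + \<beta>))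
                                       0 \<beta>} \<and>
        vector_space.dim (op_scale dn_scale) V = 2 \<and>
        V_universal TYPE('h) dn_scale V H (rho3 \<theta>))))
     \<and>
     (let H = kCinf :: ('k, int \<Rightarrow>\<^sub>0 'k) hopf; V = cosupp dn_scale H rho4;
          Ha = kC2 :: ('k, bit \<Rightarrow>\<^sub>0 'k) hopf in
        hopf_algebra H \<and>
        unital_coaction dn_scale H rho4 \<and>
        V = {T. \<exists>\<alpha> \<beta>. has_matrix T \<alpha> 0
                                       0 \<beta>} \<and>
        vector_space.dim (op_scale dn_scale) V = 2 \<and>
        V_universal TYPE('h) dn_scale V H rho4 \<and>
        hopf_algebra Ha \<and>
        (\<exists>B. finite_dimensional_vector_space (scl Ha) B) \<and>
        unital_coaction dn_scale Ha rho4a \<and>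
        equivalent_via id dn_scale Ha rho4a dn_scale H rho4)
     \<and>
     (let H = cdh_hopf :: ('k, 'k cdh) hopf; V = cosupp dn_scale H rho5;
          Ha = sweedler_hopf :: ('k, 'k sweedler) hopf in
        hopf_algebra H \<and>
        unital_coaction dn_scale H rho5 \<and>
        V = {T. \<exists>\<alpha> \<beta> \<gamma>. has_matrix T \<alpha> \<beta>
                                         0 \<gamma>} \<and>
        vector_space.dim (op_scale dn_scale) V = 3 \<and>
        V_universal TYPE('h) dn_scale V H rho5 \<and>
        hopf_algebra Ha \<and>
        (\<exists>B. finite_dimensional_vector_space (scl Ha) B) \<and>
        unital_coaction dn_scale Ha rho5a \<and>
        equivalent_via id dn_scale Ha rho5a dn_scale H rho5)"
proof (intro conjI allI impI, goal_cases)
  case (1 H \<rho>)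
  then show ?case
    unfolding equivalent_via_id_iff by (intro unital_coaction_classification) auto
next
  case 2
  note u = universal_rho1[where 'k = 'k and 'h = 'h]
  show ?case
    using u V_universalD[OF u] cosupp_rho1[where 'k = 'k] dim_upper_ops(1)[where 'k = 'k]
    by (simp add: Let_def upper_op_scalar)
next
  case 3
  note u = universal_rho2[OF 3, where 'h = 'h]
  show ?case
    using u V_universalD[OF u] cosupp_rho2[OF 3] dim_upper_ops(2)[where 'k = 'k]
    by (simp add: Let_def has_matrix_iff_upper_op)
next
  case (4 \<theta>)
  note u = universal_rho3[OF 4, where 'h = 'h]
  show ?case
    using u V_universalD[OF u] cosupp_rho3[OF 4] dim_upper_ops(3)[of \<theta>] rho3_graded[OF 4]
      algebra_iso_dn_kC2[OF 4]
    by (simp add: Let_def has_matrix_iff_upper_op)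
next
  case 5
  note u = universal_rho4[where 'k = 'k and 'h = 'h]
  show ?case
    using u V_universalD[OF u] cosupp_rho4[where 'k = 'k] cosupp_rho4a[where 'k = 'k]
      kC2_finite_dimensional[where 'k = 'k] unital_coaction_rho4a
      \<comment> \<open>Putting \<open>\<theta> = 0\<close> turns the matrices of the family with parameter \<open>\<theta>\<close> into diagonal ones.\<close>
      dim_upper_ops(3)[of "0 :: 'k"]
    by (simp add: Let_def has_matrix_iff_upper_op hopf_algebra_group equivalent_via_id_iff)
next
  case 6
  note u = universal_rho5[where 'k = 'k and 'h = 'h]
  show ?case
    using u V_universalD[OF u] cosupp_rho5[where 'k = 'k] cosupp_rho5a[where 'k = 'k]
      sweedler_finite_dimensional[where 'k = 'k] unital_coaction_rho5a dim_upper_ops(4)[where 'k = 'k]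
    by (simp add: Let_def has_matrix_iff_upper_op hopf_algebra_sweedler equivalent_via_id_iff)
qed

end
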